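(* Let $F:\mathbb{R}^d\to\mathbb{R}$ be twice continuously differentiable and suppose there are constants $L,\mu,K>0$ such that for all $x,y\in\mathbb{R}^d$: (i) $\|\nabla F(x)-\nabla F(y)\|\le L\|x-y\|$; (ii) $\langle x-y,\nabla F(x)-\nabla F(y)\rangle\ge\mu\|x-y\|^2$; (iii) $\langle x-y,\nabla\nabla F(x)\nabla F(x)-\nabla\nabla F(y)\nabla F(y)\rangle\ge K\|x-y\|^2$. Let $X_\star$ be the unique minimizer of $F$. Let $h>0$ and let $X(t)$, $t\ge 0$, be the solution of the It\^o stochastic differential equation $$dX=-\nabla\left(F(X)+\frac{h}{4}\|\nabla F(X)\|^2\right)dt+\sqrt{h}\,\sqrt{\Sigma(X)}\,dW$$ with deterministic initial value $X(0)$, where $W$ is a standard $d$-dimensional Brownian motion and $$\Sigma(x)=d\sum_{i=1}^d U_i(\nabla F(x))(\nabla F(x))^TU_i^T-(\nabla F(x))(\nabla F(x))^T.$$ Then for all $t\ge 0$, $$\mathbb{E}\left[\|X(t)-X_\star\|^2\right]\le e^{-\alpha t}\|X(0)-X_\star\|^2,\qquad \alpha=2\mu-h\big((d-1)L^2-K\big).$$ Hence, if the timestep satisfies $h\le 2\mu/((d-1)L^2-K)$, then $$\lim_{t\to\infty}\mathbb{E}\|X(t)-X_\star\|^2=0.$$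
   Context: $\|\cdot\|$ is the Euclidean norm, $\langle\cdot,\cdot\rangle$ the Euclidean inner product, and $\nabla\nabla F$ the Hessian matrix of $F$. $\sqrt{\Sigma}$ denotes the principal (symmetric positive semidefinite) square root. For $i\in\{1,\dots,d\}$, $U_i\in\mathbb{R}^{d\times d}$ is the matrix whose $i$th column is the standard basis vector $e_i$ and whose other entries are zero. The matrix $\Sigma(x)$ is the covariance matrix of the stochastic coordinate descent estimator $d\,U_w\nabla F(x)$ with $w$ uniformly distributed on $\{1,\dots,d\}$ (hence positive semidefinite), and the SDE is the modified equation of the stochastic coordinate descent iteration $x_{n+1}=x_n-d\,h\,U_{w_n}\nabla F(x_n)$ with stepsize $h$, where the $w_n$ are drawn uniformly from $\{1,\dots,d\}$.
   Formalization: The limit is proved for h < 2μ/((d-1)L²-K) (or any h>0 if (d-1)L²-K ≤ 0), not for equality, where it fails: F=L‖x‖²/2, d≥3, μ=L, K=L², h=2/((d-2)L) gives constant E‖X(t)‖². *)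

theory Defs
  imports "HOL-Probability.Probability"
begin

section \<open>Gradient, Hessian, matrices\<close>

definition gradient :: "('a::euclidean_space \<Rightarrow> real) \<Rightarrow> 'a \<Rightarrow> 'a" where
  "gradient f x = (THE D. GDERIV f x :> D)"

definition hessian :: "(real^'n \<Rightarrow> real) \<Rightarrow> real^'n \<Rightarrow> real^'n^'n" where
  "hessian f x = jacobian (gradient f) (at x)"

text \<open>Continuity of the gradient itself follows from its differentiability.\<close>

definition twice_cont_diff :: "(real^'n \<Rightarrow> real) \<Rightarrow> bool" where
  "twice_cont_diff f \<longleftrightarrow>
     (\<forall>x. f differentiable (at x)) \<and>
     (\<forall>x. gradient f differentiable (at x)) \<and>
     continuous_on UNIV (hessian f)"

definition pos_semidef :: "real^'n^'n \<Rightarrow> bool" where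
  "pos_semidef A \<longleftrightarrow> transpose A = A \<and> (\<forall>v. 0 \<le> v \<bullet> (A *v v))"

text \<open>Principal square root; meaningful only for positive semidefinite \<open>A\<close>, for which it
  exists uniquely.\<close>

definition psd_sqrt :: "real^'n^'n \<Rightarrow> real^'n^'n" where
  "psd_sqrt A = (THE B. pos_semidef B \<and> B ** B = A)"

definition coord_matrix :: "'n \<Rightarrow> real^'n^'n" where
  "coord_matrix i = (\<chi> r c. if c = i then axis i 1 $ r else 0)"

text \<open>Covariance matrix of the stochastic coordinate descent estimator. The intermediate
  matrices \<open>columnvector\<close> and \<open>rowvector\<close> are indexed by the one-element type, so that
  \<open>columnvector g ** rowvector g\<close> is the outer product of \<open>g\<close> with itself.\<close>

definition scd_covariance :: "(real^'n \<Rightarrow> real) \<Rightarrow> real^'n \<Rightarrow> real^'n^'n" where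
  "scd_covariance f x =
     (let g = gradient f x;
          gc = (columnvector g :: real^1^'n);
          gr = (rowvector g :: real^'n^1)
      in real CARD('n) *\<^sub>R (\<Sum>i\<in>UNIV. coord_matrix i ** gc ** gr ** transpose (coord_matrix i))
           - gc ** gr)"

section \<open>Brownian motion and the It\^o integral\<close>

text \<open>Processes are indexed by \<open>real\<close>, but only times \<open>t \<ge> 0\<close> are ever constrained. The index
  set of the filtration is formally all of \<open>real\<close>; this is no restriction, as a filtration
  on \<open>[0,\<infinity>)\<close> extends by its value at \<open>0\<close>. No completeness or right-continuity of the
  filtration is required.\<close>

definition filtered_prob_space :: "'a measure \<Rightarrow> (real \<Rightarrow> 'a measure) \<Rightarrow> bool" where
  "filtered_prob_space M Ft \<longleftrightarrow>
     prob_space M \<and> filtration (space M) Ft \<and> (\<forall>t. subalgebra M (Ft t))"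

text \<open>Standard Brownian motion relative to the filtration: increments over \<open>[s,t]\<close> are
  independent of \<open>Ft s\<close> and distributed as \<open>N(0, (t-s) Id)\<close>. The last parameter
  of \<open>normal_density\<close> is the standard deviation.\<close>

definition brownian_motion ::
    "'a measure \<Rightarrow> (real \<Rightarrow> 'a measure) \<Rightarrow> (real \<Rightarrow> 'a \<Rightarrow> real^'n) \<Rightarrow> bool" where
  "brownian_motion M Ft W \<longleftrightarrow>
     (\<forall>t\<ge>0. W t \<in> borel_measurable (Ft t)) \<and>
     (\<forall>\<omega>\<in>space M. continuous_on {0..} (\<lambda>t. W t \<omega>)) \<and>
     (AE \<omega> in M. W 0 \<omega> = 0) \<and>
     (\<forall>s t. 0 \<le> s \<and> s < t \<longrightarrow>
        prob_space.indep_set M (sets (Ft s))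
          (sets (vimage_algebra (space M) (\<lambda>\<omega>. W t \<omega> - W s \<omega>) borel)) \<and>
        prob_space.indep_vars M (\<lambda>_. borel) (\<lambda>i \<omega>. (W t \<omega> - W s \<omega>) $ i) UNIV \<and>
        (\<forall>i. distributed M lborel (\<lambda>\<omega>. (W t \<omega> - W s \<omega>) $ i) (normal_density 0 (sqrt (t - s)))))"

text \<open>Measurability is part of the definition, since \<open>measure\<close> is zero on non-measurable sets.\<close>

definition converges_in_prob ::
    "'a measure \<Rightarrow> (nat \<Rightarrow> 'a \<Rightarrow> 'b::{metric_space, second_countable_topology}) \<Rightarrow> ('a \<Rightarrow> 'b) \<Rightarrow> bool"
where
  "converges_in_prob M Z Y \<longleftrightarrow>
     (\<forall>n. Z n \<in> borel_measurable M) \<and> Y \<in> borel_measurable M \<and>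
     (\<forall>\<epsilon>>0. (\<lambda>n. measure M {\<omega> \<in> space M. \<epsilon> < dist (Z n \<omega>) (Y \<omega>)}) \<longlonglongrightarrow> 0)"

definition progressively_measurable ::
    "(real \<Rightarrow> 'a measure) \<Rightarrow> (real \<Rightarrow> 'a \<Rightarrow> 'b::topological_space) \<Rightarrow> bool" where
  "progressively_measurable Ft H \<longleftrightarrow>
     (\<forall>t\<ge>0. (\<lambda>(s, \<omega>). H s \<omega>) \<in>
        borel_measurable (restrict_space borel {0..t} \<Otimes>\<^sub>M Ft t))"

text \<open>A simple process takes the bounded, \<open>Ft (p i)\<close>-measurable value \<open>\<xi> i\<close> on
  \<open>(p i, p (i+1)]\<close> for \<open>i < k\<close>, and is zero elsewhere.\<close>

definition simple_integrand ::
    "'a measure \<Rightarrow> (real \<Rightarrow> 'a measure) \<Rightarrow> nat \<Rightarrow> (nat \<Rightarrow> real) \<Rightarrow> (nat \<Rightarrow> 'a \<Rightarrow> real^'m^'n) \<Rightarrow> bool"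
where
  "simple_integrand M Ft k p \<xi> \<longleftrightarrow>
     0 \<le> p 0 \<and> (\<forall>i<k. p i < p (Suc i)) \<and>
     (\<forall>i<k. \<xi> i \<in> borel_measurable (Ft (p i)) \<and> (\<exists>C. \<forall>\<omega>\<in>space M. norm (\<xi> i \<omega>) \<le> C))"

definition simple_process ::
    "nat \<Rightarrow> (nat \<Rightarrow> real) \<Rightarrow> (nat \<Rightarrow> 'a \<Rightarrow> real^'m^'n) \<Rightarrow> real \<Rightarrow> 'a \<Rightarrow> real^'m^'n" where
  "simple_process k p \<xi> s \<omega> = (\<Sum>i<k. indicator {p i<..p (Suc i)} s *\<^sub>R \<xi> i \<omega>)"

definition simple_ito_integral ::
    "(real \<Rightarrow> 'a \<Rightarrow> real^'m) \<Rightarrow> nat \<Rightarrow> (nat \<Rightarrow> real) \<Rightarrow> (nat \<Rightarrow> 'a \<Rightarrow> real^'m^'n)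
      \<Rightarrow> real \<Rightarrow> 'a \<Rightarrow> real^'n" where
  "simple_ito_integral W k p \<xi> t \<omega> =
     (\<Sum>i<k. \<xi> i \<omega> *v (W (min (p (Suc i)) t) \<omega> - W (min (p i) t) \<omega>))"

text \<open>\<open>I t\<close> is (a version of) the It\^o integral of \<open>H\<close> over \<open>[0,t]\<close> for every \<open>t \<ge> 0\<close>. This is
  the usual extension of the integral of simple processes to progressively measurable \<open>H\<close> that
  are almost surely locally square integrable in time. It determines each \<open>I t\<close> almost surely.\<close>

definition has_ito_integral ::
    "'a measure \<Rightarrow> (real \<Rightarrow> 'a measure) \<Rightarrow> (real \<Rightarrow> 'a \<Rightarrow> real^'m)
      \<Rightarrow> (real \<Rightarrow> 'a \<Rightarrow> real^'m^'n) \<Rightarrow> (real \<Rightarrow> 'a \<Rightarrow> real^'n) \<Rightarrow> bool" where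
  "has_ito_integral M Ft W H I \<longleftrightarrow>
     progressively_measurable Ft H \<and>
     (\<forall>t\<ge>0. AE \<omega> in M. set_integrable lborel {0..t} (\<lambda>s. (norm (H s \<omega>))\<^sup>2)) \<and>
     (\<exists>k p \<xi>. (\<forall>n. simple_integrand M Ft (k n) (p n) (\<xi> n)) \<and>
        (\<forall>t\<ge>0.
           converges_in_prob M
             (\<lambda>n \<omega>. LINT s:{0..t}|lborel. (norm (simple_process (k n) (p n) (\<xi> n) s \<omega> - H s \<omega>))\<^sup>2)
             (\<lambda>_. 0) \<and>
           converges_in_prob M (\<lambda>n. simple_ito_integral W (k n) (p n) (\<xi> n) t) (I t)))"

text \<open>\<open>X\<close> is a continuous adapted solution of \<open>dX = b(X) dt + \<sigma>(X) dW\<close>, \<open>X(0) = x0\<close>.\<close>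

definition sde_solution ::
    "'a measure \<Rightarrow> (real \<Rightarrow> 'a measure) \<Rightarrow> (real \<Rightarrow> 'a \<Rightarrow> real^'m)
      \<Rightarrow> (real^'n \<Rightarrow> real^'n) \<Rightarrow> (real^'n \<Rightarrow> real^'m^'n) \<Rightarrow> real^'n
      \<Rightarrow> (real \<Rightarrow> 'a \<Rightarrow> real^'n) \<Rightarrow> bool" where
  "sde_solution M Ft W b \<sigma> x0 X \<longleftrightarrow>
     (\<forall>t\<ge>0. X t \<in> borel_measurable (Ft t)) \<and>
     (\<forall>\<omega>\<in>space M. continuous_on {0..} (\<lambda>t. X t \<omega>)) \<and>
     (\<forall>t\<ge>0. AE \<omega> in M. set_integrable lborel {0..t} (\<lambda>s. b (X s \<omega>))) \<and>
     (\<exists>I. has_ito_integral M Ft W (\<lambda>s \<omega>. \<sigma> (X s \<omega>)) I \<and>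
        (\<forall>t\<ge>0. AE \<omega> in M. X t \<omega> = x0 + (LINT s:{0..t}|lborel. b (X s \<omega>)) + I t \<omega>))"

end

theory Submission
  imports Defs
begin

text \<open>No It\^o formula is used. Put \<open>Y = X - Xstar\<close>, let \<open>A t\<close> be the event that \<open>\<bar>Y\<bar> \<le> R\<close> on \<open>[0,t]\<close>,
  and let \<open>f t = E(\<bar>Y t\<bar>\<^sup>2; A t)\<close>. Dissipativity of the coefficients gives, with \<open>\<delta> = t - s\<close> and a
  constant \<open>C\<close> depending on \<open>R\<close> only,
  \<open>f t \<le> f s - \<alpha> \<delta> f t + C \<delta>\<^bsup>3/2\<^esup> + C \<delta> (P(A s) - P(A t))\<close>.
  Here the stochastic increment is approximated on \<open>A t\<close> by a truncated simple integral multiplied by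
  the indicator of \<open>A s\<close>, whose second moment is known from the isometry; the price of freezing
  the event at time \<open>s\<close> is the last term, which telescopes. Summing over a mesh tending to zero yields
  \<open>f t \<le> e\<^bsup>-\<alpha>t\<^esup> f 0\<close>, and \<open>R\<close> tends to infinity by monotone convergence.\<close>

section \<open>Principal square roots and the covariance matrix\<close>

text \<open>The obstacle is that A t is not known at time s, while the isometry and the
  orthogonality to the past hold for adapted integrands only. On A t the integrand is bounded by c
  R, so projecting the simple approximants to that ball does not change their limit there, and
  multiplying them by the indicator of A s keeps them adapted. The isometry then measures the energy
  on A s, and the part outside A t costs at most a constant times \<delta> (P(A s) - P(A t)). The
  power 3/2 appears because a path moves by about sqrt \<delta> in time \<delta>, so freezing the
  coefficients during a step costs \<delta> sqrt \<delta>. All comparisons take place on A t, hence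
  dissipativity is evaluated at the end of the step and the term \<alpha> \<delta> f t is implicit.
  The square root of \<Sigma> enters the estimate through its squared Frobenius norm, which is trace
  \<Sigma> = (d-1) |grad F|^2; this is the source of (d-1) L^2 in the rate.\<close>

lemma transpose_eq_self_iff: "transpose A = A \<longleftrightarrow> (\<forall>i j. A $ i $ j = A $ j $ i)"
  by (auto simp: transpose_def vec_eq_iff)

lemma norm_matrix_squared:
  fixes A :: "real^'m^'n"
  shows "(norm A)\<^sup>2 = (\<Sum>i\<in>UNIV. \<Sum>j\<in>UNIV. (A $ i $ j)\<^sup>2)"
  unfolding power2_norm_eq_inner inner_vec_def by (simp add: power2_eq_square)

lemma matrix_vector_inner_transpose:
  fixes A :: "real^'m^'n"
  shows "(A *v x) \<bullet> y = x \<bullet> (transpose A *v y)"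
  by (simp add: dot_lmul_matrix[symmetric] inner_commute)

lemma pos_semidef_inner_swap: "pos_semidef A \<Longrightarrow> (A *v x) \<bullet> y = x \<bullet> (A *v y)"
  by (simp add: matrix_vector_inner_transpose pos_semidef_def)

lemma matrix_vector_norm_bound:
  fixes A :: "real^'m^'n"
  obtains K where "K > 0" "\<And>v. norm (A *v v) \<le> K * norm v"
  using bounded_linear.pos_bounded[OF matrix_vector_mul_bounded_linear[of A]]
  by (metis mult.commute)

text \<open>The quadratic form is nonnegative at \<open>v - (1/K) *\<^sub>R (A *v v)\<close>, a
  gradient step of length 1/K; the quadratic term of the expansion then absorbs only half of the
  linear one.\<close>

lemma pos_semidef_cauchy_schwarz:
  assumes psd: "pos_semidef A" and K: "K > 0" "\<And>v. norm (A *v v) \<le> K * norm v"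
  shows "(norm (A *v v))\<^sup>2 \<le> K * (v \<bullet> (A *v v))"
proof -
  let ?a = "A *v v"
  have "0 \<le> (v - (1/K) *\<^sub>R ?a) \<bullet> (A *v (v - (1/K) *\<^sub>R ?a))"
    using psd by (auto simp: pos_semidef_def)
  also have "\<dots> = v \<bullet> ?a - (2/K) * (?a \<bullet> ?a) + (1/K)\<^sup>2 * (?a \<bullet> (A *v ?a))"
    using pos_semidef_inner_swap[OF psd, of v ?a]
    by (simp add: matrix_vector_mult_diff_distrib matrix_vector_mult_scaleR inner_diff_left
        inner_diff_right power2_eq_square algebra_simps)
  also have "?a \<bullet> (A *v ?a) \<le> norm ?a * (K * norm ?a)"
    using norm_cauchy_schwarz[of ?a "A *v ?a"] K(2)[of ?a]
    by (meson mult_left_mono norm_ge_zero order_trans)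
  finally have "0 \<le> v \<bullet> ?a - (2/K) * (?a \<bullet> ?a) + (1/K)\<^sup>2 * (norm ?a * (K * norm ?a))"
    by (simp add: mult_left_mono)
  also have "\<dots> = v \<bullet> ?a - (norm ?a)\<^sup>2 / K"
    using K(1) by (simp only: dot_square_norm) (simp add: power2_eq_square field_simps)
  finally show ?thesis using K(1) by (simp add: field_simps)
qed

lemma pos_semidef_mult_eq_0:
  assumes "pos_semidef A" "v \<bullet> (A *v v) = 0" shows "A *v v = 0"
proof -
  obtain K where "K > 0" "\<And>v. norm (A *v v) \<le> K * norm v"
    using matrix_vector_norm_bound[of A] by blast
  from pos_semidef_cauchy_schwarz[OF assms(1) this, of v] assms(2) show ?thesis by simp
qed

text \<open>The square root of \<open>A\<close> is \<open>sqrt K (1 - X)\<close>, where \<open>X\<close> is a Brouwer fixed point of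
  \<open>X \<mapsto> (1 - A/K + X\<^sup>2) / 2\<close> on the symmetric matrices of operator norm at most one.\<close>

lemma pos_semidef_sqrt_exists:
  fixes A :: "real^'n^'n"
  assumes psd: "pos_semidef A"
  shows "\<exists>B. pos_semidef B \<and> B ** B = A"
proof -
  obtain K where K: "K > 0" "\<And>v. norm (A *v v) \<le> K * norm v"
    using matrix_vector_norm_bound[of A] by blast
  define T where "T = mat 1 - (1/K) *\<^sub>R A"
  define S where "S = {X :: real^'n^'n. transpose X = X \<and> (\<forall>v. norm (X *v v) \<le> norm v)}"
  define f where "f X = (1/2) *\<^sub>R (T + X ** X)" for X :: "real^'n^'n"
  have Tv: "T *v v = v - (1/K) *\<^sub>R (A *v v)" for v
    by (simp add: T_def matrix_vector_mult_diff_rdistrib scaleR_matrix_vector_assoc[symmetric])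
  have T_norm: "norm (T *v v) \<le> norm v" for v
  proof -
    have "(norm (x - c *\<^sub>R y))\<^sup>2 = (norm x)\<^sup>2 - (2 * c) * (x \<bullet> y) + c\<^sup>2 * (norm y)\<^sup>2"
      for x y :: "real^'n" and c :: real
      unfolding power2_norm_eq_inner
      by (simp add: inner_diff_left inner_diff_right inner_commute[of y x] power2_eq_square
          right_diff_distrib)
    from this[of v "1/K" "A *v v"]
    have "(norm (T *v v))\<^sup>2 = (norm v)\<^sup>2 - (2/K) * (v \<bullet> (A *v v)) + (1/K)\<^sup>2 * (norm (A *v v))\<^sup>2"
      by (simp add: Tv)
    also have "\<dots> \<le> (norm v)\<^sup>2 - (2/K) * (v \<bullet> (A *v v)) + (1/K)\<^sup>2 * (K * (v \<bullet> (A *v v)))"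
      using pos_semidef_cauchy_schwarz[OF psd K] by (simp add: mult_left_mono)
    also have "\<dots> = (norm v)\<^sup>2 - (1/K) * (v \<bullet> (A *v v))"
      using K(1) by (simp add: field_simps power2_eq_square)
    also have "\<dots> \<le> (norm v)\<^sup>2" using psd K(1) by (simp add: pos_semidef_def)
    finally show ?thesis by (rule power2_le_imp_le) simp
  qed
  have T_sym: "transpose T = T"
    using psd by (auto simp: T_def pos_semidef_def transpose_eq_self_iff mat_def)
  have "closed S"
  proof -
    have "S = {X. transpose X = X} \<inter> (\<Inter>v. {X. norm (X *v v) \<le> norm v})"
      by (auto simp: S_def)
    moreover have "closed {X :: real^'n^'n. transpose X = X}"
      unfolding transpose_def by (intro closed_Collect_eq continuous_intros)
    moreover have "closed {X :: real^'n^'n. norm (X *v v) \<le> norm v}" for v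
      unfolding matrix_vector_mult_def by (intro closed_Collect_le continuous_intros)
    ultimately show ?thesis by auto
  qed
  moreover have "bounded S"
  proof -
    have "norm X \<le> real CARD('n) * real CARD('n)" if "X \<in> S" for X
    proof -
      have "\<bar>X $ i $ j\<bar> \<le> 1" for i j
      proof -
        have "X $ i $ j = (X *v axis j 1) $ i"
          by (simp add: matrix_vector_mul_component inner_axis)
        then have "\<bar>X $ i $ j\<bar> \<le> norm (X *v axis j 1)" by (metis component_le_norm_cart)
        also have "\<dots> \<le> norm (axis j 1 :: real^'n)" using that unfolding S_def by blast
        finally show ?thesis by simp
      qed
      then have "(\<Sum>j\<in>UNIV. \<bar>X $ i $ j\<bar>) \<le> real CARD('n)" for i
        using sum_bounded_above[of UNIV "\<lambda>j. \<bar>X $ i $ j\<bar>" 1] by simp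
      then have "norm (X $ i) \<le> real CARD('n)" for i
        using norm_le_l1_cart[of "X $ i"] order_trans by blast
      then have "(\<Sum>i\<in>UNIV. norm (X $ i)) \<le> real CARD('n) * real CARD('n)"
        by (intro sum_bounded_above[of UNIV _ "real CARD('n)", simplified]) auto
      moreover have "norm X \<le> (\<Sum>i\<in>UNIV. norm (X $ i))"
        unfolding norm_vec_def by (rule L2_set_le_sum) simp
      ultimately show ?thesis by simp
    qed
    then show ?thesis unfolding bounded_iff by blast
  qed
  ultimately have "compact S" by (simp add: compact_eq_bounded_closed)
  moreover have "convex S"
  proof (rule convexI)
    fix X Y :: "real^'n^'n" and u v :: real
    assume XY: "X \<in> S" "Y \<in> S" and uv: "0 \<le> u" "0 \<le> v" "u + v = 1"
    have "norm ((u *\<^sub>R X + v *\<^sub>R Y) *v w) \<le> norm w" for w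
    proof -
      have "norm ((u *\<^sub>R X + v *\<^sub>R Y) *v w) \<le> u * norm (X *v w) + v * norm (Y *v w)"
        using uv by (simp add: matrix_vector_mult_add_rdistrib scaleR_matrix_vector_assoc[symmetric]
            norm_triangle_le)
      also have "\<dots> \<le> u * norm w + v * norm w"
        using XY uv by (intro add_mono mult_left_mono) (auto simp: S_def)
      finally show ?thesis using uv by (simp flip: distrib_right)
    qed
    moreover have "transpose (u *\<^sub>R X + v *\<^sub>R Y) = u *\<^sub>R X + v *\<^sub>R Y"
      using XY by (simp add: S_def transpose_def vec_eq_iff)
    ultimately show "u *\<^sub>R X + v *\<^sub>R Y \<in> S" by (simp add: S_def)
  qed
  moreover have "0 \<in> S" by (simp add: S_def transpose_def vec_eq_iff)
  then have "S \<noteq> {}" by blast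
  moreover have "continuous_on S f"
    unfolding f_def matrix_matrix_mult_def by (intro continuous_intros)
  moreover have "f \<in> S \<rightarrow> S"
  proof
    fix X assume X: "X \<in> S"
    have "norm (f X *v v) \<le> norm v" for v
    proof -
      have "norm (f X *v v) \<le> (1/2) * (norm (T *v v) + norm (X *v (X *v v)))"
        by (simp add: f_def scaleR_matrix_vector_assoc[symmetric] matrix_vector_mult_add_rdistrib
            matrix_vector_mul_assoc[symmetric] norm_triangle_ineq)
      moreover have "norm (X *v (X *v v)) \<le> norm v" using X by (auto simp: S_def intro: order_trans)
      ultimately show ?thesis using T_norm[of v] by simp
    qed
    moreover have "transpose (f X) = f X"
    proof -
      have "transpose (X ** X) = X ** X" using X by (simp add: S_def matrix_transpose_mul)
      then show ?thesis using T_sym by (simp add: f_def transpose_def vec_eq_iff)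
    qed
    ultimately show "f X \<in> S" by (simp add: S_def)
  qed
  ultimately obtain X where X: "X \<in> S" "f X = X" by (rule brouwer)
  \<comment> \<open>The fixed point equation gives (1 - X)^2 = 1 - 2 X + X^2 = 1 - T = A/K. Since X
    does not increase norms, 1 - X is positive semidefinite.\<close>
  define B where "B = sqrt K *\<^sub>R (mat 1 - X)"
  have Bv: "B *v v = sqrt K *\<^sub>R (v - X *v v)" for v
    by (simp add: B_def matrix_vector_mult_diff_rdistrib scaleR_matrix_vector_assoc[symmetric])
  have "pos_semidef B"
  proof -
    have "v \<bullet> (X *v v) \<le> v \<bullet> v" for v
    proof -
      have "v \<bullet> (X *v v) \<le> norm v * norm (X *v v)" by (rule norm_cauchy_schwarz)
      also have "\<dots> \<le> norm v * norm v" using X by (intro mult_left_mono) (auto simp: S_def)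
      finally show ?thesis by (simp add: norm_eq_sqrt_inner)
    qed
    moreover have "transpose B = B"
      using X(1) by (auto simp: B_def S_def transpose_eq_self_iff mat_def)
    ultimately show ?thesis using K(1) by (simp add: pos_semidef_def Bv inner_diff_right)
  qed
  moreover have "B ** B = A"
  proof (subst matrix_eq, rule allI)
    fix v
    have "X *v v = (1/2) *\<^sub>R (T *v v + X *v (X *v v))"
      by (subst X(2)[symmetric]) (simp add: f_def scaleR_matrix_vector_assoc[symmetric]
          matrix_vector_mult_add_rdistrib matrix_vector_mul_assoc[symmetric])
    then have "2 *\<^sub>R (X *v v) = 2 *\<^sub>R ((1/2) *\<^sub>R (T *v v + X *v (X *v v)))" by (simp only:)
    also have "\<dots> = T *v v + X *v (X *v v)" by (simp only: scaleR_scaleR) simp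
    finally have "2 *\<^sub>R (X *v v) = T *v v + X *v (X *v v)" .
    then have *: "X *v (X *v v) = 2 *\<^sub>R (X *v v) - (v - (1/K) *\<^sub>R (A *v v))" by (simp add: Tv)
    have "(B ** B) *v v = K *\<^sub>R (v - 2 *\<^sub>R (X *v v) + X *v (X *v v))"
      using K(1) by (simp add: matrix_vector_mul_assoc[symmetric] Bv matrix_vector_mult_scaleR
          matrix_vector_mult_diff_distrib scaleR_2 algebra_simps)
    also have "\<dots> = A *v v" using K(1) by (simp add: *)
    finally show "(B ** B) *v v = A *v v" .
  qed
  ultimately show ?thesis by blast
qed

text \<open>The diagonal entries of \<open>D ** B ** D\<close> are the values of the form of B at
  the columns of D, so the trace is nonnegative when B is positive semidefinite.\<close>

lemma trace_congruence:
  fixes B D :: "real^'n^'n"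
  assumes "transpose D = D"
  shows "trace (D ** B ** D) = (\<Sum>i\<in>UNIV. (D *v axis i 1) \<bullet> (B *v (D *v axis i 1)))"
proof -
  have "(D ** B ** D) $ i $ i = (D *v axis i 1) \<bullet> (B *v (D *v axis i 1))" for i
  proof -
    have "(D ** B ** D) $ i $ i = axis i 1 \<bullet> ((D ** B ** D) *v axis i 1)"
      by (simp add: matrix_vector_mul_component inner_axis inner_axis')
    also have "\<dots> = (D *v axis i 1) \<bullet> (B *v (D *v axis i 1))"
      using assms by (simp add: matrix_vector_inner_transpose matrix_vector_mul_assoc[symmetric])
    finally show ?thesis .
  qed
  then show ?thesis by (simp add: trace_def)
qed

text \<open>With D = B - C one has D (B D + D C) = D (B^2 - C^2) = 0. Taking traces, the traces of D
  B D and D C D add up to 0 and both are nonnegative, so B and C annihilate every column of D. Then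
  D D = 0, and symmetry of D gives D = 0.\<close>

lemma pos_semidef_sqrt_unique:
  fixes B C :: "real^'n^'n"
  assumes B: "pos_semidef B" and C: "pos_semidef C" and eq: "B ** B = C ** C"
  shows "B = C"
proof -
  define D where "D = B - C"
  have D: "transpose D = D" using B C by (simp add: D_def pos_semidef_def transpose_def vec_eq_iff)
  have BC: "B *v (B *v v) = C *v (C *v v)" for v by (simp add: matrix_vector_mul_assoc eq)
  have Dv: "D *v v = B *v v - C *v v" for v by (simp add: D_def matrix_vector_mult_diff_rdistrib)
  have "D ** B ** D + D ** (D ** C) = 0"
    by (subst matrix_eq) (simp add: matrix_vector_mul_assoc[symmetric] Dv BC
        matrix_vector_mult_add_rdistrib matrix_vector_mult_diff_distrib)
  then have "trace (D ** B ** D) + trace (D ** (D ** C)) = 0"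
    by (simp add: trace_add[symmetric] trace_0[simplified mat_0])
  then have "trace (D ** B ** D) = - trace (D ** C ** D)"
    using trace_mul_sym[of D "D ** C"] by simp
  then have "(\<Sum>i\<in>UNIV. (D *v axis i 1) \<bullet> (B *v (D *v axis i 1))
      + (D *v axis i 1) \<bullet> (C *v (D *v axis i 1))) = 0"
    by (simp add: trace_congruence[OF D] sum.distrib)
  moreover have nn: "0 \<le> (D *v axis i 1) \<bullet> (B *v (D *v axis i 1))"
      "0 \<le> (D *v axis i 1) \<bullet> (C *v (D *v axis i 1))" for i
    using B C by (auto simp: pos_semidef_def)
  ultimately have z: "(D *v axis i 1) \<bullet> (B *v (D *v axis i 1)) + (D *v axis i 1) \<bullet> (C *v (D *v axis i 1)) = 0" for i
    by (subst (asm) sum_nonneg_eq_0_iff) (auto intro: add_nonneg_nonneg)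
  have "D *v axis i 1 = 0" for i
  proof -
    let ?w = "D *v axis i 1"
    have "?w \<bullet> (B *v ?w) = 0" "?w \<bullet> (C *v ?w) = 0"
      using z[of i] nn[of i] by linarith+
    then have "B *v ?w = 0" "C *v ?w = 0"
      using pos_semidef_mult_eq_0 B C by blast+
    then have "D *v ?w = 0" by (simp add: Dv)
    then have "?w \<bullet> ?w = 0"
      using D by (subst matrix_vector_inner_transpose) simp
    then show ?thesis by simp
  qed
  then have "column i D = 0" for i by (simp only: matrix_vector_mult_basis)
  then have "D $ j $ i = 0" for i j by (metis column_def vec_lambda_beta zero_index)
  then show ?thesis by (simp add: D_def vec_eq_iff)
qed

lemma psd_sqrt:
  fixes A :: "real^'n^'n"
  assumes "pos_semidef A"
  shows "pos_semidef (psd_sqrt A)" "psd_sqrt A ** psd_sqrt A = A"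
proof -
  have "\<exists>!B. pos_semidef B \<and> B ** B = A"
    using pos_semidef_sqrt_exists[OF assms] pos_semidef_sqrt_unique by blast
  from theI'[OF this] show "pos_semidef (psd_sqrt A)" "psd_sqrt A ** psd_sqrt A = A"
    unfolding psd_sqrt_def by blast+
qed

text \<open>The norm of \<open>real^'n^'n\<close> is the Frobenius norm, so for a symmetric root its
  square is the trace of the root times itself. Thus the energy of the noise is found without an
  explicit root.\<close>

lemma norm_psd_sqrt_squared:
  fixes A :: "real^'n^'n"
  assumes "pos_semidef A"
  shows "(norm (psd_sqrt A))\<^sup>2 = trace A"
proof -
  let ?B = "psd_sqrt A"
  have sym: "?B $ i $ j = ?B $ j $ i" for i j
    using psd_sqrt(1)[OF assms] by (simp add: pos_semidef_def transpose_eq_self_iff)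
  have "(norm ?B)\<^sup>2 = (\<Sum>i\<in>UNIV. \<Sum>j\<in>UNIV. ?B $ i $ j * ?B $ j $ i)"
    unfolding norm_matrix_squared by (simp add: power2_eq_square sym)
  also have "\<dots> = trace (?B ** ?B)" by (simp add: trace_def matrix_matrix_mult_def)
  finally show ?thesis by (simp add: psd_sqrt(2)[OF assms])
qed

text \<open>The k-th coordinate matrix sends g to its k-th entry times the k-th basis vector, so the
  sum in the covariance is diagonal and only the outer product has off-diagonal entries.\<close>

lemma scd_covariance_component:
  fixes F :: "real^'n \<Rightarrow> real"
  shows "scd_covariance F x $ i $ j =
    (if i = j then real CARD('n) * (gradient F x $ i)\<^sup>2 else 0) - gradient F x $ i * gradient F x $ j"
proof -
  let ?g = "gradient F x"
  have "(coord_matrix k ** (columnvector ?g :: real^1^'n) ** (rowvector ?g :: real^'n^1) **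
      transpose (coord_matrix k)) $ i $ j = (if k = i \<and> k = j then (?g $ i)\<^sup>2 else 0)" for k
    by (auto simp: matrix_matrix_mult_def coord_matrix_def columnvector_def rowvector_def
        transpose_def axis_def power2_eq_square if_distrib[of "\<lambda>x. x * _"] if_distrib[of "\<lambda>x. _ * x"]
        sum.delta sum.delta' cong: if_cong)
  then have "(\<Sum>k\<in>UNIV. coord_matrix k ** (columnvector ?g :: real^1^'n) ** (rowvector ?g :: real^'n^1) **
      transpose (coord_matrix k)) $ i $ j = (if i = j then (?g $ i)\<^sup>2 else 0)"
    by (cases "i = j") (auto intro!: sum.neutral)
  moreover have "((columnvector ?g :: real^1^'n) ** (rowvector ?g :: real^'n^1)) $ i $ j = ?g $ i * ?g $ j"
    by (simp add: matrix_matrix_mult_def columnvector_def rowvector_def)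
  ultimately show ?thesis
    by (simp add: scd_covariance_def Let_def)
qed

text \<open>With a_i = g_i v_i the quadratic form is d (sum of a_i^2) - (sum of a_i)^2, which is
  nonnegative by the Cauchy-Schwarz inequality against the all-ones vector.\<close>

lemma scd_covariance_pos_semidef:
  fixes F :: "real^'n \<Rightarrow> real"
  shows "pos_semidef (scd_covariance F x)"
proof -
  let ?g = "gradient F x"
  have "0 \<le> v \<bullet> (scd_covariance F x *v v)" for v
  proof -
    have "v \<bullet> (scd_covariance F x *v v)
        = real CARD('n) * (\<Sum>i\<in>UNIV. (?g $ i * v $ i)\<^sup>2) - (\<Sum>i\<in>UNIV. ?g $ i * v $ i)\<^sup>2"
    proof -
      have "v \<bullet> (scd_covariance F x *v v) = (\<Sum>i\<in>UNIV. \<Sum>j\<in>UNIV.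
          (if i = j then real CARD('n) * (?g $ i * v $ i)\<^sup>2 else 0) - (?g $ i * v $ i) * (?g $ j * v $ j))"
        unfolding inner_vec_def matrix_vector_mult_def
        by (auto simp: scd_covariance_component sum_distrib_left power2_eq_square algebra_simps
            intro!: sum.cong)
      also have "\<dots> = (\<Sum>i\<in>UNIV. real CARD('n) * (?g $ i * v $ i)\<^sup>2)
          - (\<Sum>i\<in>UNIV. \<Sum>j\<in>UNIV. (?g $ i * v $ i) * (?g $ j * v $ j))"
        by (simp add: sum_subtractf)
      also have "(\<Sum>i\<in>UNIV. \<Sum>j\<in>UNIV. (?g $ i * v $ i) * (?g $ j * v $ j)) = (\<Sum>i\<in>UNIV. ?g $ i * v $ i)\<^sup>2"
        by (simp only: power2_eq_square sum_product)
      finally show ?thesis by (simp add: sum_distrib_left)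
    qed
    moreover have "(\<Sum>i\<in>UNIV. ?g $ i * v $ i)\<^sup>2 \<le> real CARD('n) * (\<Sum>i\<in>UNIV. (?g $ i * v $ i)\<^sup>2)"
      using sum_squared_le_sum_of_squares[of "\<lambda>i. ?g $ i * v $ i" UNIV] by (simp add: mult.commute)
    ultimately show ?thesis by simp
  qed
  moreover have "transpose (scd_covariance F x) = scd_covariance F x"
    by (simp add: transpose_def vec_eq_iff scd_covariance_component)
  ultimately show ?thesis by (simp add: pos_semidef_def)
qed

lemma trace_scd_covariance:
  fixes F :: "real^'n \<Rightarrow> real"
  shows "trace (scd_covariance F x) = (real CARD('n) - 1) * (norm (gradient F x))\<^sup>2"
proof -
  have "(norm (gradient F x))\<^sup>2 = (\<Sum>i\<in>UNIV. (gradient F x $ i)\<^sup>2)"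
    unfolding power2_norm_eq_inner inner_vec_def by (simp add: power2_eq_square)
  moreover have "trace (scd_covariance F x) = (\<Sum>i\<in>UNIV. (real CARD('n) - 1) * (gradient F x $ i)\<^sup>2)"
    by (simp add: trace_def scd_covariance_component power2_eq_square algebra_simps)
  ultimately show ?thesis by (simp add: sum_distrib_left)
qed

section \<open>Gradient and Hessian\<close>

text \<open>The Riesz representative of the derivative is a witness for the definite description in
  \<open>gradient\<close>, and a linear form determines its representative.\<close>

lemma GDERIV_gradient:
  fixes f :: "'a::euclidean_space \<Rightarrow> real"
  assumes "f differentiable (at x)"
  shows "GDERIV f x :> gradient f x"
proof -
  obtain f' where f': "(f has_derivative f') (at x)"
    using assms by (auto simp: differentiable_def)
  then interpret linear f' by (rule has_derivative_linear)
  have "f' v = v \<bullet> (\<Sum>b\<in>Basis. f' b *\<^sub>R b)" for v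
  proof -
    have "f' v = f' (\<Sum>b\<in>Basis. (v \<bullet> b) *\<^sub>R b)" by (simp add: euclidean_representation)
    also have "\<dots> = (\<Sum>b\<in>Basis. (v \<bullet> b) * f' b)" by (simp only: sum scale real_scaleR_def)
    finally show ?thesis by (simp add: inner_sum_right mult.commute)
  qed
  then have "f' = (\<lambda>v. v \<bullet> (\<Sum>b\<in>Basis. f' b *\<^sub>R b))" by (rule ext)
  with f' have ex: "GDERIV f x :> (\<Sum>b\<in>Basis. f' b *\<^sub>R b)"
    unfolding gderiv_def by (rule has_derivative_subst)
  show ?thesis
    unfolding gradient_def
  proof (rule theI[where P = "\<lambda>D. GDERIV f x :> D", OF ex])
    fix D assume "GDERIV f x :> D"
    with ex have "(\<lambda>h. h \<bullet> D) = (\<lambda>h. h \<bullet> (\<Sum>b\<in>Basis. f' b *\<^sub>R b))"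
      unfolding gderiv_def by (intro has_derivative_unique)
    then have "h \<bullet> D = h \<bullet> (\<Sum>b\<in>Basis. f' b *\<^sub>R b)" for h by (rule fun_cong)
    then show "D = (\<Sum>b\<in>Basis. f' b *\<^sub>R b)" by (rule vector_eq_ldot[THEN iffD1, OF allI])
  qed
qed

lemma gradient_eqI:
  fixes f :: "'a::euclidean_space \<Rightarrow> real"
  assumes "GDERIV f x :> D"
  shows "gradient f x = D"
proof -
  have "f differentiable (at x)" using assms by (auto simp: gderiv_def differentiable_def)
  from GDERIV_gradient[OF this] assms have "(\<lambda>h. h \<bullet> gradient f x) = (\<lambda>h. h \<bullet> D)"
    unfolding gderiv_def by (rule has_derivative_unique)
  then have "h \<bullet> gradient f x = h \<bullet> D" for h by (rule fun_cong)
  then show ?thesis by (rule vector_eq_ldot[THEN iffD1, OF allI])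
qed

context
  fixes F :: "real^'n \<Rightarrow> real"
  assumes C2: "twice_cont_diff F"
begin

lemma twice_cont_diff_has_derivative: "(F has_derivative (\<lambda>v. v \<bullet> gradient F x)) (at x)"
  using C2 GDERIV_gradient unfolding twice_cont_diff_def gderiv_def by blast

lemma gradient_has_derivative: "(gradient F has_derivative (\<lambda>v. hessian F x *v v)) (at x)"
  using C2 unfolding twice_cont_diff_def hessian_def by (simp add: jacobian_works)

lemma continuous_on_gradient: "continuous_on S (gradient F)"
  by (meson gradient_has_derivative continuous_at_imp_continuous_on has_derivative_continuous)

lemma continuous_on_hessian: "continuous_on S (hessian F)"
  using C2 continuous_on_subset unfolding twice_cont_diff_def by blast

text \<open>The mean value theorem is applied twice: in direction u to the difference of F across
  \<open>r *\<^sub>R v\<close>, then in direction v to the resulting difference of directional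
  derivatives.\<close>

lemma second_difference:
  assumes r: "r > 0"
  shows "\<exists>s t. 0 < s \<and> s < r \<and> 0 < t \<and> t < r \<and>
    (F (a + r *\<^sub>R u + r *\<^sub>R v) - F (a + r *\<^sub>R u) - F (a + r *\<^sub>R v) + F a) / r\<^sup>2
    = (hessian F (a + s *\<^sub>R u + t *\<^sub>R v) *v v) \<bullet> u"
proof -
  let ?g = "gradient F"
  have line: "((\<lambda>s. p + s *\<^sub>R w) has_derivative (\<lambda>h. h *\<^sub>R w)) (at s)" for p w :: "real^'n" and s
    by (auto intro!: derivative_eq_intros)
  have F': "((\<lambda>s. F (p + s *\<^sub>R w)) has_real_derivative w \<bullet> ?g (p + s *\<^sub>R w)) (at s)" for p w s
    using has_derivative_compose[OF line twice_cont_diff_has_derivative, of p w s]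
    by (simp add: has_field_derivative_def mult_commute_abs)
  have "((\<lambda>s. F ((a + r *\<^sub>R v) + s *\<^sub>R u) - F (a + s *\<^sub>R u)) has_real_derivative
      u \<bullet> ?g ((a + r *\<^sub>R v) + s *\<^sub>R u) - u \<bullet> ?g (a + s *\<^sub>R u)) (at s)" for s
    by (intro DERIV_diff F')
  then have "((\<lambda>s. F (a + s *\<^sub>R u + r *\<^sub>R v) - F (a + s *\<^sub>R u)) has_real_derivative
      u \<bullet> ?g (a + s *\<^sub>R u + r *\<^sub>R v) - u \<bullet> ?g (a + s *\<^sub>R u)) (at s)" for s
    by (simp add: add.assoc add.commute[of "r *\<^sub>R v"])
  from MVT2[OF r this] obtain s where s: "0 < s" "s < r"
    "F (a + r *\<^sub>R u + r *\<^sub>R v) - F (a + r *\<^sub>R u) - F (a + r *\<^sub>R v) + F a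
      = r * (u \<bullet> ?g (a + s *\<^sub>R u + r *\<^sub>R v) - u \<bullet> ?g (a + s *\<^sub>R u))"
    by (auto simp: algebra_simps)
  have "((\<lambda>t. u \<bullet> ?g (a + s *\<^sub>R u + t *\<^sub>R v)) has_real_derivative
      u \<bullet> (hessian F (a + s *\<^sub>R u + t *\<^sub>R v) *v v)) (at t)" for t
    using has_derivative_inner_right[OF has_derivative_compose[OF line gradient_has_derivative], of u "a + s *\<^sub>R u" v t]
    by (simp add: has_field_derivative_def mult_commute_abs matrix_vector_mult_scaleR)
  from MVT2[OF r this] obtain t where "0 < t" "t < r"
    "u \<bullet> ?g (a + s *\<^sub>R u + r *\<^sub>R v) - u \<bullet> ?g (a + s *\<^sub>R u)
      = r * (u \<bullet> (hessian F (a + s *\<^sub>R u + t *\<^sub>R v) *v v))"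
    by auto
  with s show ?thesis
    using r by (intro exI[of _ s] exI[of _ t]) (simp add: power2_eq_square inner_commute)
qed

text \<open>Schwarz's theorem. The second difference is symmetric in u and v, so the mean value
  theorem evaluates it as a Hessian form in either order; by continuity of the Hessian both values
  converge as the step r tends to 0, to forms at x that must agree.\<close>

lemma hessian_symmetric: "transpose (hessian F x) = hessian F x"
proof -
  let ?H = "hessian F"
  have "(?H x *v v) \<bullet> u = (?H x *v u) \<bullet> v" for u v
  proof -
    define r where "r n = inverse (real (Suc n))" for n
    have r: "r n > 0" for n by (simp add: r_def)
    have r0: "r \<longlonglongrightarrow> 0" unfolding r_def by (rule LIMSEQ_inverse_real_of_nat)
    define Q where "Q n = (F (x + r n *\<^sub>R u + r n *\<^sub>R v) - F (x + r n *\<^sub>R u) - F (x + r n *\<^sub>R v) + F x)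
        / (r n)\<^sup>2" for n
    have lim: "G \<longlonglongrightarrow> (?H x *v q) \<bullet> p"
      if "\<And>n. \<exists>s t. 0 < s \<and> s < r n \<and> 0 < t \<and> t < r n \<and> G n = (?H (x + s *\<^sub>R p + t *\<^sub>R q) *v q) \<bullet> p"
      for p q and G :: "nat \<Rightarrow> real"
    proof -
      from that obtain s t where st: "\<And>n. 0 < s n \<and> s n < r n \<and> 0 < t n \<and> t n < r n \<and>
          G n = (?H (x + s n *\<^sub>R p + t n *\<^sub>R q) *v q) \<bullet> p" by metis
      have "s \<longlonglongrightarrow> 0" "t \<longlonglongrightarrow> 0"
        by (rule tendsto_sandwich[OF _ _ tendsto_const r0]; use st less_imp_le in \<open>auto intro!: always_eventually\<close>)+
      then have "(\<lambda>n. x + s n *\<^sub>R p + t n *\<^sub>R q) \<longlonglongrightarrow> x + 0 *\<^sub>R p + 0 *\<^sub>R q"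
        by (intro tendsto_intros)
      moreover have "isCont (\<lambda>y. (?H y *v q) \<bullet> p) x"
      proof -
        have "continuous_on UNIV (\<lambda>y. (?H y *v q) \<bullet> p)"
          using continuous_on_hessian[of UNIV] unfolding matrix_vector_mult_def
          by (intro continuous_intros)
        then show ?thesis by (simp add: continuous_on_eq_continuous_at)
      qed
      ultimately have "(\<lambda>n. (?H (x + s n *\<^sub>R p + t n *\<^sub>R q) *v q) \<bullet> p) \<longlonglongrightarrow> (?H x *v q) \<bullet> p"
        using isCont_tendsto_compose by fastforce
      moreover have "(\<lambda>n. (?H (x + s n *\<^sub>R p + t n *\<^sub>R q) *v q) \<bullet> p) = G"
        using st by auto
      ultimately show ?thesis by simp
    qed
    have "Q \<longlonglongrightarrow> (?H x *v v) \<bullet> u"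
      by (rule lim) (simp only: Q_def second_difference[OF r])
    moreover have "Q \<longlonglongrightarrow> (?H x *v u) \<bullet> v"
    proof (rule lim)
      fix n
      have "F (x + r n *\<^sub>R u + r n *\<^sub>R v) - F (x + r n *\<^sub>R u) - F (x + r n *\<^sub>R v) + F x =
          F (x + r n *\<^sub>R v + r n *\<^sub>R u) - F (x + r n *\<^sub>R v) - F (x + r n *\<^sub>R u) + F x"
        by (simp add: algebra_simps)
      then show "\<exists>s t. 0 < s \<and> s < r n \<and> 0 < t \<and> t < r n \<and> Q n = (?H (x + s *\<^sub>R v + t *\<^sub>R u) *v u) \<bullet> v"
        using second_difference[OF r, of n x v u] by (simp only: Q_def)
    qed
    ultimately show ?thesis by (rule LIMSEQ_unique)
  qed
  then have "v \<bullet> (transpose (?H x) *v u) = v \<bullet> (?H x *v u)" for u v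
    by (metis inner_commute dot_lmul_matrix transpose_matrix_vector)
  then have "transpose (?H x) *v u = ?H x *v u" for u by (metis vector_eq_ldot)
  then show ?thesis by (simp add: matrix_eq)
qed

text \<open>The derivative of |grad F|^2 in direction v is 2 (H v) . grad F, which symmetry of the
  Hessian H turns into 2 v . (H grad F); hence h/4 becomes h/2.\<close>

lemma gradient_modified_potential:
  "gradient (\<lambda>y. F y + h / 4 * (norm (gradient F y))\<^sup>2) x
    = gradient F x + (h / 2) *\<^sub>R (hessian F x *v gradient F x)"
proof (rule gradient_eqI)
  let ?g = "gradient F"
  have sym: "(hessian F x *v v) \<bullet> ?g x = v \<bullet> (hessian F x *v ?g x)" for v
    by (metis hessian_symmetric inner_commute dot_lmul_matrix transpose_matrix_vector)
  have "((\<lambda>y. F y + h / 4 * (?g y \<bullet> ?g y)) has_derivative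
      (\<lambda>v. v \<bullet> (?g x + (h / 2) *\<^sub>R (hessian F x *v ?g x)))) (at x)"
    by (rule derivative_eq_intros twice_cont_diff_has_derivative gradient_has_derivative refl)+
       (auto simp: fun_eq_iff inner_add_right sym inner_commute[of "?g x"] algebra_simps)
  then show "GDERIV (\<lambda>y. F y + h / 4 * (norm (?g y))\<^sup>2) x :> ?g x + (h / 2) *\<^sub>R (hessian F x *v ?g x)"
    by (simp add: gderiv_def power2_norm_eq_inner)
qed

text \<open>L bounds all difference quotients of the gradient, hence their limit; e pays for the
  linearization error. The drift contains the Hessian applied to the gradient, and this bound gives
  it linear growth.\<close>

lemma norm_hessian_mult_le:
  assumes lipschitz: "\<And>x y. norm (gradient F x - gradient F y) \<le> L * norm (x - y)"
  shows "norm (hessian F x *v v) \<le> L * norm v"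
proof (rule field_le_epsilon)
  fix e :: real assume e: "e > 0"
  have "((\<lambda>r. x + r *\<^sub>R v) has_derivative (\<lambda>r. r *\<^sub>R v)) (at 0)"
    by (auto intro!: derivative_eq_intros)
  then have "((\<lambda>r. gradient F (x + r *\<^sub>R v)) has_derivative (\<lambda>r. r *\<^sub>R (hessian F x *v v))) (at 0)"
    using has_derivative_compose[OF _ gradient_has_derivative, of "\<lambda>r. x + r *\<^sub>R v" "\<lambda>r. r *\<^sub>R v" 0 UNIV]
    by (simp add: matrix_vector_mult_scaleR)
  then obtain d where d: "d > 0" "\<And>r. \<bar>r\<bar> < d \<Longrightarrow>
      norm (gradient F (x + r *\<^sub>R v) - gradient F x - r *\<^sub>R (hessian F x *v v)) \<le> e * \<bar>r\<bar>"
    using e unfolding has_derivative_at_alt by fastforce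
  define r where "r = d / 2"
  have r: "r > 0" "\<bar>r\<bar> < d" using d(1) by (auto simp: r_def)
  have "r * norm (hessian F x *v v) = norm (r *\<^sub>R (hessian F x *v v))" using r(1) by simp
  also have "\<dots> \<le> norm (gradient F (x + r *\<^sub>R v) - gradient F x) +
      norm (gradient F (x + r *\<^sub>R v) - gradient F x - r *\<^sub>R (hessian F x *v v))"
    by (metis norm_triangle_sub add.commute norm_minus_commute)
  also have "\<dots> \<le> L * norm (r *\<^sub>R v) + e * r"
    using lipschitz[of "x + r *\<^sub>R v" x] d(2)[OF r(2)] r(1) by (simp add: add_mono)
  finally have "r * norm (hessian F x *v v) \<le> r * (L * norm v + e)"
    using r(1) by (simp add: algebra_simps)
  then show "norm (hessian F x *v v) \<le> L * norm v + e" using r(1) by simp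
qed

lemma gradient_minimizer:
  assumes "is_arg_min F (\<lambda>_. True) z"
  shows "gradient F z = 0"
proof -
  have "(\<lambda>v. v \<bullet> gradient F z) = (\<lambda>v. 0)"
    by (rule has_derivative_local_min[OF twice_cont_diff_has_derivative])
       (use assms in \<open>auto simp: is_arg_min_linorder intro!: always_eventually\<close>)
  then show ?thesis by (metis inner_eq_zero_iff)
qed

end

section \<open>Integrals of simple processes\<close>

text \<open>The intervals are disjoint, so at each u at most one summand is nonzero, and a map
  fixing 0 can be applied term by term. It serves for the squared norm, for the projection to a ball
  and for the error of that projection.\<close>

lemma simple_sum_apply:
  fixes z :: "nat \<Rightarrow> 'b::real_vector" and \<phi> :: "'b \<Rightarrow> 'c::real_vector" and p :: "nat \<Rightarrow> real"
  assumes p: "\<And>i. i < k \<Longrightarrow> p i < p (Suc i)" and \<phi>: "\<phi> 0 = 0"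
  shows "\<phi> (\<Sum>i<k. indicator {p i<..p (Suc i)} u *\<^sub>R z i) = (\<Sum>i<k. indicator {p i<..p (Suc i)} u *\<^sub>R \<phi> (z i))"
proof (cases "\<exists>i<k. u \<in> {p i<..p (Suc i)}")
  case True
  then obtain i where i: "i < k" "u \<in> {p i<..p (Suc i)}" by blast
  have mono: "p a \<le> p b" if "a \<le> b" "b \<le> k" for a b
    using that
  proof (induction rule: dec_induct)
    case (step n)
    then show ?case using p[of n] by simp
  qed simp
  have other: "u \<notin> {p j<..p (Suc j)}" if "j < k" "j \<noteq> i" for j
  proof (cases "j < i")
    case True
    with mono[of "Suc j" i] i show ?thesis by auto
  next
    case False
    with mono[of "Suc i" j] that i show ?thesis by auto
  qed
  have *: "(\<Sum>j<k. indicator {p j<..p (Suc j)} u *\<^sub>R w j) = w i" for w :: "nat \<Rightarrow> 'd::real_vector"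
  proof -
    have "(\<Sum>j<k. indicator {p j<..p (Suc j)} u *\<^sub>R w j) = (\<Sum>j<k. if j = i then w j else 0)"
      using other i by (intro sum.cong) auto
    then show ?thesis using i by simp
  qed
  show ?thesis by (simp only: *)
next
  case False
  then have *: "(\<Sum>j<k. indicator {p j<..p (Suc j)} u *\<^sub>R w j) = 0" for w :: "nat \<Rightarrow> 'd::real_vector"
    by (intro sum.neutral) auto
  show ?thesis by (simp only: * \<phi>)
qed

text \<open>For s \<le> t this is the projection onto [s,t]. Clamping all mesh points restricts a
  simple integral to [s,t]; intervals outside collapse to length zero.\<close>

definition clamp_time :: "real \<Rightarrow> real \<Rightarrow> real \<Rightarrow> real" where
  "clamp_time s t x = max s (min x t)"

text \<open>Measurability is asked of the function cut off to the interval, because a path of a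
  progressively measurable process is controlled only there.\<close>

lemma set_integrable_bounded:
  fixes f :: "real \<Rightarrow> 'b::{banach, second_countable_topology}"
  assumes "(\<lambda>u. indicator {a..b} u *\<^sub>R f u) \<in> borel_measurable borel" "\<And>u. u \<in> {a..b} \<Longrightarrow> norm (f u) \<le> C"
  shows "set_integrable lborel {a..b} f"
  unfolding set_integrable_def
  by (rule integrableI_bounded_set[where A = "{a..b}" and B = C]) (use assms emeasure_bounded_finite[of "{a..b}"] in auto)

lemma set_integral_indicator_interval:
  assumes "s < t" "p \<le> q"
  shows "(LINT u:{s..t}|lborel. indicator {p<..q} u * c) = (clamp_time s t q - clamp_time s t p) * (c::real)"
proof -
  have "(LINT u:{s..t}|lborel. indicator {p<..q} u * c) = (LINT u|lborel. indicator ({s..t} \<inter> {p<..q}) u *\<^sub>R c)"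
    unfolding set_lebesgue_integral_def by (intro Bochner_Integration.integral_cong) (auto simp: indicator_def)
  also have "\<dots> = measure lborel ({s..t} \<inter> {p<..q}) * c"
  proof (subst integral_scaleR_left)
    have "emeasure lborel ({s..t} \<inter> {p<..q}) < \<infinity>"
      by (intro emeasure_bounded_finite bounded_Int) simp
    then show "integrable lborel (indicat_real ({s..t} \<inter> {p<..q}))"
      by (intro integrable_real_indicator) auto
  qed simp
  also have "measure lborel ({s..t} \<inter> {p<..q}) = clamp_time s t q - clamp_time s t p"
  proof (cases "p < s")
    case True
    then have "{s..t} \<inter> {p<..q} = {s..min q t}" by auto
    then show ?thesis using True assms by (auto simp: clamp_time_def measure_lborel_Icc)
  next
    case False
    then have "{s..t} \<inter> {p<..q} = {p<..min q t}" by auto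
    then show ?thesis using False assms by (cases "p \<le> min q t") (auto simp: clamp_time_def)
  qed
  finally show ?thesis .
qed

lemma simple_sum_energy:
  fixes z :: "nat \<Rightarrow> real^'m^'n" and p :: "nat \<Rightarrow> real"
  assumes p: "\<And>i. i < k \<Longrightarrow> p i < p (Suc i)" and st: "s < t"
  shows "(LINT u:{s..t}|lborel. (norm (\<Sum>i<k. indicator {p i<..p (Suc i)} u *\<^sub>R z i))\<^sup>2)
    = (\<Sum>i<k. (clamp_time s t (p (Suc i)) - clamp_time s t (p i)) * (norm (z i))\<^sup>2)"
proof -
  have "(norm (\<Sum>i<k. indicator {p i<..p (Suc i)} u *\<^sub>R z i))\<^sup>2
      = (\<Sum>i<k. indicator {p i<..p (Suc i)} u * (norm (z i))\<^sup>2)" for u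
    using simple_sum_apply[where \<phi> = "\<lambda>x. (norm x)\<^sup>2" and p = p and z = z] p by simp
  then have "(LINT u:{s..t}|lborel. (norm (\<Sum>i<k. indicator {p i<..p (Suc i)} u *\<^sub>R z i))\<^sup>2)
      = (\<Sum>i<k. LINT u:{s..t}|lborel. indicator {p i<..p (Suc i)} u * (norm (z i))\<^sup>2)"
    unfolding set_lebesgue_integral_def
  proof (simp only: scaleR_sum_right, intro Bochner_Integration.integral_sum)
    fix i
    show "integrable lborel (\<lambda>u. indicat_real {s..t} u *\<^sub>R (indicator {p i<..p (Suc i)} u * (norm (z i))\<^sup>2))"
      by (rule set_integrable_bounded[where C = "(norm (z i))\<^sup>2", unfolded set_integrable_def])
         (auto simp: indicator_def)
  qed
  also have "\<dots> = (\<Sum>i<k. (clamp_time s t (p (Suc i)) - clamp_time s t (p i)) * (norm (z i))\<^sup>2)"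
    using p by (intro sum.cong refl set_integral_indicator_interval st less_imp_le) auto
  finally show ?thesis .
qed

section \<open>Projection of simple integrands to a ball\<close>

context
  fixes r :: real
  assumes r: "r \<ge> 0"
begin

text \<open>Projection to a convex set is 1-Lipschitz and fixes the points of the set. Fixing 0
  makes it commute with simple sums; not increasing the distance to points of the ball makes it
  harmless for approximation.\<close>

lemma closest_cball_props:
  fixes x y :: "'b::euclidean_space"
  shows "closest_point (cball 0 r) (0::'b) = 0" "norm (closest_point (cball 0 r) x) \<le> r"
    "norm y \<le> r \<Longrightarrow> norm (closest_point (cball 0 r) x - y) \<le> norm (x - y)"
proof -
  have ne: "cball (0::'b) r \<noteq> {}" using r by simp
  show "closest_point (cball 0 r) (0::'b) = 0" using r by (intro closest_point_self) simp
  show "norm (closest_point (cball 0 r) x) \<le> r"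
    using closest_point_in_set[OF closed_cball ne, of x] by simp
  assume "norm y \<le> r"
  then have "closest_point (cball 0 r) y = y" by (intro closest_point_self) simp
  then show "norm (closest_point (cball 0 r) x - y) \<le> norm (x - y)"
    using closest_point_lipschitz[OF convex_cball closed_cball ne, of x y] by (simp add: dist_norm)
qed

lemma closest_cball_measurable:
  "closest_point (cball (0::'b::euclidean_space) r) \<in> borel_measurable borel"
  using r by (intro borel_measurable_continuous_onI continuous_on_closest_point) auto

text \<open>Values of h lie in the ball, so |C S - S| \<le> |C S - h| + |h - S| \<le> 2 |S - h|, and
  squaring gives the factor 4. For the second bound, ||C S|^2 - |h|^2| \<le> 2 r |S - h| \<le> r (e
  + |S - h|^2 / e); the free parameter e replaces a Cauchy-Schwarz inequality in time and is later
  taken of order sqrt D.\<close>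

lemma truncation_estimates:
  fixes h :: "real \<Rightarrow> real^'m^'n" and z :: "nat \<Rightarrow> real^'m^'n" and p :: "nat \<Rightarrow> real"
  assumes p: "\<And>i. i < k \<Longrightarrow> p i < p (Suc i)" and st: "0 \<le> s" "s < t"
    and h: "(\<lambda>u. indicator {0..t} u *\<^sub>R h u) \<in> borel_measurable borel" "\<And>u. u \<in> {0..t} \<Longrightarrow> norm (h u) \<le> r"
  defines "D \<equiv> LINT u:{0..t}|lborel. (norm ((\<Sum>i<k. indicator {p i<..p (Suc i)} u *\<^sub>R z i) - h u))\<^sup>2"
    and "C \<equiv> closest_point (cball (0::real^'m^'n) r)"
    and "w \<equiv> \<lambda>i. clamp_time s t (p (Suc i)) - clamp_time s t (p i)"
  shows "(\<Sum>i<k. w i * (norm (C (z i) - z i))\<^sup>2) \<le> 4 * D"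
    and "e > 0 \<Longrightarrow> \<bar>(\<Sum>i<k. w i * (norm (C (z i)))\<^sup>2) - (LINT u:{s..t}|lborel. (norm (h u))\<^sup>2)\<bar>
      \<le> r * (e * (t - s) + D / e)"
proof -
  define S where "S u = (\<Sum>i<k. indicator {p i<..p (Suc i)} u *\<^sub>R z i)" for u
  have S_meas: "S \<in> borel_measurable borel" unfolding S_def by measurable
  have S_bound: "norm (S u) \<le> (\<Sum>i<k. norm (z i))" for u
    unfolding S_def by (intro order_trans[OF norm_sum] sum_mono) (auto simp: indicator_def)
  have CS: "C (S u) = (\<Sum>i<k. indicator {p i<..p (Suc i)} u *\<^sub>R C (z i))" for u
    unfolding S_def by (rule simple_sum_apply[where \<phi> = C]) (auto simp: C_def closest_cball_props p)
  have CSS: "C (S u) - S u = (\<Sum>i<k. indicator {p i<..p (Suc i)} u *\<^sub>R (C (z i) - z i))" for u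
    unfolding S_def by (rule simple_sum_apply[where \<phi> = "\<lambda>x. C x - x"]) (auto simp: C_def closest_cball_props p)
  have C_meas: "C \<in> borel_measurable borel" unfolding C_def by (rule closest_cball_measurable)
  have C_norm: "norm (C x) \<le> r" for x unfolding C_def by (rule closest_cball_props)
  have sub: "{s..t} \<subseteq> {0..t}" using st by auto
  define g where "g u = indicator {0..t} u *\<^sub>R h u" for u
  have [measurable]: "g \<in> borel_measurable borel" unfolding g_def using h(1) .
  note [measurable] = S_meas C_meas
  have h_bound: "norm (S u - h u) \<le> (\<Sum>i<k. norm (z i)) + r" if "u \<in> {0..t}" for u
    using norm_triangle_ineq4[of "S u" "h u"] S_bound[of u] h(2)[OF that] by simp
  have int0: "set_integrable lborel {0..t} (\<lambda>u. (norm (S u - h u))\<^sup>2)"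
  proof (rule set_integrable_bounded)
    have "(\<lambda>u. indicator {0..t} u *\<^sub>R (norm (S u - h u))\<^sup>2) = (\<lambda>u. indicator {0..t} u * (norm (S u - g u))\<^sup>2)"
      by (auto simp: g_def indicator_def)
    then show "(\<lambda>u. indicator {0..t} u *\<^sub>R (norm (S u - h u))\<^sup>2) \<in> borel_measurable borel" by simp
    show "norm ((norm (S u - h u))\<^sup>2) \<le> ((\<Sum>i<k. norm (z i)) + r)\<^sup>2" if "u \<in> {0..t}" for u
      using h_bound[OF that] by (simp add: power_mono)
  qed
  then have int: "set_integrable lborel {s..t} (\<lambda>u. (norm (S u - h u))\<^sup>2)"
    by (rule set_integrable_subset) (use sub in auto)
  have D_ge: "(LINT u:{s..t}|lborel. (norm (S u - h u))\<^sup>2) \<le> D"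
    unfolding D_def S_def[symmetric] set_lebesgue_integral_def
    by (rule Bochner_Integration.integral_mono[OF int[unfolded set_integrable_def] int0[unfolded set_integrable_def]])
       (use sub in \<open>auto simp: indicator_def\<close>)
  have intC: "set_integrable lborel {s..t} (\<lambda>u. (norm (C (S u)))\<^sup>2)"
    by (rule set_integrable_bounded[where C = "r\<^sup>2"]) (auto simp: C_norm power_mono)
  have intCS: "set_integrable lborel {s..t} (\<lambda>u. (norm (C (S u) - S u))\<^sup>2)"
  proof (rule set_integrable_bounded[where C = "(r + (\<Sum>i<k. norm (z i)))\<^sup>2"])
    show "norm ((norm (C (S u) - S u))\<^sup>2) \<le> (r + (\<Sum>i<k. norm (z i)))\<^sup>2" for u
      using norm_triangle_ineq4[of "C (S u)" "S u"] S_bound[of u] closest_cball_props(2)[of "S u"]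
      by (simp add: C_def power_mono)
  qed simp
  have inth: "set_integrable lborel {s..t} (\<lambda>u. (norm (h u))\<^sup>2)"
  proof (rule set_integrable_bounded[where C = "r\<^sup>2"])
    have "(\<lambda>u. indicator {s..t} u *\<^sub>R (norm (h u))\<^sup>2) = (\<lambda>u. indicator {s..t} u * (norm (g u))\<^sup>2)"
      using sub by (auto simp: g_def indicator_def fun_eq_iff)
    then show "(\<lambda>u. indicator {s..t} u *\<^sub>R (norm (h u))\<^sup>2) \<in> borel_measurable borel" by simp
    show "norm ((norm (h u))\<^sup>2) \<le> r\<^sup>2" if "u \<in> {s..t}" for u
      using h(2)[of u] that sub by (auto simp: power_mono)
  qed
  have "(\<Sum>i<k. w i * (norm (C (z i) - z i))\<^sup>2) = (LINT u:{s..t}|lborel. (norm (C (S u) - S u))\<^sup>2)"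
    unfolding CSS w_def by (rule simple_sum_energy[symmetric]) (use p st in auto)
  also have "\<dots> \<le> (LINT u:{s..t}|lborel. 4 * (norm (S u - h u))\<^sup>2)"
  proof (rule set_integral_mono[OF intCS])
    show "set_integrable lborel {s..t} (\<lambda>u. 4 * (norm (S u - h u))\<^sup>2)" using int by simp
    fix u assume "u \<in> {s..t}"
    then have "norm (h u) \<le> r" using sub h(2) by auto
    then have "norm (C (S u) - h u) \<le> norm (S u - h u)" unfolding C_def by (rule closest_cball_props)
    then have "norm (C (S u) - S u) \<le> 2 * norm (S u - h u)"
      using norm_triangle_ineq4[of "C (S u) - h u" "S u - h u"] by simp
    then have "(norm (C (S u) - S u))\<^sup>2 \<le> (2 * norm (S u - h u))\<^sup>2" by (intro power_mono) auto
    then show "(norm (C (S u) - S u))\<^sup>2 \<le> 4 * (norm (S u - h u))\<^sup>2" by (simp add: power_mult_distrib)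
  qed
  also have "\<dots> \<le> 4 * D" using D_ge by simp
  finally show "(\<Sum>i<k. w i * (norm (C (z i) - z i))\<^sup>2) \<le> 4 * D" .
  assume e: "e > 0"
  have "(\<Sum>i<k. w i * (norm (C (z i)))\<^sup>2) = (LINT u:{s..t}|lborel. (norm (C (S u)))\<^sup>2)"
    unfolding CS w_def by (rule simple_sum_energy[symmetric]) (use p st in auto)
  then have "(\<Sum>i<k. w i * (norm (C (z i)))\<^sup>2) - (LINT u:{s..t}|lborel. (norm (h u))\<^sup>2)
      = (LINT u:{s..t}|lborel. (norm (C (S u)))\<^sup>2 - (norm (h u))\<^sup>2)"
    using intC inth by simp
  also have "\<bar>\<dots>\<bar> \<le> (LINT u:{s..t}|lborel. \<bar>(norm (C (S u)))\<^sup>2 - (norm (h u))\<^sup>2\<bar>)"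
    unfolding set_lebesgue_integral_def
    by (rule order_trans[OF integral_abs_bound]) (simp add: abs_mult)
  also have "\<dots> \<le> (LINT u:{s..t}|lborel. r * e + (r / e) * (norm (S u - h u))\<^sup>2)"
  proof (rule set_integral_mono)
    show "set_integrable lborel {s..t} (\<lambda>u. \<bar>(norm (C (S u)))\<^sup>2 - (norm (h u))\<^sup>2\<bar>)"
      using intC inth by (intro set_integrable_abs set_integral_diff)
    show "set_integrable lborel {s..t} (\<lambda>u. r * e + (r / e) * (norm (S u - h u))\<^sup>2)"
      using int by (intro set_integral_add set_integrable_mult_right) (auto intro: set_integrable_bounded)
    fix u assume "u \<in> {s..t}"
    then have hr: "norm (h u) \<le> r" using sub h(2) by auto
    let ?x = "C (S u)" and ?d = "norm (S u - h u)"
    have d: "norm (?x - h u) \<le> ?d" using hr unfolding C_def by (rule closest_cball_props)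
    have "\<bar>(norm ?x)\<^sup>2 - (norm (h u))\<^sup>2\<bar> = \<bar>norm ?x - norm (h u)\<bar> * (norm ?x + norm (h u))"
      by (simp add: power2_eq_square square_diff_square_factored abs_mult)
    also have "\<dots> \<le> ?d * (r + r)"
      using d norm_triangle_ineq3[of ?x "h u"] hr closest_cball_props(2)[of "S u"]
      by (intro mult_mono add_mono) (auto simp: C_def)
    also have "\<dots> \<le> r * (e + ?d\<^sup>2 / e)"
    proof -
      have "0 \<le> (?d - e)\<^sup>2" by simp
      then have "2 * ?d * e \<le> e * e + ?d\<^sup>2" by (simp add: power2_eq_square algebra_simps)
      then have "2 * ?d \<le> e + ?d\<^sup>2 / e" using e by (simp add: field_simps)
      then have "r * (2 * ?d) \<le> r * (e + ?d\<^sup>2 / e)" using r by (rule mult_left_mono)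
      then show ?thesis by (simp add: algebra_simps)
    qed
    finally show "\<bar>(norm ?x)\<^sup>2 - (norm (h u))\<^sup>2\<bar> \<le> r * e + (r / e) * ?d\<^sup>2" by (simp add: algebra_simps)
  qed
  also have "\<dots> = r * e * (t - s) + (r / e) * (LINT u:{s..t}|lborel. (norm (S u - h u))\<^sup>2)"
  proof -
    have "set_integrable lborel {s..t} (\<lambda>u. r * e)" by (auto intro: set_integrable_bounded)
    moreover have "(LINT u:{s..t}|lborel. r * e) = r * e * (t - s)"
      using st by (simp add: set_lebesgue_integral_def)
    ultimately show ?thesis using int by (simp add: set_integral_add)
  qed
  also have "\<dots> \<le> r * (e * (t - s) + D / e)"
    using mult_left_mono[OF D_ge, of "r / e"] r e by (simp add: algebra_simps)
  finally show "\<bar>(\<Sum>i<k. w i * (norm (C (z i)))\<^sup>2) - (LINT u:{s..t}|lborel. (norm (h u))\<^sup>2)\<bar>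
      \<le> r * (e * (t - s) + D / e)" .
qed

end

lemma continuous_on_matrix_vector_mult [continuous_intros]:
  fixes A :: "'a::topological_space \<Rightarrow> real^'m^'n"
  assumes "continuous_on S A" "continuous_on S x"
  shows "continuous_on S (\<lambda>\<omega>. A \<omega> *v x \<omega>)"
  unfolding matrix_vector_mult_def using assms by (intro continuous_intros)

lemma borel_measurable_matrix_vector_mult [measurable (raw)]:
  fixes A :: "'a \<Rightarrow> real^'m^'n"
  assumes "A \<in> borel_measurable M" "x \<in> borel_measurable M"
  shows "(\<lambda>\<omega>. A \<omega> *v x \<omega>) \<in> borel_measurable M"
  using assms by (rule borel_measurable_continuous_Pair) (intro continuous_intros)

lemma borel_measurable_vec_nth [measurable (raw)]:
  fixes x :: "'a \<Rightarrow> 'b::topological_space^'m"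
  assumes "x \<in> borel_measurable M"
  shows "(\<lambda>\<omega>. x \<omega> $ i) \<in> borel_measurable M"
  by (rule measurable_compose[OF assms borel_measurable_continuous_onI]) (intro continuous_intros)

lemma integrable_inner_of_squares:
  fixes f g :: "'a \<Rightarrow> 'b::euclidean_space"
  assumes [measurable]: "f \<in> borel_measurable M" "g \<in> borel_measurable M"
    and "integrable M (\<lambda>x. (norm (f x))\<^sup>2)" "integrable M (\<lambda>x. (norm (g x))\<^sup>2)"
  shows "integrable M (\<lambda>x. f x \<bullet> g x)"
proof (rule Bochner_Integration.integrable_bound)
  show "integrable M (\<lambda>x. (norm (f x))\<^sup>2 + (norm (g x))\<^sup>2)" using assms by simp
  have "\<bar>f x \<bullet> g x\<bar> \<le> (norm (f x))\<^sup>2 + (norm (g x))\<^sup>2" for x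
  proof -
    have "\<bar>f x \<bullet> g x\<bar> \<le> norm (f x) * norm (g x)" by (rule Cauchy_Schwarz_ineq2)
    moreover have "0 \<le> (norm (f x) - norm (g x))\<^sup>2 + (norm (f x))\<^sup>2 + (norm (g x))\<^sup>2" by simp
    ultimately show ?thesis by (simp add: power2_eq_square algebra_simps)
  qed
  then show "AE x in M. norm (f x \<bullet> g x) \<le> norm ((norm (f x))\<^sup>2 + (norm (g x))\<^sup>2)" by auto
qed simp

lemma norm_add_squared: "(norm (x + y))\<^sup>2 = (norm x)\<^sup>2 + 2 * (x \<bullet> y) + (norm y)\<^sup>2"
  for x y :: "'b::real_inner"
  unfolding power2_norm_eq_inner by (simp add: inner_add_left inner_add_right inner_commute)

section \<open>Brownian increments and the isometry for adapted sums\<close>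

locale filtered_brownian =
  fixes M :: "'a measure" and Ft :: "real \<Rightarrow> 'a measure" and W :: "real \<Rightarrow> 'a \<Rightarrow> real^'m"
  assumes filtered: "filtered_prob_space M Ft" and brownian: "brownian_motion M Ft W"
begin

sublocale prob_space M using filtered by (simp add: filtered_prob_space_def)

lemma measurable_Ft_mono:
  assumes "f \<in> borel_measurable (Ft s)" "s \<le> t" shows "f \<in> borel_measurable (Ft t)"
proof -
  interpret filtration "space M" Ft using filtered by (simp add: filtered_prob_space_def)
  have "subalgebra (Ft t) (Ft s)"
    using sets_F_mono[OF assms(2)] by (simp add: subalgebra_def space_F)
  then show ?thesis using assms(1) by (rule measurable_from_subalg)
qed

lemma measurable_Ft:
  assumes "f \<in> borel_measurable (Ft s)" shows "f \<in> borel_measurable M"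
  using filtered assms measurable_from_subalg unfolding filtered_prob_space_def by blast

lemma space_Ft: "space (Ft s) = space M"
  using filtered by (simp add: filtered_prob_space_def subalgebra_def)

lemma W_measurable: "0 \<le> t \<Longrightarrow> W t \<in> borel_measurable (Ft t)"
  using brownian by (simp add: brownian_motion_def)

lemma W_measurable_M: "0 \<le> t \<Longrightarrow> W t \<in> borel_measurable M"
  using W_measurable measurable_Ft by blast

context
  fixes s t :: real
  assumes st: "0 \<le> s" "s < t"
begin

text \<open>G and \<phi> of the increment generate sub-\<sigma>-algebras of the two
  \<sigma>-algebras that are independent by the definition of Brownian motion.\<close>

lemma indep_increment:
  fixes G :: "'a \<Rightarrow> real" and \<phi> :: "real^'m \<Rightarrow> real"
  assumes G: "G \<in> borel_measurable (Ft s)" and [measurable]: "\<phi> \<in> borel_measurable borel"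
  shows "indep_var borel G borel (\<lambda>\<omega>. \<phi> (W t \<omega> - W s \<omega>))"
proof -
  let ?D = "\<lambda>\<omega>. W t \<omega> - W s \<omega>"
  have [measurable]: "?D \<in> borel_measurable M"
    using W_measurable_M st by (intro borel_measurable_diff) auto
  have ind: "indep_set (sets (Ft s)) (sets (vimage_algebra (space M) ?D borel))"
    using brownian st unfolding brownian_motion_def by blast
  have "sigma_sets (space M) {G -` A \<inter> space M |A. A \<in> sets borel} \<subseteq> sets (Ft s)"
    by (rule sets.sigma_sets_subset[of _ "Ft s", unfolded space_Ft])
       (use measurable_sets[OF G] space_Ft in auto)
  moreover have "sigma_sets (space M) {(\<lambda>\<omega>. \<phi> (?D \<omega>)) -` A \<inter> space M |A. A \<in> sets borel}
      \<subseteq> sets (vimage_algebra (space M) ?D borel)"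
  proof (rule sets.sigma_sets_subset[of _ "vimage_algebra (space M) ?D borel", unfolded space_vimage_algebra])
    have "(\<lambda>\<omega>. \<phi> (?D \<omega>)) \<in> borel_measurable (vimage_algebra (space M) ?D borel)"
      by (rule measurable_compose[OF measurable_vimage_algebra1]) auto
    from measurable_sets[OF this]
    show "{(\<lambda>\<omega>. \<phi> (?D \<omega>)) -` A \<inter> space M |A. A \<in> sets borel} \<subseteq> sets (vimage_algebra (space M) ?D borel)"
      by auto
  qed
  ultimately have "indep_set (sigma_sets (space M) {G -` A \<inter> space M |A. A \<in> sets borel})
      (sigma_sets (space M) {(\<lambda>\<omega>. \<phi> (?D \<omega>)) -` A \<inter> space M |A. A \<in> sets borel})"
    using ind unfolding indep_sets2_eq by blast
  then show ?thesis
    using measurable_Ft[OF G] unfolding indep_var_eq by simp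
qed

lemma increment_moments:
  shows increment_integrable: "integrable M (\<lambda>\<omega>. (W t \<omega> - W s \<omega>) $ b)"
    and increment_mean: "expectation (\<lambda>\<omega>. (W t \<omega> - W s \<omega>) $ b) = 0"
    and increment_product_integrable:
      "integrable M (\<lambda>\<omega>. (W t \<omega> - W s \<omega>) $ b * (W t \<omega> - W s \<omega>) $ c)"
    and increment_covariance:
      "expectation (\<lambda>\<omega>. (W t \<omega> - W s \<omega>) $ b * (W t \<omega> - W s \<omega>) $ c) = (if b = c then t - s else 0)"
proof -
  let ?D = "\<lambda>b \<omega>. (W t \<omega> - W s \<omega>) $ b"
  have dist: "distributed M lborel (?D b) (normal_density 0 (sqrt (t - s)))" for b
    using brownian st unfolding brownian_motion_def by blast
  have pos: "0 < sqrt (t - s)" using st by simp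
  have int: "integrable M (\<lambda>\<omega>. ?D b \<omega> ^ k)" for b k
    using integrable_normal_moment[OF pos, of 0 k]
    by (subst distributed_integrable[OF dist, symmetric]) auto
  have mean: "expectation (?D b) = 0" for b
    by (rule normal_distributed_expectation[OF pos dist])
  have sq: "expectation (\<lambda>\<omega>. ?D b \<omega> * ?D b \<omega>) = t - s" for b
    using normal_distributed_variance[OF pos dist, of b] st
    unfolding mean by (simp add: power2_eq_square)
  have ind: "indep_vars (\<lambda>_. borel) ?D UNIV"
    using brownian st unfolding brownian_motion_def by blast
  \<comment> \<open>Independence of a pair is read off from the independence of one member and a sum
    of others, here a sum over the singleton {c}.\<close>
  have indep: "indep_var borel (?D b) borel (?D c)" if "b \<noteq> c"
    using indep_vars_sum[of "{c}" b ?D] that indep_vars_subset[OF ind, of "{b, c}"] by simp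
  show "integrable M (?D b)" using int[of b 1] by simp
  show "expectation (?D b) = 0" by (rule mean)
  show "integrable M (\<lambda>\<omega>. ?D b \<omega> * ?D c \<omega>)"
  proof (cases "b = c")
    case True then show ?thesis using int[of c 2] by (simp add: power2_eq_square)
  next
    case False then show ?thesis
      using int[of _ 1] by (intro indep_var_integrable indep) auto
  qed
  show "expectation (\<lambda>\<omega>. ?D b \<omega> * ?D c \<omega>) = (if b = c then t - s else 0)"
  proof (cases "b = c")
    case True then show ?thesis using sq by simp
  next
    case False
    have int1: "integrable M (?D b)" for b using int[of b 1] by simp
    show ?thesis
      unfolding indep_var_lebesgue_integral[OF indep[OF False] int1 int1] mean using False by simp
  qed
qed

lemma increment_martingale:
  fixes G :: "'a \<Rightarrow> real^'m"
  assumes G: "G \<in> borel_measurable (Ft s)" and int: "\<And>b. integrable M (\<lambda>\<omega>. G \<omega> $ b)"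
  shows "integrable M (\<lambda>\<omega>. G \<omega> \<bullet> (W t \<omega> - W s \<omega>))"
    and "expectation (\<lambda>\<omega>. G \<omega> \<bullet> (W t \<omega> - W s \<omega>)) = 0"
proof -
  let ?D = "\<lambda>b \<omega>. (W t \<omega> - W s \<omega>) $ b"
  note [measurable] = G
  have ind: "indep_var borel (\<lambda>\<omega>. G \<omega> $ b) borel (?D b)" for b
    by (rule indep_increment) measurable
  have i: "integrable M (\<lambda>\<omega>. G \<omega> $ b * ?D b \<omega>)" for b
    by (rule indep_var_integrable[OF ind int increment_integrable])
  have e: "expectation (\<lambda>\<omega>. G \<omega> $ b * ?D b \<omega>) = 0" for b
    unfolding indep_var_lebesgue_integral[OF ind int increment_integrable] increment_mean by simp
  show "integrable M (\<lambda>\<omega>. G \<omega> \<bullet> (W t \<omega> - W s \<omega>))"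
    unfolding inner_vec_def inner_real_def by (intro Bochner_Integration.integrable_sum i)
  show "expectation (\<lambda>\<omega>. G \<omega> \<bullet> (W t \<omega> - W s \<omega>)) = 0"
    unfolding inner_vec_def inner_real_def by (subst Bochner_Integration.integral_sum) (simp_all only: i e sum.neutral_const)
qed

text \<open>The squared norm expands into a triple sum of products of entries of Z, known at time s,
  with products of two increment components, independent of them. The covariance (t - s) on the
  diagonal and 0 elsewhere leaves the sum of squared entries.\<close>

lemma increment_isometry:
  fixes Z :: "'a \<Rightarrow> real^'m^'n"
  assumes Z: "Z \<in> borel_measurable (Ft s)" and C: "\<And>\<omega>. \<omega> \<in> space M \<Longrightarrow> norm (Z \<omega>) \<le> C"
  shows "integrable M (\<lambda>\<omega>. (norm (Z \<omega> *v (W t \<omega> - W s \<omega>)))\<^sup>2)"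
    and "expectation (\<lambda>\<omega>. (norm (Z \<omega> *v (W t \<omega> - W s \<omega>)))\<^sup>2) = (t - s) * expectation (\<lambda>\<omega>. (norm (Z \<omega>))\<^sup>2)"
proof -
  let ?D = "\<lambda>b \<omega>. (W t \<omega> - W s \<omega>) $ b"
  note [measurable] = Z measurable_Ft[OF Z]
  have expand: "(norm (Z \<omega> *v (W t \<omega> - W s \<omega>)))\<^sup>2 =
      (\<Sum>a\<in>UNIV. \<Sum>b\<in>UNIV. \<Sum>c\<in>UNIV. (Z \<omega> $ a $ b * Z \<omega> $ a $ c) * (?D b \<omega> * ?D c \<omega>))" for \<omega>
    unfolding power2_norm_eq_inner inner_vec_def matrix_vector_mult_def inner_real_def vec_lambda_beta sum_product
    by (intro sum.cong refl) (simp only: ac_simps)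
  have bound: "\<bar>Z \<omega> $ a $ b\<bar> \<le> C" if "\<omega> \<in> space M" for \<omega> a b
    using C[OF that] component_le_norm_cart[of "Z \<omega> $ a" b] Finite_Cartesian_Product.norm_nth_le[of "Z \<omega>" a] by simp
  have ZZ: "integrable M (\<lambda>\<omega>. Z \<omega> $ a $ b * Z \<omega> $ a $ c)" for a b c
  proof (rule integrable_const_bound[of _ "C * C"])
    show "AE \<omega> in M. norm (Z \<omega> $ a $ b * Z \<omega> $ a $ c) \<le> C * C"
    proof (rule AE_I2)
      fix \<omega> assume "\<omega> \<in> space M"
      from bound[OF this] show "norm (Z \<omega> $ a $ b * Z \<omega> $ a $ c) \<le> C * C"
        by (simp add: abs_mult mult_mono')
    qed
  qed measurable
  have ind: "indep_var borel (\<lambda>\<omega>. Z \<omega> $ a $ b * Z \<omega> $ a $ c) borel (\<lambda>\<omega>. ?D b \<omega> * ?D c \<omega>)" for a b c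
    by (rule indep_increment[where \<phi> = "\<lambda>x. x $ b * x $ c"]) measurable
  note i = indep_var_integrable[OF ind ZZ increment_product_integrable]
  show "integrable M (\<lambda>\<omega>. (norm (Z \<omega> *v (W t \<omega> - W s \<omega>)))\<^sup>2)"
    unfolding expand by (intro Bochner_Integration.integrable_sum i)
  have "expectation (\<lambda>\<omega>. (norm (Z \<omega> *v (W t \<omega> - W s \<omega>)))\<^sup>2) =
      (\<Sum>a\<in>UNIV. \<Sum>b\<in>UNIV. \<Sum>c\<in>UNIV. expectation (\<lambda>\<omega>. (Z \<omega> $ a $ b * Z \<omega> $ a $ c) * (?D b \<omega> * ?D c \<omega>)))"
    unfolding expand by (simp only: Bochner_Integration.integral_sum Bochner_Integration.integrable_sum i)
  also have "\<dots> = (\<Sum>a\<in>UNIV. \<Sum>b\<in>UNIV. expectation (\<lambda>\<omega>. Z \<omega> $ a $ b * Z \<omega> $ a $ b) * (t - s))"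
    unfolding indep_var_lebesgue_integral[OF ind ZZ increment_product_integrable] increment_covariance
    by (intro sum.cong refl) (simp add: if_distrib cong: if_cong)
  also have "\<dots> = (t - s) * expectation (\<lambda>\<omega>. \<Sum>a\<in>UNIV. \<Sum>b\<in>UNIV. Z \<omega> $ a $ b * Z \<omega> $ a $ b)"
    by (simp add: Bochner_Integration.integral_sum ZZ sum_distrib_left mult.commute)
  also have "(\<lambda>\<omega>. \<Sum>a\<in>UNIV. \<Sum>b\<in>UNIV. Z \<omega> $ a $ b * Z \<omega> $ a $ b) = (\<lambda>\<omega>. (norm (Z \<omega>))\<^sup>2)"
    unfolding power2_norm_eq_inner inner_vec_def inner_real_def ..
  finally show "expectation (\<lambda>\<omega>. (norm (Z \<omega> *v (W t \<omega> - W s \<omega>)))\<^sup>2) = (t - s) * expectation (\<lambda>\<omega>. (norm (Z \<omega>))\<^sup>2)" .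
qed

end

context
  fixes k :: nat and a :: "nat \<Rightarrow> real" and Z :: "nat \<Rightarrow> 'a \<Rightarrow> real^'m^'n"
  assumes a0: "0 \<le> a 0" and a_mono: "\<And>i. i < k \<Longrightarrow> a i \<le> a (Suc i)"
    and Z: "\<And>i. i < k \<Longrightarrow> a i < a (Suc i) \<Longrightarrow> Z i \<in> borel_measurable (Ft (a i))"
    and Z_bounded: "\<And>i. i < k \<Longrightarrow> \<exists>C. \<forall>\<omega>\<in>space M. norm (Z i \<omega>) \<le> C"
begin

text \<open>Each new increment is orthogonal to everything known at its left end: to the partial
  sum, which gives the isometry by induction, and to V, which gives orthogonality to the past. Mesh
  points may repeat because they will be clamped; an empty interval contributes nothing, so
  adaptedness of Z is asked on nonempty intervals.\<close>

lemma increment_sum: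
  defines "T \<equiv> \<lambda>k \<omega>. \<Sum>i<k. Z i \<omega> *v (W (a (Suc i)) \<omega> - W (a i) \<omega>)"
  assumes "j \<le> k"
  shows "a 0 \<le> a j \<and> T j \<in> borel_measurable (Ft (a j)) \<and> integrable M (\<lambda>\<omega>. (norm (T j \<omega>))\<^sup>2)
    \<and> expectation (\<lambda>\<omega>. (norm (T j \<omega>))\<^sup>2) = (\<Sum>i<j. (a (Suc i) - a i) * expectation (\<lambda>\<omega>. (norm (Z i \<omega>))\<^sup>2))
    \<and> (\<forall>V. V \<in> borel_measurable (Ft (a 0)) \<longrightarrow> integrable M (\<lambda>\<omega>. (norm (V \<omega>))\<^sup>2) \<longrightarrow>
          expectation (\<lambda>\<omega>. V \<omega> \<bullet> T j \<omega>) = 0)"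
  using \<open>j \<le> k\<close>
proof (induction j)
  case 0
  show ?case by (simp add: T_def)
next
  case (Suc j)
  then have j: "j < k" and le: "a 0 \<le> a j" and Tm: "T j \<in> borel_measurable (Ft (a j))"
    and Ti: "integrable M (\<lambda>\<omega>. (norm (T j \<omega>))\<^sup>2)"
    and Te: "expectation (\<lambda>\<omega>. (norm (T j \<omega>))\<^sup>2) =
      (\<Sum>i<j. (a (Suc i) - a i) * expectation (\<lambda>\<omega>. (norm (Z i \<omega>))\<^sup>2))"
    and TV: "\<And>V. V \<in> borel_measurable (Ft (a 0)) \<Longrightarrow> integrable M (\<lambda>\<omega>. (norm (V \<omega>))\<^sup>2) \<Longrightarrow>
          expectation (\<lambda>\<omega>. V \<omega> \<bullet> T j \<omega>) = 0"
    by auto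
  let ?D = "\<lambda>\<omega>. W (a (Suc j)) \<omega> - W (a j) \<omega>"
  show ?case
  proof (cases "a j < a (Suc j)")
    case False
    with a_mono[OF j] have eq: "a (Suc j) = a j" by simp
    have "T (Suc j) = T j" by (simp add: T_def eq)
    then show ?thesis using le Tm Ti Te TV by (simp add: eq)
  next
    case True
    have st: "0 \<le> a j" "a j < a (Suc j)" using a0 le True by auto
    obtain C where C: "\<And>\<omega>. \<omega> \<in> space M \<Longrightarrow> norm (Z j \<omega>) \<le> C" using Z_bounded[OF j] by blast
    note Zm = Z[OF j True]
    note [measurable] = measurable_Ft_mono[OF Zm a_mono[OF j]] measurable_Ft_mono[OF Tm a_mono[OF j]]
      measurable_Ft[OF Zm] measurable_Ft[OF Tm]
    have [measurable]: "W (a (Suc j)) \<in> borel_measurable (Ft (a (Suc j)))"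
        "W (a j) \<in> borel_measurable (Ft (a (Suc j)))" "W (a (Suc j)) \<in> borel_measurable M"
        "W (a j) \<in> borel_measurable M"
      using st by (auto intro: W_measurable W_measurable_M measurable_Ft_mono[OF W_measurable])
    have TS: "T (Suc j) = (\<lambda>\<omega>. T j \<omega> + Z j \<omega> *v ?D \<omega>)" by (simp add: T_def)
    have orth: "integrable M (\<lambda>\<omega>. G \<omega> \<bullet> (Z j \<omega> *v ?D \<omega>)) \<and> expectation (\<lambda>\<omega>. G \<omega> \<bullet> (Z j \<omega> *v ?D \<omega>)) = 0"
      if G: "G \<in> borel_measurable (Ft (a j))" and Gi: "integrable M (\<lambda>\<omega>. (norm (G \<omega>))\<^sup>2)" for G
    proof -
      note [measurable] = G Zm measurable_Ft[OF G]
      \<comment> \<open>Moving the matrix to the other side, by its transpose, leaves a vector known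
        at time \<open>a j\<close> against the increment, so the vector case applies.\<close>
      have eq: "G \<omega> \<bullet> (Z j \<omega> *v ?D \<omega>) = (\<chi> b. \<Sum>c\<in>UNIV. G \<omega> $ c * Z j \<omega> $ c $ b) \<bullet> ?D \<omega>" for \<omega>
        unfolding inner_vec_def matrix_vector_mult_def inner_real_def vec_lambda_beta sum_distrib_left sum_distrib_right
        by (subst sum.swap) (simp only: ac_simps)
      have m: "(\<lambda>\<omega>. \<chi> b. \<Sum>c\<in>UNIV. G \<omega> $ c * Z j \<omega> $ c $ b) \<in> borel_measurable (Ft (a j))"
        by (rule borel_measurable_euclidean_space[THEN iffD2])
          (auto simp: Basis_vec_def inner_axis intro!: borel_measurable_sum borel_measurable_times borel_measurable_vec_nth G Zm)
      have i: "integrable M (\<lambda>\<omega>. \<Sum>c\<in>UNIV. G \<omega> $ c * Z j \<omega> $ c $ b)" for b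
      proof (rule Bochner_Integration.integrable_sum, rule Bochner_Integration.integrable_bound)
        fix c
        show "integrable M (\<lambda>\<omega>. (1 + (norm (G \<omega>))\<^sup>2) * C)" using Gi by simp
        show "AE \<omega> in M. norm (G \<omega> $ c * Z j \<omega> $ c $ b) \<le> norm ((1 + (norm (G \<omega>))\<^sup>2) * C)"
        proof (rule AE_I2)
          fix \<omega> assume \<omega>: "\<omega> \<in> space M"
          have "\<bar>Z j \<omega> $ c $ b\<bar> \<le> C"
            using C[OF \<omega>] component_le_norm_cart[of "Z j \<omega> $ c" b]
              Finite_Cartesian_Product.norm_nth_le[of "Z j \<omega>" c] by simp
          moreover have "\<bar>G \<omega> $ c\<bar> \<le> 1 + (norm (G \<omega>))\<^sup>2"
          proof -
            have "0 \<le> (norm (G \<omega>) - 1)\<^sup>2 + (norm (G \<omega>))\<^sup>2 + 1" by simp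
            then have "norm (G \<omega>) \<le> 1 + (norm (G \<omega>))\<^sup>2" by (simp add: power2_eq_square algebra_simps)
            then show ?thesis using component_le_norm_cart[of "G \<omega>" c] by simp
          qed
          ultimately show "norm (G \<omega> $ c * Z j \<omega> $ c $ b) \<le> norm ((1 + (norm (G \<omega>))\<^sup>2) * C)"
            by (simp add: abs_mult mult_mono')
        qed
      qed measurable
      show ?thesis
        unfolding eq using increment_martingale[OF st m] i by (simp only: vec_lambda_beta)
    qed
    note iso = increment_isometry[OF st Zm C]
    have ex: "(norm (T (Suc j) \<omega>))\<^sup>2 = (norm (T j \<omega>))\<^sup>2 + 2 * (T j \<omega> \<bullet> (Z j \<omega> *v ?D \<omega>)) + (norm (Z j \<omega> *v ?D \<omega>))\<^sup>2" for \<omega>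
      by (simp only: TS norm_add_squared)
    have "integrable M (\<lambda>\<omega>. (norm (T (Suc j) \<omega>))\<^sup>2)"
      unfolding ex using iso(1) orth[OF Tm Ti] Ti by (intro Bochner_Integration.integrable_add integrable_mult_right) auto
    moreover have "expectation (\<lambda>\<omega>. (norm (T (Suc j) \<omega>))\<^sup>2) =
        (\<Sum>i<Suc j. (a (Suc i) - a i) * expectation (\<lambda>\<omega>. (norm (Z i \<omega>))\<^sup>2))"
      unfolding ex using iso orth[OF Tm Ti] Ti by (simp add: Te del: vector_minus_component)
    moreover have "T (Suc j) \<in> borel_measurable (Ft (a (Suc j)))"
      unfolding TS by measurable
    moreover have "expectation (\<lambda>\<omega>. V \<omega> \<bullet> T (Suc j) \<omega>) = 0"
      if V: "V \<in> borel_measurable (Ft (a 0))" and Vi: "integrable M (\<lambda>\<omega>. (norm (V \<omega>))\<^sup>2)" for V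
    proof -
      have "integrable M (\<lambda>\<omega>. V \<omega> \<bullet> T j \<omega>)"
        using measurable_Ft[OF V] measurable_Ft[OF Tm] Vi Ti by (rule integrable_inner_of_squares)
      then show ?thesis
        using orth[OF measurable_Ft_mono[OF V le] Vi] TV[OF V Vi] by (simp add: TS inner_add_right)
    qed
    ultimately show ?thesis using le True by auto
  qed
qed

end

section \<open>It\^o integrals of integrands bounded on an event\<close>

context
  fixes k :: nat and a :: "nat \<Rightarrow> real" and Z :: "nat \<Rightarrow> 'a \<Rightarrow> real^'m^'n"
  assumes a0: "0 \<le> a 0" and a_mono: "\<And>i. i < k \<Longrightarrow> a i \<le> a (Suc i)"
    and Z: "\<And>i. i < k \<Longrightarrow> a i < a (Suc i) \<Longrightarrow> Z i \<in> borel_measurable (Ft (a i))"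
    and Z_bounded: "\<And>i. i < k \<Longrightarrow> \<exists>C. \<forall>\<omega>\<in>space M. norm (Z i \<omega>) \<le> C"
begin

text \<open>The integrand is switched off as soon as its energy exceeds \<open>\<delta>\<close>; this is adapted, because the
  energy up to the end of the \<open>i\<close>-th interval is already known at its start.\<close>

lemma increment_sum_tail:
  assumes "\<delta> \<ge> 0" "\<epsilon> > 0"
  shows "measure M {\<omega> \<in> space M. \<epsilon> \<le> norm (\<Sum>i<k. Z i \<omega> *v (W (a (Suc i)) \<omega> - W (a i) \<omega>))
      \<and> (\<Sum>i<k. (a (Suc i) - a i) * (norm (Z i \<omega>))\<^sup>2) \<le> \<delta>} \<le> \<delta> / \<epsilon>\<^sup>2"
proof -
  define E where "E j \<omega> = (\<Sum>i<j. (a (Suc i) - a i) * (norm (Z i \<omega>))\<^sup>2)" for j \<omega>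
  \<comment> \<open>The test looks at \<open>E (Suc i)\<close>, which includes the i-th interval
    itself, so the energy of Y cannot overshoot \<delta>.\<close>
  define Y where "Y i \<omega> = (if E (Suc i) \<omega> \<le> \<delta> then Z i \<omega> else 0)" for i \<omega>
  define T where "T Z j \<omega> = (\<Sum>i<j. Z i \<omega> *v (W (a (Suc i)) \<omega> - W (a i) \<omega>))"
    for Z :: "nat \<Rightarrow> 'a \<Rightarrow> real^'m^'n" and j \<omega>
  have mono: "a i \<le> a j" if "i \<le> j" "j \<le> k" for i j
    using that
  proof (induction rule: dec_induct)
    case (step n)
    then show ?case using a_mono[of n] by simp
  qed simp
  have E_meas: "E (Suc j) \<in> borel_measurable (Ft (a j))" if "j < k" for j
    unfolding E_def
  proof (rule borel_measurable_sum)
    fix i assume i: "i \<in> {..<Suc j}"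
    show "(\<lambda>\<omega>. (a (Suc i) - a i) * (norm (Z i \<omega>))\<^sup>2) \<in> borel_measurable (Ft (a j))"
    proof (cases "a i < a (Suc i)")
      case True
      have "Z i \<in> borel_measurable (Ft (a j))"
        using measurable_Ft_mono[OF Z mono, of i j] True i that by simp
      then show ?thesis by measurable
    next
      case False
      then have "a (Suc i) = a i" using a_mono[of i] i that by simp
      then show ?thesis by simp
    qed
  qed
  have Y_meas: "Y i \<in> borel_measurable (Ft (a i))" if "i < k" "a i < a (Suc i)" for i
  proof -
    note [measurable] = Z[OF that] E_meas[OF that(1)]
    show ?thesis unfolding Y_def by measurable
  qed
  have Y_bounded: "\<exists>C. \<forall>\<omega>\<in>space M. norm (Y i \<omega>) \<le> C" if i: "i < k" for i
  proof -
    obtain C where "\<forall>\<omega>\<in>space M. norm (Z i \<omega>) \<le> C" using Z_bounded[OF i] by blast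
    then have "\<forall>\<omega>\<in>space M. norm (Y i \<omega>) \<le> \<bar>C\<bar>" by (auto simp: Y_def intro: order_trans)
    then show ?thesis by blast
  qed
  have E_step: "E (Suc j) \<omega> = E j \<omega> + (a (Suc j) - a j) * (norm (Z j \<omega>))\<^sup>2" for j \<omega>
    by (simp add: E_def)
  have E_mono: "E j \<omega> \<le> E (Suc j) \<omega>" if "j < k" for j \<omega>
    using a_mono[OF that] by (simp add: E_step)
  \<comment> \<open>Both bounds feed the induction: if the new term is on, the bound by
    \<open>E j\<close> gives \<open>E (Suc j)\<close>, which is at most \<delta> by the test; if it
    is off, nothing is added.\<close>
  have energy: "(\<Sum>i<j. (a (Suc i) - a i) * (norm (Y i \<omega>))\<^sup>2) \<le> min \<delta> (E j \<omega>)" if "j \<le> k" for j \<omega>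
    using that
  proof (induction j)
    case 0 then show ?case using \<open>\<delta> \<ge> 0\<close> by (simp add: E_def)
  next
    case (Suc j)
    then have "(\<Sum>i<j. (a (Suc i) - a i) * (norm (Y i \<omega>))\<^sup>2) \<le> min \<delta> (E j \<omega>)" by simp
    then show ?case using E_mono[of j \<omega>] Suc.prems by (auto simp: Y_def E_step)
  qed
  have isum: "integrable M (\<lambda>\<omega>. (norm (T Y k \<omega>))\<^sup>2)"
      "expectation (\<lambda>\<omega>. (norm (T Y k \<omega>))\<^sup>2) = (\<Sum>i<k. (a (Suc i) - a i) * expectation (\<lambda>\<omega>. (norm (Y i \<omega>))\<^sup>2))"
    using increment_sum[where Z = Y and k = k and j = k and a = a, OF a0 a_mono Y_meas Y_bounded]
    by (auto simp: T_def)
  have Y_int: "integrable M (\<lambda>\<omega>. (a (Suc i) - a i) * (norm (Y i \<omega>))\<^sup>2)" if i: "i < k" for i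
  proof (cases "a i < a (Suc i)")
    case True
    obtain C where C: "\<forall>\<omega>\<in>space M. norm (Y i \<omega>) \<le> C" using Y_bounded[OF i] by blast
    have [measurable]: "Y i \<in> borel_measurable M" by (rule measurable_Ft[OF Y_meas[OF i True]])
    have "integrable M (\<lambda>\<omega>. (norm (Y i \<omega>))\<^sup>2)"
      by (rule integrable_const_bound[of _ "C\<^sup>2"]) (use C in \<open>auto intro!: AE_I2 power_mono\<close>)
    then show ?thesis by simp
  next
    case False
    then show ?thesis using a_mono[OF i] by simp
  qed
  have "(\<Sum>i<k. (a (Suc i) - a i) * expectation (\<lambda>\<omega>. (norm (Y i \<omega>))\<^sup>2))
      = expectation (\<lambda>\<omega>. \<Sum>i<k. (a (Suc i) - a i) * (norm (Y i \<omega>))\<^sup>2)"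
    using Y_int by (subst Bochner_Integration.integral_sum) auto
  also have "\<dots> \<le> expectation (\<lambda>\<omega>. \<delta>)"
    using Y_int energy[of k] by (intro integral_mono Bochner_Integration.integrable_sum) auto
  finally have le: "expectation (\<lambda>\<omega>. (norm (T Y k \<omega>))\<^sup>2) \<le> \<delta>" using isum(2) by (simp add: prob_space)
  \<comment> \<open>While the total energy is at most \<delta>, no test fails and Y agrees with Z.
    The tail of Z is thus a tail of Y, whose second moment is at most \<delta>.\<close>
  have "{\<omega> \<in> space M. \<epsilon> \<le> norm (T Z k \<omega>) \<and> E k \<omega> \<le> \<delta>} \<subseteq> {\<omega> \<in> space M. \<epsilon>\<^sup>2 \<le> (norm (T Y k \<omega>))\<^sup>2}"
  proof safe
    fix \<omega> assume \<omega>: "\<epsilon> \<le> norm (T Z k \<omega>)" "E k \<omega> \<le> \<delta>"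
    have "E (Suc i) \<omega> \<le> E k \<omega>" if "i < k" for i
    proof -
      have "Suc i \<le> k" using that by simp
      then show ?thesis
      proof (induction rule: inc_induct)
        case (step n) then show ?case using E_mono[of n \<omega>] by simp
      qed simp
    qed
    then have "Y i \<omega> = Z i \<omega>" if "i < k" for i using that \<omega>(2) order_trans unfolding Y_def by fastforce
    then have "T Y k \<omega> = T Z k \<omega>" by (simp add: T_def)
    then show "\<epsilon>\<^sup>2 \<le> (norm (T Y k \<omega>))\<^sup>2" using \<omega>(1) \<open>\<epsilon> > 0\<close> by (simp add: power_mono)
  qed
  then have "measure M {\<omega> \<in> space M. \<epsilon> \<le> norm (T Z k \<omega>) \<and> E k \<omega> \<le> \<delta>}
      \<le> measure M {\<omega> \<in> space M. \<epsilon>\<^sup>2 \<le> (norm (T Y k \<omega>))\<^sup>2}"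
    using isum(1) by (intro finite_measure_mono) auto
  also have "\<dots> \<le> expectation (\<lambda>\<omega>. (norm (T Y k \<omega>))\<^sup>2) / \<epsilon>\<^sup>2"
    using isum(1) \<open>\<epsilon> > 0\<close> by (intro integral_Markov_inequality_measure[where A = "{}"]) auto
  also have "\<dots> \<le> \<delta> / \<epsilon>\<^sup>2" using le by (simp add: divide_right_mono)
  finally show ?thesis by (simp add: T_def E_def)
qed

end

section \<open>From convergence in probability to almost sure convergence\<close>

lemma converges_in_prob_L1:
  fixes U :: "nat \<Rightarrow> 'a \<Rightarrow> real"
  assumes meas: "\<And>n. U n \<in> borel_measurable M" and bnd: "\<And>n \<omega>. 0 \<le> U n \<omega> \<and> U n \<omega> \<le> 1"
    and prob: "\<And>\<epsilon>. \<epsilon> > 0 \<Longrightarrow> (\<lambda>n. measure M {\<omega> \<in> space M. \<epsilon> < U n \<omega>}) \<longlonglongrightarrow> 0"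
  shows "(\<lambda>n. expectation (U n)) \<longlonglongrightarrow> 0"
proof (rule LIMSEQ_I)
  fix e :: real assume e: "e > 0"
  note [measurable] = meas
  from LIMSEQ_D[OF prob[of "e/2"], of "e/2"] e obtain N
    where N: "\<And>n. n \<ge> N \<Longrightarrow> measure M {\<omega> \<in> space M. e/2 < U n \<omega>} < e/2" by auto
  have int: "integrable M (U n)" for n
    using bnd by (intro integrable_const_bound[of _ 1]) auto
  have "norm (expectation (U n) - 0) < e" if "n \<ge> N" for n
  proof -
    have i: "integrable M (indicat_real {\<omega> \<in> space M. e/2 < U n \<omega>})"
      by (intro integrable_real_indicator) (auto simp: less_top[symmetric])
    have "expectation (U n) \<le> expectation (\<lambda>\<omega>. e/2 + indicator {\<omega> \<in> space M. e/2 < U n \<omega>} \<omega>)"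
    proof (rule integral_mono[OF int])
      show "integrable M (\<lambda>\<omega>. e/2 + indicator {\<omega> \<in> space M. e/2 < U n \<omega>} \<omega>)" using i by simp
      fix \<omega> assume "\<omega> \<in> space M"
      then show "U n \<omega> \<le> e/2 + indicator {\<omega> \<in> space M. e/2 < U n \<omega>} \<omega>"
        using bnd[of n \<omega>] e by (cases "e/2 < U n \<omega>") auto
    qed
    also have "\<dots> = e/2 + measure M {\<omega> \<in> space M. e/2 < U n \<omega>}"
      using i by (subst Bochner_Integration.integral_add) (auto simp: prob_space)
    also have "\<dots> < e" using N[OF that] by simp
    finally show ?thesis using bnd by (simp add: Bochner_Integration.integral_nonneg)
  qed
  then show "\<exists>N. \<forall>n\<ge>N. norm (expectation (U n) - 0) < e" by blast
qed

text \<open>The sum of the m sequences, each capped at 1, tends to 0 in mean, so a single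
  subsequence of it converges almost surely and serves all of them. The cap is harmless because a
  capped sequence tending to 0 eventually equals the original.\<close>

lemma AE_common_subsequence:
  fixes U :: "nat \<Rightarrow> nat \<Rightarrow> 'a \<Rightarrow> real"
  assumes meas: "\<And>i n. i < m \<Longrightarrow> U i n \<in> borel_measurable M" and nonneg: "\<And>i n \<omega>. 0 \<le> U i n \<omega>"
    and prob: "\<And>i \<epsilon>. i < m \<Longrightarrow> \<epsilon> > 0 \<Longrightarrow> (\<lambda>n. measure M {\<omega> \<in> space M. \<epsilon> < U i n \<omega>}) \<longlonglongrightarrow> 0"
  obtains \<rho> where "strict_mono \<rho>" "AE \<omega> in M. \<forall>i<m. (\<lambda>n. U i (\<rho> n) \<omega>) \<longlonglongrightarrow> 0"
proof -
  define S where "S n \<omega> = (\<Sum>i<m. min 1 (U i n \<omega>))" for n \<omega>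
  have int: "integrable M (\<lambda>\<omega>. min 1 (U i n \<omega>))" if "i < m" for i n
    using meas[OF that] nonneg by (intro integrable_const_bound[of _ 1]) auto
  have "(\<lambda>n. expectation (\<lambda>\<omega>. min 1 (U i n \<omega>))) \<longlonglongrightarrow> 0" if i: "i < m" for i
  proof (rule converges_in_prob_L1)
    note [measurable] = meas[OF i]
    show "(\<lambda>\<omega>. min 1 (U i n \<omega>)) \<in> borel_measurable M" for n by measurable
    show "0 \<le> min 1 (U i n \<omega>) \<and> min 1 (U i n \<omega>) \<le> 1" for n \<omega> using nonneg by simp
    fix \<epsilon> :: real assume \<epsilon>: "\<epsilon> > 0"
    show "(\<lambda>n. measure M {\<omega> \<in> space M. \<epsilon> < min 1 (U i n \<omega>)}) \<longlonglongrightarrow> 0"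
      by (rule tendsto_sandwich[OF _ _ tendsto_const prob[OF i \<epsilon>]])
         (auto intro!: always_eventually finite_measure_mono)
  qed
  then have "(\<lambda>n. \<Sum>i<m. expectation (\<lambda>\<omega>. min 1 (U i n \<omega>))) \<longlonglongrightarrow> (\<Sum>i<m. 0)"
    by (intro tendsto_sum) auto
  moreover have "(\<Sum>i<m. expectation (\<lambda>\<omega>. min 1 (U i n \<omega>))) = expectation (\<lambda>\<omega>. norm (S n \<omega>))" for n
  proof -
    have "norm (S n \<omega>) = S n \<omega>" for \<omega> using nonneg by (simp add: S_def sum_nonneg)
    then show ?thesis unfolding S_def using int by (subst Bochner_Integration.integral_sum[symmetric]) auto
  qed
  ultimately have "(\<lambda>n. expectation (\<lambda>\<omega>. norm (S n \<omega>))) \<longlonglongrightarrow> 0" by simp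
  moreover have "integrable M (S n)" for n unfolding S_def using int by auto
  ultimately obtain \<rho> where \<rho>: "strict_mono \<rho>" "AE \<omega> in M. (\<lambda>n. S (\<rho> n) \<omega>) \<longlonglongrightarrow> 0"
    using tendsto_L1_AE_subseq[of M S] by blast
  have *: "\<forall>i<m. (\<lambda>n. U i (\<rho> n) \<omega>) \<longlonglongrightarrow> 0" if S: "(\<lambda>n. S (\<rho> n) \<omega>) \<longlonglongrightarrow> 0" for \<omega>
  proof safe
    fix i assume i: "i < m"
    have lim: "(\<lambda>n. min 1 (U i (\<rho> n) \<omega>)) \<longlonglongrightarrow> 0"
    proof (rule tendsto_sandwich[OF _ _ tendsto_const S])
      show "\<forall>\<^sub>F n in sequentially. min 1 (U i (\<rho> n) \<omega>) \<le> S (\<rho> n) \<omega>"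
        unfolding S_def using i nonneg
        by (intro always_eventually allI member_le_sum[where f = "\<lambda>i. min 1 (U i _ _)"]) auto
    qed (use nonneg in auto)
    then have "\<forall>\<^sub>F n in sequentially. min 1 (U i (\<rho> n) \<omega>) < 1" by (rule order_tendstoD) simp
    then have "\<forall>\<^sub>F n in sequentially. min 1 (U i (\<rho> n) \<omega>) = U i (\<rho> n) \<omega>"
      by eventually_elim auto
    with lim show "(\<lambda>n. U i (\<rho> n) \<omega>) \<longlonglongrightarrow> 0" by (rule Lim_transform_eventually)
  qed
  from \<rho>(2) have "AE \<omega> in M. \<forall>i<m. (\<lambda>n. U i (\<rho> n) \<omega>) \<longlonglongrightarrow> 0"
  proof eventually_elim
    case (elim \<omega>)
    then show ?case by (rule *)
  qed
  with \<rho>(1) show thesis by (rule that)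
qed

lemma increment_sum_measurable:
  assumes "\<And>i. i < k \<Longrightarrow> Z i \<in> borel_measurable M" "\<And>i. 0 \<le> a i"
  shows "(\<lambda>\<omega>. \<Sum>i<k. Z i \<omega> *v (W (a (Suc i)) \<omega> - W (a i) \<omega>)) \<in> borel_measurable M"
  using assms W_measurable_M
  by (intro borel_measurable_sum borel_measurable_matrix_vector_mult borel_measurable_diff) auto

text \<open>N is the simple integral over [s,t] of the approximants projected to the ball of radius
  r and switched on by A, which is known at time s; so it is orthogonal to the past and obeys the
  isometry, with Q the energy along a path before A is imposed. The event B may anticipate the
  future and occurs only in the limits. There H is bounded by r, so the projection error has energy
  at most 4 D, and \<open>increment_sum_tail\<close> makes its integral tend to 0 in
  probability.\<close>

lemma ito_localized:
  fixes H :: "real \<Rightarrow> 'a \<Rightarrow> real^'m^'n" and I :: "real \<Rightarrow> 'a \<Rightarrow> real^'n"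
  assumes ito: "has_ito_integral M Ft W H I" and st: "0 \<le> s" "s < t"
    and A: "A \<in> sets (Ft s)" and B: "B \<in> sets M" "B \<subseteq> A"
    and r: "r \<ge> 0" and H: "\<And>\<omega> u. \<omega> \<in> B \<Longrightarrow> u \<in> {0..t} \<Longrightarrow> norm (H u \<omega>) \<le> r"
  obtains N :: "nat \<Rightarrow> 'a \<Rightarrow> real^'n" and Q :: "nat \<Rightarrow> 'a \<Rightarrow> real" where
    "\<And>n. N n \<in> borel_measurable M" "\<And>n. integrable M (\<lambda>\<omega>. (norm (N n \<omega>))\<^sup>2)"
    "\<And>n V. V \<in> borel_measurable (Ft s) \<Longrightarrow> integrable M (\<lambda>\<omega>. (norm (V \<omega>))\<^sup>2) \<Longrightarrow>
      expectation (\<lambda>\<omega>. V \<omega> \<bullet> N n \<omega>) = 0"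
    "\<And>n. Q n \<in> borel_measurable M" "\<And>n \<omega>. 0 \<le> Q n \<omega> \<and> Q n \<omega> \<le> r\<^sup>2 * (t - s)"
    "\<And>n. expectation (\<lambda>\<omega>. (norm (N n \<omega>))\<^sup>2) = expectation (\<lambda>\<omega>. indicator A \<omega> * Q n \<omega>)"
    "AE \<omega> in M. \<omega> \<in> B \<longrightarrow> (\<lambda>n. N n \<omega>) \<longlonglongrightarrow> I t \<omega> - I s \<omega>"
    "AE \<omega> in M. \<omega> \<in> B \<longrightarrow> (\<lambda>n. Q n \<omega>) \<longlonglongrightarrow> (LINT u:{s..t}|lborel. (norm (H u \<omega>))\<^sup>2)"
proof -
  from ito obtain k p \<xi> where simple: "\<And>n. simple_integrand M Ft (k n) (p n) (\<xi> n)"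
    and conv: "\<And>t. t \<ge> 0 \<Longrightarrow> converges_in_prob M
             (\<lambda>n \<omega>. LINT s:{0..t}|lborel. (norm (simple_process (k n) (p n) (\<xi> n) s \<omega> - H s \<omega>))\<^sup>2) (\<lambda>_. 0)"
      "\<And>t. t \<ge> 0 \<Longrightarrow> converges_in_prob M (\<lambda>n. simple_ito_integral W (k n) (p n) (\<xi> n) t) (I t)"
    unfolding has_ito_integral_def by blast
  define C where "C = closest_point (cball (0::real^'m^'n) r)"
  define a where "a n i = clamp_time s t (p n i)" for n i
  define Zc where "Zc n i \<omega> = indicator A \<omega> *\<^sub>R C (\<xi> n i \<omega>)" for n i \<omega>
  define \<eta> where "\<eta> n i \<omega> = C (\<xi> n i \<omega>) - \<xi> n i \<omega>" for n i \<omega>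
  define N where "N n \<omega> = (\<Sum>i<k n. Zc n i \<omega> *v (W (a n (Suc i)) \<omega> - W (a n i) \<omega>))" for n \<omega>
  define T where "T n \<omega> = (\<Sum>i<k n. \<eta> n i \<omega> *v (W (a n (Suc i)) \<omega> - W (a n i) \<omega>))" for n \<omega>
  define Q where "Q n \<omega> = (\<Sum>i<k n. (a n (Suc i) - a n i) * (norm (C (\<xi> n i \<omega>)))\<^sup>2)" for n \<omega>
  define D where "D n \<omega> = (LINT u:{0..t}|lborel. (norm (simple_process (k n) (p n) (\<xi> n) u \<omega> - H u \<omega>))\<^sup>2)" for n \<omega>
  define J where "J n = simple_ito_integral W (k n) (p n) (\<xi> n)" for n
  have C_meas: "C \<in> borel_measurable borel" unfolding C_def by (rule closest_cball_measurable[OF r])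
  have C_norm: "norm (C x) \<le> r" for x unfolding C_def by (rule closest_cball_props[OF r])
  note [measurable] = C_meas B(1)
  have [measurable]: "A \<in> sets M" using A filtered by (auto simp: filtered_prob_space_def subalgebra_def)
  have p: "p n i < p n (Suc i)" if "i < k n" for n i
    using simple[of n] that by (auto simp: simple_integrand_def)
  have \<xi>_meas: "\<xi> n i \<in> borel_measurable (Ft (p n i))" if "i < k n" for n i
    using simple[of n] that by (auto simp: simple_integrand_def)
  have \<xi>_meas_M [measurable]: "\<xi> n i \<in> borel_measurable M" if "i < k n" for n i
    using \<xi>_meas[OF that] by (rule measurable_Ft)
  have \<xi>_bounded: "\<exists>c. \<forall>\<omega>\<in>space M. norm (\<xi> n i \<omega>) \<le> c" if "i < k n" for n i
    using simple[of n] that by (auto simp: simple_integrand_def)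
  have a_ge: "s \<le> a n i" and a_le: "a n i \<le> t" for n i using st by (auto simp: a_def clamp_time_def)
  then have a_nonneg: "0 \<le> a n i" for n i using st(1) order_trans by blast
  have a_mono: "a n i \<le> a n (Suc i)" if "i < k n" for n i
    using p[OF that] by (auto simp: a_def clamp_time_def)
  have \<xi>_meas_a: "\<xi> n i \<in> borel_measurable (Ft (a n i))" if "i < k n" "a n i < a n (Suc i)" for n i
  proof -
    \<comment> \<open>A nonempty clamped interval forces \<open>p n i < t\<close>, so clamping can
      only delay its left end, where \<xi> is still known.\<close>
    have "p n i \<le> a n i" using that(2) by (auto simp: a_def clamp_time_def)
    with \<xi>_meas[OF that(1)] show ?thesis by (rule measurable_Ft_mono)
  qed
  have A_meas: "indicat_real A \<in> borel_measurable (Ft (a n i))" for n i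
    by (rule measurable_Ft_mono[OF borel_measurable_indicator[OF A] a_ge])
  have Zc_meas: "Zc n i \<in> borel_measurable (Ft (a n i))" if "i < k n" "a n i < a n (Suc i)" for n i
  proof -
    note [measurable] = \<xi>_meas_a[OF that] A_meas[of n i]
    show ?thesis unfolding Zc_def by measurable
  qed
  have Zc_meas_M: "Zc n i \<in> borel_measurable M" if "i < k n" for n i
  proof -
    note [measurable] = \<xi>_meas_M[OF that]
    show ?thesis unfolding Zc_def by measurable
  qed
  have Zc_norm: "norm (Zc n i \<omega>) \<le> r" for n i \<omega> using C_norm[of "\<xi> n i \<omega>"] r by (simp add: Zc_def indicator_def)
  have \<eta>_meas: "\<eta> n i \<in> borel_measurable (Ft (a n i))" if "i < k n" "a n i < a n (Suc i)" for n i
  proof -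
    note [measurable] = \<xi>_meas_a[OF that]
    show ?thesis unfolding \<eta>_def by measurable
  qed
  have \<eta>_meas_M: "\<eta> n i \<in> borel_measurable M" if "i < k n" for n i
  proof -
    note [measurable] = \<xi>_meas_M[OF that]
    show ?thesis unfolding \<eta>_def by measurable
  qed
  have \<eta>_bounded: "\<exists>c. \<forall>\<omega>\<in>space M. norm (\<eta> n i \<omega>) \<le> c" if i: "i < k n" for n i
  proof -
    obtain c where c: "\<forall>\<omega>\<in>space M. norm (\<xi> n i \<omega>) \<le> c" using \<xi>_bounded[OF i] by blast
    have "norm (\<eta> n i \<omega>) \<le> r + c" if "\<omega> \<in> space M" for \<omega>
      using c that C_norm[of "\<xi> n i \<omega>"] unfolding \<eta>_def by (intro norm_triangle_le_diff add_mono) auto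
    then show ?thesis by blast
  qed
  have N_props: "integrable M (\<lambda>\<omega>. (norm (N n \<omega>))\<^sup>2)"
    "expectation (\<lambda>\<omega>. (norm (N n \<omega>))\<^sup>2) = (\<Sum>i<k n. (a n (Suc i) - a n i) * expectation (\<lambda>\<omega>. (norm (Zc n i \<omega>))\<^sup>2))"
    "\<And>V. V \<in> borel_measurable (Ft (a n 0)) \<Longrightarrow> integrable M (\<lambda>\<omega>. (norm (V \<omega>))\<^sup>2) \<Longrightarrow>
      expectation (\<lambda>\<omega>. V \<omega> \<bullet> N n \<omega>) = 0" for n
    using increment_sum[where Z = "Zc n" and k = "k n" and j = "k n" and a = "a n", OF a_nonneg a_mono Zc_meas]
      Zc_norm by (auto simp: N_def)
  have N_meas: "N n \<in> borel_measurable M" for n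
    unfolding N_def using Zc_meas_M a_nonneg by (intro increment_sum_measurable) auto
  have T_meas: "T n \<in> borel_measurable M" for n
    unfolding T_def using \<eta>_meas_M a_nonneg by (intro increment_sum_measurable) auto
  have Q_meas: "Q n \<in> borel_measurable M" for n
    unfolding Q_def
  proof (rule borel_measurable_sum)
    fix i assume "i \<in> {..<k n}"
    then have [measurable]: "\<xi> n i \<in> borel_measurable M" using \<xi>_meas_M by simp
    show "(\<lambda>\<omega>. (a n (Suc i) - a n i) * (norm (C (\<xi> n i \<omega>)))\<^sup>2) \<in> borel_measurable M" by measurable
  qed
  have Q_bounds: "0 \<le> Q n \<omega> \<and> Q n \<omega> \<le> r\<^sup>2 * (t - s)" for n \<omega>
  proof
    show "0 \<le> Q n \<omega>" unfolding Q_def using a_mono by (intro sum_nonneg) auto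
    have "Q n \<omega> \<le> (\<Sum>i<k n. (a n (Suc i) - a n i) * r\<^sup>2)"
      unfolding Q_def using a_mono C_norm by (intro sum_mono mult_left_mono power_mono) auto
    also have "\<dots> = (a n (k n) - a n 0) * r\<^sup>2"
      by (simp add: sum_distrib_right[symmetric] sum_lessThan_telescope)
    also have "\<dots> \<le> (t - s) * r\<^sup>2" using a_le[of n "k n"] a_ge[of n 0] by (intro mult_right_mono) auto
    finally show "Q n \<omega> \<le> r\<^sup>2 * (t - s)" by (simp add: mult.commute)
  qed
  have N_energy: "expectation (\<lambda>\<omega>. (norm (N n \<omega>))\<^sup>2) = expectation (\<lambda>\<omega>. indicator A \<omega> * Q n \<omega>)" for n
  proof -
    have "integrable M (\<lambda>\<omega>. (norm (Zc n i \<omega>))\<^sup>2)" if "i < k n" for i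
      using Zc_meas_M[OF that] Zc_norm by (intro integrable_const_bound[of _ "r\<^sup>2"]) (auto intro!: power_mono)
    then have "expectation (\<lambda>\<omega>. (norm (N n \<omega>))\<^sup>2)
        = expectation (\<lambda>\<omega>. \<Sum>i<k n. (a n (Suc i) - a n i) * (norm (Zc n i \<omega>))\<^sup>2)"
      unfolding N_props(2) by (subst Bochner_Integration.integral_sum) auto
    also have "\<dots> = expectation (\<lambda>\<omega>. indicator A \<omega> * Q n \<omega>)"
      by (intro Bochner_Integration.integral_cong refl)
         (auto simp: Q_def Zc_def sum_distrib_left indicator_def)
    finally show ?thesis .
  qed
  \<comment> \<open>Cutting a simple integral at t and at s and subtracting leaves exactly the
    increments between clamped mesh points.\<close>
  have J_diff: "J n t \<omega> - J n s \<omega> = (\<Sum>i<k n. \<xi> n i \<omega> *v (W (a n (Suc i)) \<omega> - W (a n i) \<omega>))" for n \<omega>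
  proof -
    have cl: "W (min x t) \<omega> - W (min x s) \<omega> = W (clamp_time s t x) \<omega> - W s \<omega>" for x
      using st by (cases "x \<le> s") (auto simp: clamp_time_def min_def max_def)
    have "W (clamp_time s t y) \<omega> - W (clamp_time s t x) \<omega> =
        (W (min y t) \<omega> - W (min x t) \<omega>) - (W (min y s) \<omega> - W (min x s) \<omega>)" for x y
    proof -
      have "(W (min y t) \<omega> - W (min x t) \<omega>) - (W (min y s) \<omega> - W (min x s) \<omega>)
          = (W (min y t) \<omega> - W (min y s) \<omega>) - (W (min x t) \<omega> - W (min x s) \<omega>)" by simp
      then show ?thesis by (simp only: cl) simp
    qed
    then show ?thesis
      by (simp only: J_def simple_ito_integral_def a_def matrix_vector_mult_diff_distrib sum_subtractf)
  qed
  have N_T: "N n \<omega> = (J n t \<omega> - J n s \<omega>) + T n \<omega>" if "\<omega> \<in> A" for n \<omega>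
    using that by (simp add: N_def T_def J_diff Zc_def \<eta>_def matrix_vector_mult_diff_rdistrib sum_subtractf
        del: vector_minus_component)
  have slice: "(\<lambda>u. indicator {0..t} u *\<^sub>R H u \<omega>) \<in> borel_measurable borel" if "\<omega> \<in> B" for \<omega>
  proof -
    have "\<omega> \<in> space (Ft t)" using that B(1) sets.sets_into_space space_Ft by blast
    moreover have "(\<lambda>(s, \<omega>). H s \<omega>) \<in> borel_measurable (restrict_space borel {0..t} \<Otimes>\<^sub>M Ft t)"
      using ito st by (simp add: has_ito_integral_def progressively_measurable_def)
    ultimately have "(\<lambda>u. H u \<omega>) \<in> borel_measurable (restrict_space borel {0..t})"
      using measurable_compose[OF measurable_Pair2'[of \<omega>]] by fastforce
    then show ?thesis by (subst (asm) borel_measurable_restrict_space_iff) auto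
  qed
  have trunc: "(\<Sum>i<k n. (a n (Suc i) - a n i) * (norm (\<eta> n i \<omega>))\<^sup>2) \<le> 4 * D n \<omega>"
    "e > 0 \<Longrightarrow> \<bar>Q n \<omega> - (LINT u:{s..t}|lborel. (norm (H u \<omega>))\<^sup>2)\<bar> \<le> r * (e * (t - s) + D n \<omega> / e)"
    if "\<omega> \<in> B" for n \<omega> e
    using truncation_estimates[where r = r and k = "k n" and p = "p n" and s = s and t = t
        and h = "\<lambda>u. H u \<omega>" and z = "\<lambda>i. \<xi> n i \<omega>", OF r p st slice[OF that] H[OF that]]
    by (simp_all add: \<eta>_def a_def Q_def D_def C_def simple_process_def)
  \<comment> \<open>Four sequences must converge along one subsequence: the approximation error, the
    integrals at t and at s, and the integral of the projection error. The last carries the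
    indicator of B because its energy is controlled only there.\<close>
  define U where "U i n \<omega> = (if i = 0 then \<bar>D n \<omega>\<bar> else if i = 1 then dist (J n t \<omega>) (I t \<omega>)
      else if i = 2 then dist (J n s \<omega>) (I s \<omega>) else indicator B \<omega> * norm (T n \<omega>))" for i :: nat and n \<omega>
  have t0: "0 \<le> t" using st by simp
  have [measurable]: "D n \<in> borel_measurable M" "J n t \<in> borel_measurable M" "J n s \<in> borel_measurable M"
      "I t \<in> borel_measurable M" "I s \<in> borel_measurable M" for n
    using conv(1)[OF t0] conv(2)[OF t0] conv(2)[OF st(1)] by (auto simp: converges_in_prob_def D_def[abs_def] J_def)
  note [measurable] = T_meas
  have D_prob: "(\<lambda>n. measure M {\<omega> \<in> space M. \<epsilon> < \<bar>D n \<omega>\<bar>}) \<longlonglongrightarrow> 0" if "\<epsilon> > 0" for \<epsilon>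
    using conv(1)[OF t0] that by (simp add: converges_in_prob_def D_def)
  have T_prob: "(\<lambda>n. measure M {\<omega> \<in> space M. \<epsilon> < indicator B \<omega> * norm (T n \<omega>)}) \<longlonglongrightarrow> 0" if \<epsilon>: "\<epsilon> > 0" for \<epsilon>
  proof (rule LIMSEQ_I)
    fix e :: real assume e: "e > 0"
    \<comment> \<open>With this choice the tail bound \<delta> / \<epsilon>^2 is e/2. The threshold
      \<delta>/4 for D matches the factor 4 in the energy of the projection error.\<close>
    define \<delta> where "\<delta> = e / 2 * \<epsilon>\<^sup>2"
    have \<delta>: "\<delta> > 0" using e \<epsilon> by (simp add: \<delta>_def)
    from LIMSEQ_D[OF D_prob[of "\<delta>/4"], of "e/2"] e \<delta> obtain n0
      where n0: "\<And>n. n \<ge> n0 \<Longrightarrow> measure M {\<omega> \<in> space M. \<delta>/4 < \<bar>D n \<omega>\<bar>} < e/2" by auto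
    have "norm (measure M {\<omega> \<in> space M. \<epsilon> < indicator B \<omega> * norm (T n \<omega>)} - 0) < e" if n: "n \<ge> n0" for n
    proof -
      let ?E = "\<lambda>\<omega>. \<Sum>i<k n. (a n (Suc i) - a n i) * (norm (\<eta> n i \<omega>))\<^sup>2"
      let ?S = "{\<omega> \<in> space M. \<epsilon> \<le> norm (T n \<omega>) \<and> ?E \<omega> \<le> \<delta>}"
      have [measurable]: "?E \<in> borel_measurable M"
        using \<eta>_meas_M by (intro borel_measurable_sum borel_measurable_times borel_measurable_power) auto
      have "measure M {\<omega> \<in> space M. \<epsilon> < indicator B \<omega> * norm (T n \<omega>)}
          \<le> measure M (?S \<union> {\<omega> \<in> space M. \<delta>/4 < \<bar>D n \<omega>\<bar>})"
      proof (rule finite_measure_mono)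
        show "{\<omega> \<in> space M. \<epsilon> < indicator B \<omega> * norm (T n \<omega>)} \<subseteq> ?S \<union> {\<omega> \<in> space M. \<delta>/4 < \<bar>D n \<omega>\<bar>}"
        proof safe
          fix \<omega> assume *: "\<omega> \<in> space M" "\<epsilon> < indicator B \<omega> * norm (T n \<omega>)" "\<not> \<delta>/4 < \<bar>D n \<omega>\<bar>"
          have "\<omega> \<in> B" using *(2) \<epsilon> by (cases "\<omega> \<in> B") auto
          then show "\<epsilon> \<le> norm (T n \<omega>)" "?E \<omega> \<le> \<delta>" using * trunc(1)[of \<omega> n] by auto
        qed
      qed measurable
      also have "\<dots> \<le> measure M ?S + measure M {\<omega> \<in> space M. \<delta>/4 < \<bar>D n \<omega>\<bar>}"
        by (intro measure_Un_le) measurable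
      also have "measure M ?S \<le> \<delta> / \<epsilon>\<^sup>2"
        unfolding T_def using \<delta> \<epsilon> a_nonneg a_mono \<eta>_meas \<eta>_bounded
        by (intro increment_sum_tail) auto
      also have "\<delta> / \<epsilon>\<^sup>2 = e / 2" using \<epsilon> by (simp add: \<delta>_def)
      finally show ?thesis using n0[OF n] by simp
    qed
    then show "\<exists>n0. \<forall>n\<ge>n0. norm (measure M {\<omega> \<in> space M. \<epsilon> < indicator B \<omega> * norm (T n \<omega>)} - 0) < e" by blast
  qed
  obtain \<rho> where \<rho>: "strict_mono \<rho>" "AE \<omega> in M. \<forall>i<4. (\<lambda>n. U i (\<rho> n) \<omega>) \<longlonglongrightarrow> 0"
  proof (rule AE_common_subsequence[of 4 U])
    show "U i n \<in> borel_measurable M" for i n unfolding U_def by measurable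
    show "0 \<le> U i n \<omega>" for i n \<omega> by (simp add: U_def)
    show "(\<lambda>n. measure M {\<omega> \<in> space M. \<epsilon> < U i n \<omega>}) \<longlonglongrightarrow> 0" if "\<epsilon> > 0" for i \<epsilon>
    proof -
      have J_prob: "(\<lambda>n. measure M {\<omega> \<in> space M. \<epsilon> < dist (J n \<tau> \<omega>) (I \<tau> \<omega>)}) \<longlonglongrightarrow> 0" if "\<tau> \<ge> 0" for \<tau>
        using conv(2)[OF that] \<open>\<epsilon> > 0\<close> by (simp add: converges_in_prob_def J_def)
      consider "i = 0" | "i = 1" | "i = 2" | "i \<noteq> 0 \<and> i \<noteq> 1 \<and> i \<noteq> 2" by blast
      then show ?thesis
        using D_prob[OF that] T_prob[OF that] J_prob[OF t0] J_prob[OF st(1)]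
        by cases (simp_all add: U_def)
    qed
  qed blast
  show thesis
  proof
    fix n
    show "N (\<rho> n) \<in> borel_measurable M" by (rule N_meas)
    show "integrable M (\<lambda>\<omega>. (norm (N (\<rho> n) \<omega>))\<^sup>2)" by (rule N_props)
    show "expectation (\<lambda>\<omega>. V \<omega> \<bullet> N (\<rho> n) \<omega>) = 0"
      if "V \<in> borel_measurable (Ft s)" "integrable M (\<lambda>\<omega>. (norm (V \<omega>))\<^sup>2)" for V
      using measurable_Ft_mono[OF that(1) a_ge] that(2) by (rule N_props)
    show "Q (\<rho> n) \<in> borel_measurable M" by (rule Q_meas)
    show "0 \<le> Q (\<rho> n) \<omega> \<and> Q (\<rho> n) \<omega> \<le> r\<^sup>2 * (t - s)" for \<omega> by (rule Q_bounds)
    show "expectation (\<lambda>\<omega>. (norm (N (\<rho> n) \<omega>))\<^sup>2) = expectation (\<lambda>\<omega>. indicator A \<omega> * Q (\<rho> n) \<omega>)"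
      by (rule N_energy)
  next
    from \<rho>(2) show "AE \<omega> in M. \<omega> \<in> B \<longrightarrow> (\<lambda>n. N (\<rho> n) \<omega>) \<longlonglongrightarrow> I t \<omega> - I s \<omega>"
    proof eventually_elim
      case (elim \<omega>)
      show ?case
      proof
        assume \<omega>: "\<omega> \<in> B"
        have "(\<lambda>n. J (\<rho> n) t \<omega>) \<longlonglongrightarrow> I t \<omega>" "(\<lambda>n. J (\<rho> n) s \<omega>) \<longlonglongrightarrow> I s \<omega>"
          using elim[rule_format, of 1] elim[rule_format, of 2]
          unfolding U_def by (auto intro: tendsto_dist_iff[THEN iffD2])
        moreover have "(\<lambda>n. T (\<rho> n) \<omega>) \<longlonglongrightarrow> 0"
          using elim[rule_format, of 3] \<omega> unfolding U_def by (auto intro: tendsto_norm_zero_iff[THEN iffD1])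
        ultimately have "(\<lambda>n. (J (\<rho> n) t \<omega> - J (\<rho> n) s \<omega>) + T (\<rho> n) \<omega>) \<longlonglongrightarrow> (I t \<omega> - I s \<omega>) + 0"
          by (intro tendsto_intros)
        then show "(\<lambda>n. N (\<rho> n) \<omega>) \<longlonglongrightarrow> I t \<omega> - I s \<omega>" using N_T \<omega> B(2) by auto
      qed
    qed
  next
    from \<rho>(2) show "AE \<omega> in M. \<omega> \<in> B \<longrightarrow> (\<lambda>n. Q (\<rho> n) \<omega>) \<longlonglongrightarrow> (LINT u:{s..t}|lborel. (norm (H u \<omega>))\<^sup>2)"
    proof eventually_elim
      case (elim \<omega>)
      show ?case
      proof
        assume \<omega>: "\<omega> \<in> B"
        let ?L = "LINT u:{s..t}|lborel. (norm (H u \<omega>))\<^sup>2"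
        \<comment> \<open>This is the free parameter of \<open>truncation_estimates\<close>: of
          order sqrt D, so that D / e \<le> e, while the added reciprocal keeps it positive when D
          vanishes.\<close>
        define e where "e n = sqrt (\<bar>D (\<rho> n) \<omega>\<bar> + inverse (real (Suc n)))" for n
        have e_pos: "e n > 0" for n by (simp add: e_def add_nonneg_pos)
        have "(\<lambda>n. \<bar>D (\<rho> n) \<omega>\<bar>) \<longlonglongrightarrow> 0" using elim[rule_format, of 0] unfolding U_def by simp
        then have "e \<longlonglongrightarrow> sqrt (0 + 0)"
          unfolding e_def by (intro tendsto_intros LIMSEQ_inverse_real_of_nat)
        then have lim: "(\<lambda>n. r * (t - s + 1) * e n) \<longlonglongrightarrow> 0" by (auto intro: tendsto_mult_right_zero)
        have bound: "\<bar>Q (\<rho> n) \<omega> - ?L\<bar> \<le> r * (t - s + 1) * e n" for n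
        proof -
          have "D (\<rho> n) \<omega> \<le> (e n)\<^sup>2" by (simp add: e_def add_increasing2)
          then have "D (\<rho> n) \<omega> / e n \<le> e n" using e_pos[of n] by (simp add: power2_eq_square pos_divide_le_eq)
          then have "r * (e n * (t - s) + D (\<rho> n) \<omega> / e n) \<le> r * (e n * (t - s) + e n)"
            using r by (intro mult_left_mono) auto
          then show ?thesis using trunc(2)[OF \<omega> e_pos, of "\<rho> n" n] by (simp add: algebra_simps)
        qed
        have "(\<lambda>n. Q (\<rho> n) \<omega> - ?L) \<longlonglongrightarrow> 0"
          by (rule Lim_null_comparison[OF always_eventually[OF allI] lim]) (unfold real_norm_def, rule bound)
        then show "(\<lambda>n. Q (\<rho> n) \<omega>) \<longlonglongrightarrow> ?L" by (rule LIM_zero_cancel)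
      qed
    qed
  qed
qed

end

section \<open>Dissipative stochastic differential equations\<close>

text \<open>For \<delta> = T/n the step is an implicit Euler inequality with factor \<beta> = 1 +
  \<alpha> \<delta>, and iteration weights the errors by powers of \<beta>, all at most M. The n
  errors of order \<delta> sqrt \<delta> add up to order sqrt \<delta>, and the telescoped ones to
  at most C \<delta>, while \<beta>^n tends to exp (\<alpha> T). The condition |\<alpha>| T/n < 1
  keeps \<beta> positive for negative \<alpha> as well.\<close>

lemma discrete_gronwall:
  fixes f q :: "real \<Rightarrow> real"
  assumes q: "\<And>t. 0 \<le> q t \<and> q t \<le> 1" "\<And>s t. s \<le> t \<Longrightarrow> q t \<le> q s" and C: "C \<ge> 0"
    and step: "\<And>s t. 0 \<le> s \<Longrightarrow> s < t \<Longrightarrow> t \<le> s + 1 \<Longrightarrow>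
      f t \<le> f s - \<alpha> * (t - s) * f t + C * (t - s) * sqrt (t - s) + C * (t - s) * (q s - q t)"
    and T: "T \<ge> 0"
  shows "f T \<le> exp (- \<alpha> * T) * f 0"
proof (cases "T = 0")
  case False
  with T have T0: "T > 0" by simp
  define M where "M = exp (\<bar>\<alpha>\<bar> * T)"
  have "(1 + \<alpha> * T / real n) ^ n * f T \<le> f 0 + M * (C * T * sqrt (T / real n) + C * (T / real n))"
    if n: "n > 0" "T / real n \<le> 1" "\<bar>\<alpha>\<bar> * T / real n < 1" for n
  proof -
    define \<delta> where "\<delta> = T / real n"
    define \<beta> where "\<beta> = 1 + \<alpha> * \<delta>"
    define e where "e j = C * \<delta> * sqrt \<delta> + C * \<delta> * (q (real j * \<delta>) - q (real (Suc j) * \<delta>))" for j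
    have \<delta>: "\<delta> > 0" "\<delta> \<le> 1" "real n * \<delta> = T" using n T0 by (auto simp: \<delta>_def)
    have "\<bar>\<alpha> * \<delta>\<bar> < 1" using n T0 by (simp add: \<delta>_def abs_mult)
    then have \<beta>: "\<beta> > 0" unfolding \<beta>_def by linarith
    have \<beta>_pow: "\<beta> ^ j \<le> M" if "j \<le> n" for j
    proof -
      have "\<beta> \<le> exp (\<bar>\<alpha>\<bar> * \<delta>)"
        using exp_ge_add_one_self[of "\<bar>\<alpha>\<bar> * \<delta>"] mult_right_mono[of \<alpha> "\<bar>\<alpha>\<bar>" \<delta>] \<delta>(1) unfolding \<beta>_def by linarith
      then have "\<beta> ^ j \<le> exp (\<bar>\<alpha>\<bar> * \<delta>) ^ j" using \<beta> by (intro power_mono) auto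
      also have "\<dots> = exp (\<bar>\<alpha>\<bar> * (real j * \<delta>))" by (simp add: exp_of_nat_mult[symmetric] ac_simps)
      also have "\<dots> \<le> exp (\<bar>\<alpha>\<bar> * (real n * \<delta>))" using that \<delta>(1) by (simp add: mult_left_mono mult_right_mono)
      finally show ?thesis using \<delta>(3) by (simp add: M_def)
    qed
    have one: "\<beta> * f (real (Suc j) * \<delta>) \<le> f (real j * \<delta>) + e j" for j
      using step[of "real j * \<delta>" "real (Suc j) * \<delta>"] \<delta> by (simp add: \<beta>_def e_def algebra_simps)
    have e: "0 \<le> e j" for j
    proof -
      have "q (real (Suc j) * \<delta>) \<le> q (real j * \<delta>)" using \<delta>(1) by (intro q) (simp add: algebra_simps)
      then show ?thesis using C \<delta>(1) by (simp add: e_def)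
    qed
    have iter: "\<beta> ^ j * f (real j * \<delta>) \<le> f 0 + M * (\<Sum>i<j. e i)" if "j \<le> n" for j
      using that
    proof (induction j)
      case (Suc j)
      have "\<beta> ^ Suc j * f (real (Suc j) * \<delta>) = \<beta> ^ j * (\<beta> * f (real (Suc j) * \<delta>))" by simp
      also have "\<dots> \<le> \<beta> ^ j * (f (real j * \<delta>) + e j)" using one[of j] \<beta> by (intro mult_left_mono) auto
      also have "\<dots> \<le> f 0 + M * (\<Sum>i<j. e i) + M * e j"
        using Suc mult_right_mono[OF \<beta>_pow[of j] e[of j]] by (simp add: distrib_left)
      finally show ?case by (simp add: distrib_left)
    qed simp
    have "(\<Sum>i<n. e i) = C * T * sqrt \<delta> + C * \<delta> * (q 0 - q T)"
    proof -
      have "(\<Sum>i<n. q (real i * \<delta>) - q (real (Suc i) * \<delta>)) = q 0 - q (real n * \<delta>)"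
        using sum_lessThan_telescope'[of "\<lambda>i. q (real i * \<delta>)" n] by simp
      then show ?thesis
        using \<delta>(3) by (simp add: e_def sum.distrib sum_distrib_left[symmetric] mult.assoc[symmetric] mult.commute[of "real n"])
    qed
    also have "\<dots> \<le> C * T * sqrt \<delta> + C * \<delta>"
      using q(1)[of 0] q(1)[of T] mult_left_mono[of "q 0 - q T" 1 "C * \<delta>"] C \<delta>(1) by simp
    finally have "M * (\<Sum>i<n. e i) \<le> M * (C * T * sqrt \<delta> + C * \<delta>)" by (simp add: M_def)
    then show ?thesis using iter[of n] \<delta>(3) by (simp add: \<beta>_def \<delta>_def)
  qed
  moreover have "\<forall>\<^sub>F n in sequentially. n > 0 \<and> T / real n \<le> 1 \<and> \<bar>\<alpha>\<bar> * T / real n < 1"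
    using eventually_gt_at_top[of "0::nat"] order_tendstoD(2)[OF lim_const_over_n[of T] zero_less_one]
      order_tendstoD(2)[OF lim_const_over_n[of "\<bar>\<alpha>\<bar> * T"] zero_less_one]
    by eventually_elim auto
  ultimately have "\<forall>\<^sub>F n in sequentially. (1 + \<alpha> * T / real n) ^ n * f T
      \<le> f 0 + M * (C * T * sqrt (T / real n) + C * (T / real n))"
    by (auto elim: eventually_mono)
  moreover have "(\<lambda>n. (1 + \<alpha> * T / real n) ^ n * f T) \<longlonglongrightarrow> exp (\<alpha> * T) * f T"
    by (intro tendsto_intros tendsto_exp_limit_sequentially)
  moreover have "(\<lambda>n. f 0 + M * (C * T * sqrt (T / real n) + C * (T / real n))) \<longlonglongrightarrow> f 0 + M * (C * T * sqrt 0 + C * 0)"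
    by (intro tendsto_intros lim_const_over_n)
  ultimately have "exp (\<alpha> * T) * f T \<le> f 0 + M * (C * T * sqrt 0 + C * 0)"
    by (intro tendsto_le[OF sequentially_bot])
  then have "exp (- \<alpha> * T) * (exp (\<alpha> * T) * f T) \<le> exp (- \<alpha> * T) * f 0" by simp
  then show ?thesis by (simp add: mult.assoc[symmetric] exp_add[symmetric])
qed simp

text \<open>Approximation from below by grid points: they stay inside [0,u], so nothing beyond time
  u is consulted, and they are rational, so countably many times suffice.\<close>

lemma floor_approx:
  fixes u :: real
  defines "a \<equiv> \<lambda>n. real_of_int \<lfloor>real (Suc n) * u\<rfloor> / real (Suc n)"
  shows "a \<longlonglongrightarrow> u" "a n \<le> u" "a n \<in> \<rat>" "u \<ge> 0 \<Longrightarrow> a n \<ge> 0"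
proof -
  have le: "a n \<le> u" for n
    unfolding a_def by (subst pos_divide_le_eq) (auto simp: mult.commute intro: of_int_floor_le)
  then show "a n \<le> u" .
  have ge: "u - inverse (real (Suc n)) \<le> a n" for n
  proof -
    have "real (Suc n) * u - 1 \<le> real_of_int \<lfloor>real (Suc n) * u\<rfloor>" by linarith
    then have "(real (Suc n) * u - 1) / real (Suc n) \<le> a n" unfolding a_def by (rule divide_right_mono) simp
    then show ?thesis by (simp add: diff_divide_distrib inverse_eq_divide)
  qed
  have "(\<lambda>n. u - inverse (real (Suc n))) \<longlonglongrightarrow> u - 0"
    by (intro tendsto_diff tendsto_const LIMSEQ_inverse_real_of_nat)
  then show "a \<longlonglongrightarrow> u"
    by (intro tendsto_sandwich[OF always_eventually[OF allI[OF ge]] always_eventually[OF allI[OF le]]]) auto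
  show "a n \<in> \<rat>" by (simp add: a_def)
  show "a n \<ge> 0" if "u \<ge> 0" using that by (simp add: a_def)
qed

text \<open>A continuous path is the limit of its versions frozen at the left grid point. A frozen
  version is jointly measurable because the grid index takes countably many values.\<close>

lemma measurable_continuous_paths:
  fixes f :: "'a \<Rightarrow> real \<Rightarrow> 'b::metric_space"
  assumes meas: "\<And>u. (\<lambda>\<omega>. f \<omega> u) \<in> borel_measurable M"
    and cont: "\<And>\<omega>. \<omega> \<in> space M \<Longrightarrow> continuous_on UNIV (f \<omega>)"
  shows "(\<lambda>(\<omega>, u). f \<omega> u) \<in> borel_measurable (M \<Otimes>\<^sub>M lborel)"
proof (rule borel_measurable_LIMSEQ_metric)
  fix n :: nat
  have "(\<lambda>x. (\<lambda>i x. f (fst x) (real_of_int i / real (Suc n))) \<lfloor>real (Suc n) * snd x\<rfloor> x)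
      \<in> borel_measurable (M \<Otimes>\<^sub>M lborel)"
  proof (rule measurable_compose_countable[where f = "\<lambda>i x. f (fst x) (real_of_int i / real (Suc n))"])
    show "(\<lambda>x. f (fst x) (real_of_int i / real (Suc n))) \<in> borel_measurable (M \<Otimes>\<^sub>M lborel)" for i
      by (rule measurable_compose[OF measurable_fst meas])
    show "(\<lambda>x. \<lfloor>real (Suc n) * snd x\<rfloor>) \<in> measurable (M \<Otimes>\<^sub>M lborel) (count_space UNIV)"
      by measurable
  qed
  then show "(\<lambda>(\<omega>, u). f \<omega> (real_of_int \<lfloor>real (Suc n) * u\<rfloor> / real (Suc n))) \<in> borel_measurable (M \<Otimes>\<^sub>M lborel)"
    by (simp add: case_prod_beta')
next
  fix x :: "'a \<times> real" assume "x \<in> space (M \<Otimes>\<^sub>M lborel)"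
  then obtain \<omega> u where x: "x = (\<omega>, u)" "\<omega> \<in> space M" by (auto simp: space_pair_measure)
  have "(\<lambda>n. f \<omega> (real_of_int \<lfloor>real (Suc n) * u\<rfloor> / real (Suc n))) \<longlonglongrightarrow> f \<omega> u"
    by (rule isCont_tendsto_compose[OF _ floor_approx(1)])
       (use cont[OF x(2)] in \<open>simp add: continuous_on_eq_continuous_at\<close>)
  then show "(\<lambda>n. (\<lambda>(\<omega>, u). f \<omega> (real_of_int \<lfloor>real (Suc n) * u\<rfloor> / real (Suc n))) x) \<longlonglongrightarrow> (\<lambda>(\<omega>, u). f \<omega> u) x"
    by (simp add: x)
qed

text \<open>The left side of \<open>dissipative\<close> is the generator of the equation applied to
  |x - z|^2. Linear growth is measured from z, so both coefficients are bounded by c R while the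
  solution stays within distance R of z.\<close>

locale dissipative_sde = filtered_brownian M Ft W
  for M :: "'a measure" and Ft :: "real \<Rightarrow> 'a measure" and W :: "real \<Rightarrow> 'a \<Rightarrow> real^'m" +
  fixes b :: "real^'n \<Rightarrow> real^'n" and \<sigma> :: "real^'n \<Rightarrow> real^'m^'n" and x0 z :: "real^'n"
    and X :: "real \<Rightarrow> 'a \<Rightarrow> real^'n" and \<alpha> c :: real
  assumes solution: "sde_solution M Ft W b \<sigma> x0 X"
    and b_cont: "continuous_on UNIV b"
    and c: "c \<ge> 0"
    and growth: "\<And>x. norm (b x) \<le> c * norm (x - z)" "\<And>x. norm (\<sigma> x) \<le> c * norm (x - z)"
    and dissipative: "\<And>x. 2 * ((x - z) \<bullet> b x) + (norm (\<sigma> x))\<^sup>2 \<le> - \<alpha> * (norm (x - z))\<^sup>2"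
begin

section \<open>Confinement events and functionals of the paths\<close>

definition confined :: "real \<Rightarrow> real \<Rightarrow> 'a set" where
  "confined R t = {\<omega> \<in> space M. \<forall>u\<in>{0..t}. norm (X u \<omega> - z) \<le> R}"

definition stopped_moment :: "real \<Rightarrow> real \<Rightarrow> real" where
  "stopped_moment R t = expectation (\<lambda>\<omega>. indicator (confined R t) \<omega> * (norm (X t \<omega> - z))\<^sup>2)"

lemma X_adapted: "t \<ge> 0 \<Longrightarrow> X t \<in> borel_measurable (Ft t)"
  using solution by (simp add: sde_solution_def)

lemma X_measurable: "t \<ge> 0 \<Longrightarrow> X t \<in> borel_measurable M"
  using X_adapted measurable_Ft by blast

lemma X_continuous: "\<omega> \<in> space M \<Longrightarrow> continuous_on {0..} (\<lambda>t. X t \<omega>)"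
  using solution by (simp add: sde_solution_def)

lemma confined_mono: "s \<le> t \<Longrightarrow> confined R t \<subseteq> confined R s"
  by (auto simp: confined_def)

text \<open>By continuity the closed condition need only be checked at rational times, reached from
  below so that they do not exceed t.\<close>

lemma confined_adapted: "confined R t \<in> sets (Ft t)"
proof -
  have "confined R t = {\<omega> \<in> space (Ft t). \<forall>u\<in>{0..t} \<inter> \<rat>. norm (X u \<omega> - z) \<le> R}"
  proof
    show "confined R t \<subseteq> {\<omega> \<in> space (Ft t). \<forall>u\<in>{0..t} \<inter> \<rat>. norm (X u \<omega> - z) \<le> R}"
      by (auto simp: confined_def space_Ft)
    show "{\<omega> \<in> space (Ft t). \<forall>u\<in>{0..t} \<inter> \<rat>. norm (X u \<omega> - z) \<le> R} \<subseteq> confined R t"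
    proof
      fix \<omega> assume \<omega>: "\<omega> \<in> {\<omega> \<in> space (Ft t). \<forall>u\<in>{0..t} \<inter> \<rat>. norm (X u \<omega> - z) \<le> R}"
      have "norm (X u \<omega> - z) \<le> R" if u: "u \<in> {0..t}" for u
      proof -
        let ?a = "\<lambda>n. real_of_int \<lfloor>real (Suc n) * u\<rfloor> / real (Suc n)"
        have a: "?a n \<in> {0..t} \<inter> \<rat>" for n
          using floor_approx(2)[where n=n and u=u] floor_approx(3)[where n=n and u=u] floor_approx(4)[where n=n and u=u] u
          by (simp only: Int_iff atLeastAtMost_iff) auto
        have "(\<lambda>n. X (?a n) \<omega>) \<longlonglongrightarrow> X u \<omega>"
          by (rule continuous_on_tendsto_compose[OF X_continuous floor_approx(1)])
             (use \<omega> a u in \<open>auto simp: space_Ft intro!: always_eventually\<close>)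
        then have "(\<lambda>n. norm (X (?a n) \<omega> - z)) \<longlonglongrightarrow> norm (X u \<omega> - z)" by (intro tendsto_intros)
        then show ?thesis
        proof (rule LIMSEQ_le_const2)
          show "\<exists>N. \<forall>n\<ge>N. norm (X (?a n) \<omega> - z) \<le> R" using \<omega> a by blast
        qed
      qed
      then show "\<omega> \<in> confined R t" using \<omega> by (auto simp: confined_def space_Ft)
    qed
  qed
  also have "\<dots> \<in> sets (Ft t)"
  proof (rule sets.sets_Collect_countable_All')
    show "countable ({0..t} \<inter> \<rat>)" using countable_rat by (rule countable_subset[rotated]) auto
    fix u assume "u \<in> {0..t} \<inter> \<rat>"
    then have [measurable]: "X u \<in> borel_measurable (Ft t)"
      using measurable_Ft_mono[OF X_adapted[of u], of t] by auto
    show "{\<omega> \<in> space (Ft t). norm (X u \<omega> - z) \<le> R} \<in> sets (Ft t)" by measurable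
  qed
  finally show ?thesis .
qed

lemma confined_measurable [measurable]: "confined R t \<in> sets M"
  using confined_adapted[of R t] filtered by (auto simp: filtered_prob_space_def subalgebra_def)

lemma confinedD: "\<omega> \<in> confined R t \<Longrightarrow> 0 \<le> u \<Longrightarrow> u \<le> t \<Longrightarrow> norm (X u \<omega> - z) \<le> R"
  by (auto simp: confined_def)

lemma growth_confined:
  assumes "\<omega> \<in> confined R t" "0 \<le> u" "u \<le> t"
  shows "norm (b (X u \<omega>)) \<le> c * R" "norm (\<sigma> (X u \<omega>)) \<le> c * R"
  using growth[of "X u \<omega>"] mult_left_mono[OF confinedD[OF assms] c] by linarith+

text \<open>\<open>max 0 u\<close> continues the path constantly to negative times, where nothing is
  known about X, so that it is continuous on the whole line.\<close>

lemma path_measurable: "(\<lambda>(\<omega>, u). X (max 0 u) \<omega>) \<in> borel_measurable (M \<Otimes>\<^sub>M lborel)"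
proof (rule measurable_continuous_paths)
  fix \<omega> assume "\<omega> \<in> space M"
  from X_continuous[OF this] show "continuous_on UNIV (\<lambda>u. X (max 0 u) \<omega>)"
    by (rule continuous_on_compose2) (auto intro!: continuous_intros)
qed (simp add: X_measurable)

lemma path_functional_measurable:
  fixes g :: "real^'n \<Rightarrow> 'b::{banach, second_countable_topology}"
  assumes g: "continuous_on UNIV g" and s: "s \<ge> 0"
  shows "(\<lambda>\<omega>. LINT u:{s..t}|lborel. g (X u \<omega>)) \<in> borel_measurable M"
proof -
  have "(\<lambda>(\<omega>, u). X (max 0 u) \<omega>) \<in> borel_measurable (M \<Otimes>\<^sub>M lborel)" by (rule path_measurable)
  then have [measurable]: "(\<lambda>x. X (max 0 (snd x)) (fst x)) \<in> borel_measurable (M \<Otimes>\<^sub>M lborel)"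
    by (simp add: case_prod_beta')
  have [measurable]: "g \<in> borel_measurable borel" by (rule borel_measurable_continuous_onI[OF g])
  have "(\<lambda>\<omega>. \<integral>u. indicator {s..t} u *\<^sub>R g (X (max 0 u) \<omega>) \<partial>lborel) \<in> borel_measurable M"
    by (rule lborel.borel_measurable_lebesgue_integral) (simp add: case_prod_beta')
  also have "(\<lambda>\<omega>. \<integral>u. indicator {s..t} u *\<^sub>R g (X (max 0 u) \<omega>) \<partial>lborel) = (\<lambda>\<omega>. LINT u:{s..t}|lborel. g (X u \<omega>))"
    unfolding set_lebesgue_integral_def
    by (intro ext Bochner_Integration.integral_cong refl) (use s in \<open>auto simp: indicator_def max_def\<close>)
  finally show ?thesis .
qed

lemma path_continuous:
  assumes "\<omega> \<in> space M" "continuous_on UNIV g" "s \<ge> 0"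
  shows "continuous_on {s..t} (\<lambda>u. g (X u \<omega>))"
  by (rule continuous_on_compose2[OF assms(2)])
     (use continuous_on_subset[OF X_continuous[OF assms(1)], of "{s..t}"] assms(3) in auto)

lemma path_integrable:
  fixes g :: "real^'n \<Rightarrow> 'b::euclidean_space"
  assumes "\<omega> \<in> space M" "continuous_on UNIV g" "s \<ge> 0"
  shows "set_integrable lborel {s..t} (\<lambda>u. g (X u \<omega>))"
  by (rule borel_integrable_atLeastAtMost'[OF path_continuous[OF assms]])

lemma path_integral_bound:
  fixes g :: "real^'n \<Rightarrow> 'b::euclidean_space"
  assumes \<omega>: "\<omega> \<in> space M" and g: "continuous_on UNIV g" and s: "s \<ge> 0" "s \<le> t"
    and bound: "\<And>u. s \<le> u \<Longrightarrow> u \<le> t \<Longrightarrow> norm (g (X u \<omega>)) \<le> C"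
  shows "norm (LINT u:{s..t}|lborel. g (X u \<omega>)) \<le> C * (t - s)"
proof -
  have "norm (LINT u:{s..t}|lborel. g (X u \<omega>)) \<le> (LINT u:{s..t}|lborel. norm (g (X u \<omega>)))"
    unfolding set_lebesgue_integral_def by (rule order_trans[OF integral_norm_bound]) simp
  also have "\<dots> \<le> (LINT u:{s..t}|lborel. C)"
  proof (rule set_integral_mono)
    show "set_integrable lborel {s..t} (\<lambda>u. norm (g (X u \<omega>)))"
      by (rule path_integrable[OF \<omega> _ s(1)]) (intro continuous_intros g)
    show "set_integrable lborel {s..t} (\<lambda>u. C)" by (auto intro: set_integrable_bounded)
  qed (use bound in auto)
  also have "\<dots> = C * (t - s)" using s by (simp add: set_lebesgue_integral_def)
  finally show ?thesis .
qed

text \<open>The largest value that dissipativity allows for |\<sigma> x|^2. It is continuous in x,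
  and together with 2 (x - z) . b x it gives exactly -\<alpha> |x - z|^2.\<close>

definition energy_rate :: "real^'n \<Rightarrow> real" where
  "energy_rate x = - \<alpha> * (norm (x - z))\<^sup>2 - 2 * ((x - z) \<bullet> b x)"

lemma energy_rate_continuous: "continuous_on UNIV energy_rate"
  unfolding energy_rate_def by (intro continuous_intros b_cont)

lemma norm_diffusion_le: "(norm (\<sigma> x))\<^sup>2 \<le> energy_rate x"
  using dissipative[of x] by (simp add: energy_rate_def)

lemma energy_rate_confined:
  assumes "\<omega> \<in> confined R t" "0 \<le> u" "u \<le> t"
  shows "\<bar>energy_rate (X u \<omega>)\<bar> \<le> (\<bar>\<alpha>\<bar> + 2 * c) * R\<^sup>2"
proof -
  let ?y = "X u \<omega> - z"
  have y: "norm ?y \<le> R" by (rule confinedD[OF assms])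
  have "\<bar>?y \<bullet> b (X u \<omega>)\<bar> \<le> norm ?y * norm (b (X u \<omega>))" by (rule Cauchy_Schwarz_ineq2)
  also have "\<dots> \<le> R * (c * R)" using y growth_confined(1)[OF assms] order_trans[OF norm_ge_zero y]
    by (intro mult_mono) auto
  finally have 1: "\<bar>?y \<bullet> b (X u \<omega>)\<bar> \<le> c * R\<^sup>2" by (simp add: power2_eq_square algebra_simps)
  have 2: "\<bar>\<alpha> * (norm ?y)\<^sup>2\<bar> \<le> \<bar>\<alpha>\<bar> * R\<^sup>2"
    unfolding abs_mult using y by (intro mult_left_mono) (auto intro: power_mono)
  have "\<bar>energy_rate (X u \<omega>)\<bar> \<le> \<bar>\<alpha> * (norm ?y)\<^sup>2\<bar> + 2 * \<bar>?y \<bullet> b (X u \<omega>)\<bar>"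
    unfolding energy_rate_def by linarith
  also have "\<dots> \<le> \<bar>\<alpha>\<bar> * R\<^sup>2 + 2 * (c * R\<^sup>2)" using 1 2 by linarith
  finally show ?thesis by (simp add: algebra_simps)
qed

section \<open>One-step estimates on confinement events\<close>

lemma set_integral_split:
  fixes g :: "real^'n \<Rightarrow> 'b::euclidean_space"
  assumes "\<omega> \<in> space M" "continuous_on UNIV g" "0 \<le> s" "s \<le> t"
  shows "(LINT u:{0..t}|lborel. g (X u \<omega>)) - (LINT u:{0..s}|lborel. g (X u \<omega>)) = (LINT u:{s..t}|lborel. g (X u \<omega>))"
proof -
  have i: "set_integrable lborel {0..t} (\<lambda>u. g (X u \<omega>))" "set_integrable lborel {0..s} (\<lambda>u. g (X u \<omega>))"
      "set_integrable lborel {s..t} (\<lambda>u. g (X u \<omega>))"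
    using assms by (auto intro!: path_integrable)
  have "integral {0..s} (\<lambda>u. g (X u \<omega>)) + integral {s..t} (\<lambda>u. g (X u \<omega>)) = integral {0..t} (\<lambda>u. g (X u \<omega>))"
    using assms set_borel_integral_eq_integral(1)[OF i(1)] by (intro Henstock_Kurzweil_Integration.integral_combine) auto
  then show ?thesis using i by (simp add: set_borel_integral_eq_integral(2) algebra_simps)
qed

lemma integrable_bounded:
  fixes f :: "'a \<Rightarrow> real"
  assumes "f \<in> borel_measurable M" "\<And>\<omega>. \<omega> \<in> space M \<Longrightarrow> \<bar>f \<omega>\<bar> \<le> C"
  shows "integrable M f"
  by (rule integrable_const_bound[of _ C]) (use assms in \<open>auto intro!: AE_I2\<close>)

text \<open>On B the increment of X is the drift part D plus the limit of the N n from
  \<open>ito_localized\<close>. In the expansion of |V + D + N n|^2 the product of V and N n has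
  mean zero because V is known at time s. The energy of N n lives on \<open>confined R s\<close>;
  passing to B costs r^2 (t - s) times the difference of the two probabilities.\<close>

lemma increment_estimate:
  fixes V :: "'a \<Rightarrow> real^'n"
  assumes R: "R \<ge> 0" and st: "0 \<le> s" "s < t"
    and V: "V \<in> borel_measurable (Ft s)" "\<And>\<omega>. \<omega> \<in> space M \<Longrightarrow> norm (V \<omega>) \<le> R"
  defines "B \<equiv> confined R t" and "r \<equiv> c * R"
  shows "expectation (\<lambda>\<omega>. indicator B \<omega> * (norm (V \<omega> + (X t \<omega> - X s \<omega>)))\<^sup>2)
    \<le> expectation (\<lambda>\<omega>. (norm (V \<omega>))\<^sup>2)
      + 2 * expectation (\<lambda>\<omega>. indicator B \<omega> * (V \<omega> \<bullet> (LINT u:{s..t}|lborel. b (X u \<omega>))))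
      + expectation (\<lambda>\<omega>. indicator B \<omega> * (LINT u:{s..t}|lborel. energy_rate (X u \<omega>)))
      + r\<^sup>2 * (t - s)\<^sup>2 + 2 * r\<^sup>2 * (t - s) * sqrt (t - s)
      + r\<^sup>2 * (t - s) * (measure M (confined R s) - measure M B)"
proof -
  obtain I where ito: "has_ito_integral M Ft W (\<lambda>s \<omega>. \<sigma> (X s \<omega>)) I"
    and eq: "\<And>t. t \<ge> 0 \<Longrightarrow> AE \<omega> in M. X t \<omega> = x0 + (LINT s:{0..t}|lborel. b (X s \<omega>)) + I t \<omega>"
    using solution unfolding sde_solution_def by blast
  have r: "r \<ge> 0" using R c by (simp add: r_def)
  define A where "A = confined R s"
  define \<delta> where "\<delta> = t - s"
  define \<eta> where "\<eta> = sqrt \<delta>"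
  have \<delta>: "\<delta> > 0" and \<eta>: "\<eta> > 0" "\<eta> * \<eta> = \<delta>" using st by (auto simp: \<delta>_def \<eta>_def)
  have BA: "B \<subseteq> A" using confined_mono st by (auto simp: A_def B_def)
  have [measurable]: "A \<in> sets M" "B \<in> sets M" by (auto simp: A_def B_def)
  have A_adapted: "A \<in> sets (Ft s)" unfolding A_def by (rule confined_adapted)
  have \<sigma>_bound: "norm (\<sigma> (X u \<omega>)) \<le> r" if "\<omega> \<in> B" "u \<in> {0..t}" for \<omega> u
    using growth_confined(2)[of \<omega> R t u] that by (auto simp: B_def r_def)
  obtain N :: "nat \<Rightarrow> 'a \<Rightarrow> real^'n" and Q :: "nat \<Rightarrow> 'a \<Rightarrow> real" where
    N_meas [measurable]: "\<And>n. N n \<in> borel_measurable M" and N_int: "\<And>n. integrable M (\<lambda>\<omega>. (norm (N n \<omega>))\<^sup>2)"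
    and N_orth: "\<And>n V. V \<in> borel_measurable (Ft s) \<Longrightarrow> integrable M (\<lambda>\<omega>. (norm (V \<omega>))\<^sup>2) \<Longrightarrow>
      expectation (\<lambda>\<omega>. V \<omega> \<bullet> N n \<omega>) = 0"
    and Q_meas [measurable]: "\<And>n. Q n \<in> borel_measurable M"
    and Q_bound: "\<And>n \<omega>. 0 \<le> Q n \<omega> \<and> Q n \<omega> \<le> r\<^sup>2 * (t - s)"
    and N_energy: "\<And>n. expectation (\<lambda>\<omega>. (norm (N n \<omega>))\<^sup>2) = expectation (\<lambda>\<omega>. indicator A \<omega> * Q n \<omega>)"
    and N_lim: "AE \<omega> in M. \<omega> \<in> B \<longrightarrow> (\<lambda>n. N n \<omega>) \<longlonglongrightarrow> I t \<omega> - I s \<omega>"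
    and Q_lim: "AE \<omega> in M. \<omega> \<in> B \<longrightarrow> (\<lambda>n. Q n \<omega>) \<longlonglongrightarrow> (LINT u:{s..t}|lborel. (norm (\<sigma> (X u \<omega>)))\<^sup>2)"
    by (rule ito_localized[OF ito st A_adapted \<open>B \<in> sets M\<close> BA r \<sigma>_bound]) blast+
  define D where "D \<omega> = indicator B \<omega> *\<^sub>R (LINT u:{s..t}|lborel. b (X u \<omega>))" for \<omega>
  define G where "G \<omega> = (LINT u:{s..t}|lborel. energy_rate (X u \<omega>))" for \<omega>
  have [measurable]: "(\<lambda>\<omega>. LINT u:{s..t}|lborel. b (X u \<omega>)) \<in> borel_measurable M"
    by (rule path_functional_measurable[OF b_cont st(1)])
  have [measurable]: "D \<in> borel_measurable M" unfolding D_def by measurable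
  have [measurable]: "G \<in> borel_measurable M"
    unfolding G_def by (rule path_functional_measurable[OF energy_rate_continuous st(1)])
  note [measurable] = measurable_Ft[OF V(1)]
  have [measurable]: "X t \<in> borel_measurable M" "X s \<in> borel_measurable M" using X_measurable st by auto
  have B_space: "\<omega> \<in> B \<Longrightarrow> \<omega> \<in> space M" for \<omega> by (auto simp: B_def confined_def)
  have D_norm: "norm (D \<omega>) \<le> r * \<delta>" for \<omega>
  proof (cases "\<omega> \<in> B")
    case True
    have "norm (LINT u:{s..t}|lborel. b (X u \<omega>)) \<le> r * (t - s)"
      using growth_confined(1)[of \<omega> R t] True st
      by (intro path_integral_bound B_space b_cont) (auto simp: r_def B_def)
    then show ?thesis using True by (simp add: D_def \<delta>_def)
  qed (use r \<delta> in \<open>simp add: D_def\<close>)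
  define K where "K = (\<bar>\<alpha>\<bar> + 2 * c) * R\<^sup>2"
  have K: "K \<ge> 0" using c by (simp add: K_def)
  have G_bound: "\<bar>G \<omega>\<bar> \<le> K * \<delta>" if "\<omega> \<in> B" for \<omega>
    unfolding G_def \<delta>_def real_norm_def[symmetric]
    using energy_rate_confined[of \<omega> R t] that st
    by (intro path_integral_bound B_space energy_rate_continuous) (auto simp: K_def B_def)
  have V_int: "integrable M (\<lambda>\<omega>. (norm (V \<omega>))\<^sup>2)"
    using V(2) by (intro integrable_bounded[of _ "R\<^sup>2"]) (auto intro: power_mono)
  have D_int: "integrable M (\<lambda>\<omega>. (norm (D \<omega>))\<^sup>2)"
    using D_norm by (intro integrable_bounded[of _ "(r * \<delta>)\<^sup>2"]) (auto intro: power_mono)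
  note prod_int = integrable_inner_of_squares[OF _ _ V_int D_int] integrable_inner_of_squares[OF _ _ V_int N_int]
  have D_sq: "expectation (\<lambda>\<omega>. (norm (D \<omega>))\<^sup>2) \<le> (r * \<delta>)\<^sup>2"
  proof -
    have "expectation (\<lambda>\<omega>. (norm (D \<omega>))\<^sup>2) \<le> expectation (\<lambda>\<omega>. (r * \<delta>)\<^sup>2)"
      using D_norm by (intro integral_mono D_int) (auto intro: power_mono)
    then show ?thesis by (simp add: prob_space)
  qed
  define K0 where "K0 = expectation (\<lambda>\<omega>. (norm (V \<omega>))\<^sup>2) + 2 * expectation (\<lambda>\<omega>. V \<omega> \<bullet> D \<omega>)
      + r\<^sup>2 * \<delta>\<^sup>2 + 2 * r\<^sup>2 * \<delta> * \<eta> + r\<^sup>2 * \<delta> * (measure M A - measure M B)"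
  have Q_B_int: "integrable M (\<lambda>\<omega>. indicator B \<omega> * Q n \<omega>)" for n
    using Q_bound r \<delta> by (intro integrable_bounded[of _ "r\<^sup>2 * (t - s)"]) (auto simp: indicator_def \<delta>_def)
  have Q_A_int: "integrable M (\<lambda>\<omega>. indicator A \<omega> * Q n \<omega>)" for n
    using Q_bound r \<delta> by (intro integrable_bounded[of _ "r\<^sup>2 * (t - s)"]) (auto simp: indicator_def \<delta>_def)
  have ind_int: "integrable M (indicat_real A)" "integrable M (indicat_real B)"
    by (auto intro!: integrable_bounded[of _ 1] simp: indicator_def)
  have N_sq: "expectation (\<lambda>\<omega>. (norm (N n \<omega>))\<^sup>2)
      \<le> expectation (\<lambda>\<omega>. indicator B \<omega> * Q n \<omega>) + r\<^sup>2 * \<delta> * (measure M A - measure M B)"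
    "expectation (\<lambda>\<omega>. (norm (N n \<omega>))\<^sup>2) \<le> r\<^sup>2 * \<delta>" for n
  proof -
    have "expectation (\<lambda>\<omega>. indicator A \<omega> * Q n \<omega>)
        \<le> expectation (\<lambda>\<omega>. indicator B \<omega> * Q n \<omega> + r\<^sup>2 * \<delta> * (indicator A \<omega> - indicator B \<omega>))"
      using BA Q_bound[of n] by (intro integral_mono Q_A_int Q_B_int ind_int Bochner_Integration.integrable_add
          Bochner_Integration.integrable_diff integrable_mult_right) (auto simp: indicator_def \<delta>_def)
    then show "expectation (\<lambda>\<omega>. (norm (N n \<omega>))\<^sup>2)
        \<le> expectation (\<lambda>\<omega>. indicator B \<omega> * Q n \<omega>) + r\<^sup>2 * \<delta> * (measure M A - measure M B)"
      using Q_B_int ind_int by (simp add: N_energy)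
    have "expectation (\<lambda>\<omega>. indicator A \<omega> * Q n \<omega>) \<le> expectation (\<lambda>\<omega>. r\<^sup>2 * \<delta>)"
      using Q_bound[of n] \<delta> by (intro integral_mono Q_A_int) (auto simp: indicator_def \<delta>_def)
    then show "expectation (\<lambda>\<omega>. (norm (N n \<omega>))\<^sup>2) \<le> r\<^sup>2 * \<delta>" by (simp add: N_energy prob_space)
  qed
  \<comment> \<open>On B the limit has norm at most 3 R: R from V and 2 R from the two end points of
    the increment. Cutting at 3 R therefore leaves the limit unchanged and supplies the bound for
    dominated convergence.\<close>
  have cut: "\<bar>indicator B \<omega> * (min (norm y) (3 * R))\<^sup>2\<bar> \<le> (3 * R)\<^sup>2" for \<omega> and y :: "real^'n"
  proof -
    have "(min (norm y) (3 * R))\<^sup>2 \<le> (3 * R)\<^sup>2" using R by (intro power_mono) auto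
    then show ?thesis by (cases "\<omega> \<in> B") simp_all
  qed
  have upper: "expectation (\<lambda>\<omega>. indicator B \<omega> * (min (norm (V \<omega> + D \<omega> + N n \<omega>)) (3 * R))\<^sup>2)
      \<le> K0 + expectation (\<lambda>\<omega>. indicator B \<omega> * max (Q n \<omega>) (G \<omega>))" for n
  proof -
    let ?f = "\<lambda>\<omega>. ((norm (V \<omega>))\<^sup>2 + 2 * (V \<omega> \<bullet> D \<omega>)) + (1 + 1 / \<eta>) * (norm (D \<omega>))\<^sup>2
        + 2 * (V \<omega> \<bullet> N n \<omega>) + (1 + \<eta>) * (norm (N n \<omega>))\<^sup>2"
    have f_int: "integrable M ?f"
      using V_int D_int N_int[of n] prod_int by (intro Bochner_Integration.integrable_add integrable_mult_right) auto
    have "expectation (\<lambda>\<omega>. indicator B \<omega> * (min (norm (V \<omega> + D \<omega> + N n \<omega>)) (3 * R))\<^sup>2) \<le> expectation ?f"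
    proof (rule integral_mono[OF _ f_int])
      show "integrable M (\<lambda>\<omega>. indicator B \<omega> * (min (norm (V \<omega> + D \<omega> + N n \<omega>)) (3 * R))\<^sup>2)"
        by (intro integrable_bounded[OF _ cut]) measurable
      fix \<omega>
      have "indicator B \<omega> * (min (norm (V \<omega> + D \<omega> + N n \<omega>)) (3 * R))\<^sup>2 \<le> (norm (V \<omega> + D \<omega> + N n \<omega>))\<^sup>2"
        using R by (auto simp: indicator_def intro!: power_mono)
      also have "\<dots> = (norm (V \<omega>))\<^sup>2 + 2 * (V \<omega> \<bullet> D \<omega>) + (norm (D \<omega>))\<^sup>2 + 2 * (V \<omega> \<bullet> N n \<omega>)
          + 2 * (D \<omega> \<bullet> N n \<omega>) + (norm (N n \<omega>))\<^sup>2"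
        by (simp add: norm_add_squared inner_add_left)
      \<comment> \<open>The weight \<eta> = sqrt \<delta> balances the two halves: since |D| \<le> r
        \<delta> and N n has second moment at most r^2 \<delta>, each contributes at most r^2
        \<delta> \<eta>.\<close>
      also have "2 * (D \<omega> \<bullet> N n \<omega>) \<le> (1 / \<eta>) * (norm (D \<omega>))\<^sup>2 + \<eta> * (norm (N n \<omega>))\<^sup>2"
      proof -
        let ?d = "norm (D \<omega>)" and ?n = "norm (N n \<omega>)"
        have "0 \<le> (?d - \<eta> * ?n)\<^sup>2" by simp
        then have "2 * (?d * ?n) * \<eta> \<le> ?d\<^sup>2 + \<eta> * ?n\<^sup>2 * \<eta>" by (simp add: power2_eq_square algebra_simps)
        then have "2 * (?d * ?n) \<le> (?d\<^sup>2 + \<eta> * ?n\<^sup>2 * \<eta>) / \<eta>" using \<eta>(1) by (simp add: pos_le_divide_eq)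
        also have "\<dots> = (1 / \<eta>) * ?d\<^sup>2 + \<eta> * ?n\<^sup>2" using \<eta>(1) by (simp add: field_simps)
        finally show ?thesis using norm_cauchy_schwarz[of "D \<omega>" "N n \<omega>"] by linarith
      qed
      finally show "indicator B \<omega> * (min (norm (V \<omega> + D \<omega> + N n \<omega>)) (3 * R))\<^sup>2 \<le> ?f \<omega>"
        by (simp add: distrib_right)
    qed
    also have "expectation ?f = expectation (\<lambda>\<omega>. (norm (V \<omega>))\<^sup>2) + 2 * expectation (\<lambda>\<omega>. V \<omega> \<bullet> D \<omega>)
        + (1 + 1 / \<eta>) * expectation (\<lambda>\<omega>. (norm (D \<omega>))\<^sup>2) + (1 + \<eta>) * expectation (\<lambda>\<omega>. (norm (N n \<omega>))\<^sup>2)"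
      using V_int D_int N_int[of n] prod_int N_orth[OF V(1) V_int, of n] by simp
    also have "(1 + 1 / \<eta>) * expectation (\<lambda>\<omega>. (norm (D \<omega>))\<^sup>2) \<le> (1 + 1 / \<eta>) * (r * \<delta>)\<^sup>2"
      using D_sq \<eta>(1) by (intro mult_left_mono) auto
    also have "(1 + 1 / \<eta>) * (r * \<delta>)\<^sup>2 = r\<^sup>2 * \<delta>\<^sup>2 + r\<^sup>2 * \<delta> * \<eta>"
      using \<eta>(1) by (simp add: \<eta>(2)[symmetric] power2_eq_square field_simps)
    also have "(1 + \<eta>) * expectation (\<lambda>\<omega>. (norm (N n \<omega>))\<^sup>2) \<le>
        expectation (\<lambda>\<omega>. indicator B \<omega> * Q n \<omega>) + r\<^sup>2 * \<delta> * (measure M A - measure M B) + r\<^sup>2 * \<delta> * \<eta>"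
      using N_sq(1)[of n] mult_left_mono[OF N_sq(2)[of n] less_imp_le[OF \<eta>(1)]] by (simp add: algebra_simps)
    \<comment> \<open>The limit of Q n on B is the energy of \<sigma> along the path, which is at
      most G. Taking the maximum first makes the limit G itself, whose measurability comes from
      continuity of \<open>energy_rate\<close>.\<close>
    also have "expectation (\<lambda>\<omega>. indicator B \<omega> * Q n \<omega>) \<le> expectation (\<lambda>\<omega>. indicator B \<omega> * max (Q n \<omega>) (G \<omega>))"
    proof (rule integral_mono[OF Q_B_int])
      show "integrable M (\<lambda>\<omega>. indicator B \<omega> * max (Q n \<omega>) (G \<omega>))"
      proof (rule integrable_bounded[of _ "r\<^sup>2 * (t - s) + K * \<delta>"])
        fix \<omega>
        have "0 \<le> K * \<delta>" using K \<delta> by simp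
        then show "\<bar>indicat_real B \<omega> * max (Q n \<omega>) (G \<omega>)\<bar> \<le> r\<^sup>2 * (t - s) + K * \<delta>"
          using Q_bound[of n \<omega>] G_bound[of \<omega>] by (cases "\<omega> \<in> B") (auto simp: max_def)
      qed measurable
    qed (auto simp: indicator_def)
    finally show ?thesis by (simp add: K0_def algebra_simps)
  qed
  have "(\<lambda>n. expectation (\<lambda>\<omega>. indicator B \<omega> * (min (norm (V \<omega> + D \<omega> + N n \<omega>)) (3 * R))\<^sup>2))
      \<longlonglongrightarrow> expectation (\<lambda>\<omega>. indicator B \<omega> * (norm (V \<omega> + (X t \<omega> - X s \<omega>)))\<^sup>2)"
  proof (rule integral_dominated_convergence[where w = "\<lambda>_. (3 * R)\<^sup>2"])
    have "AE \<omega> in M. X t \<omega> = x0 + (LINT s:{0..t}|lborel. b (X s \<omega>)) + I t \<omega>"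
      "AE \<omega> in M. X s \<omega> = x0 + (LINT s:{0..s}|lborel. b (X s \<omega>)) + I s \<omega>"
      using eq[of t] eq[of s] st by auto
    with N_lim show "AE \<omega> in M. (\<lambda>n. indicator B \<omega> * (min (norm (V \<omega> + D \<omega> + N n \<omega>)) (3 * R))\<^sup>2)
        \<longlonglongrightarrow> indicator B \<omega> * (norm (V \<omega> + (X t \<omega> - X s \<omega>)))\<^sup>2"
    proof eventually_elim
      case (elim \<omega>)
      show ?case
      proof (cases "\<omega> \<in> B")
        case True
        have "X t \<omega> - X s \<omega> = (LINT u:{0..t}|lborel. b (X u \<omega>)) - (LINT u:{0..s}|lborel. b (X u \<omega>)) + (I t \<omega> - I s \<omega>)"
          by (subst elim(2), subst elim(3)) (simp add: algebra_simps)
        also have "\<dots> = D \<omega> + (I t \<omega> - I s \<omega>)"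
          using True st by (subst set_integral_split[OF B_space b_cont]) (auto simp: D_def)
        finally have incr: "V \<omega> + (X t \<omega> - X s \<omega>) = V \<omega> + D \<omega> + (I t \<omega> - I s \<omega>)" by simp
        have "norm (X t \<omega> - X s \<omega>) \<le> 2 * R"
          using norm_triangle_ineq4[of "X t \<omega> - z" "X s \<omega> - z"] confinedD[of \<omega> R t t] confinedD[of \<omega> R t s] True st
          by (simp add: B_def)
        then have le: "norm (V \<omega> + (X t \<omega> - X s \<omega>)) \<le> 3 * R"
          using norm_triangle_ineq[of "V \<omega>" "X t \<omega> - X s \<omega>"] V(2)[OF B_space[OF True]] by linarith
        have "(\<lambda>n. (min (norm (V \<omega> + D \<omega> + N n \<omega>)) (3 * R))\<^sup>2)
            \<longlonglongrightarrow> (min (norm (V \<omega> + D \<omega> + (I t \<omega> - I s \<omega>))) (3 * R))\<^sup>2"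
          using elim(1) True by (intro tendsto_intros tendsto_min) auto
        then show ?thesis using le True by (simp add: incr[symmetric] min_absorb1)
      qed simp
    qed
    show "AE \<omega> in M. norm (indicator B \<omega> * (min (norm (V \<omega> + D \<omega> + N n \<omega>)) (3 * R))\<^sup>2) \<le> (3 * R)\<^sup>2" for n
      unfolding real_norm_def by (rule AE_I2, rule cut)
  qed auto
  moreover have "(\<lambda>n. K0 + expectation (\<lambda>\<omega>. indicator B \<omega> * max (Q n \<omega>) (G \<omega>)))
      \<longlonglongrightarrow> K0 + expectation (\<lambda>\<omega>. indicator B \<omega> * G \<omega>)"
  proof (intro tendsto_add tendsto_const, rule integral_dominated_convergence[where w = "\<lambda>_. r\<^sup>2 * (t - s) + K * \<delta>"])
    from Q_lim show "AE \<omega> in M. (\<lambda>n. indicator B \<omega> * max (Q n \<omega>) (G \<omega>)) \<longlonglongrightarrow> indicator B \<omega> * G \<omega>"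
    proof eventually_elim
      case (elim \<omega>)
      show ?case
      proof (cases "\<omega> \<in> B")
        case True
        let ?L = "LINT u:{s..t}|lborel. (norm (\<sigma> (X u \<omega>)))\<^sup>2"
        have "?L \<le> G \<omega>"
        \<comment> \<open>If the energy of \<sigma> along this path is not integrable, its integral
          is 0 by default, and G is nonnegative because \<open>energy_rate\<close> dominates a
          square.\<close>
        proof (cases "set_integrable lborel {s..t} (\<lambda>u. (norm (\<sigma> (X u \<omega>)))\<^sup>2)")
          case True
          then show ?thesis
            unfolding G_def
            by (rule set_integral_mono[OF _ path_integrable[OF B_space[OF \<open>\<omega> \<in> B\<close>] energy_rate_continuous st(1)] norm_diffusion_le])
        next
          case False
          then have "?L = 0"
            unfolding set_lebesgue_integral_def set_integrable_def by (rule not_integrable_integral_eq)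
          moreover have "0 \<le> energy_rate x" for x using norm_diffusion_le[of x] zero_le_power2 order_trans by blast
          then have "0 \<le> G \<omega>"
            unfolding G_def set_lebesgue_integral_def by (intro Bochner_Integration.integral_nonneg) simp
          ultimately show ?thesis by simp
        qed
        moreover have "(\<lambda>n. max (Q n \<omega>) (G \<omega>)) \<longlonglongrightarrow> max ?L (G \<omega>)"
          using elim True by (intro tendsto_max) auto
        ultimately show ?thesis using True by (simp add: max_absorb2)
      qed simp
    qed
    show "AE \<omega> in M. norm (indicator B \<omega> * max (Q n \<omega>) (G \<omega>)) \<le> r\<^sup>2 * (t - s) + K * \<delta>" for n
    proof (rule AE_I2)
      fix \<omega>
      have "0 \<le> K * \<delta>" using K \<delta> by simp
      then show "norm (indicat_real B \<omega> * max (Q n \<omega>) (G \<omega>)) \<le> r\<^sup>2 * (t - s) + K * \<delta>"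
        using Q_bound[of n \<omega>] G_bound[of \<omega>] by (cases "\<omega> \<in> B") (auto simp: max_def)
    qed
  qed auto
  ultimately have "expectation (\<lambda>\<omega>. indicator B \<omega> * (norm (V \<omega> + (X t \<omega> - X s \<omega>)))\<^sup>2)
      \<le> K0 + expectation (\<lambda>\<omega>. indicator B \<omega> * G \<omega>)"
    by (rule LIMSEQ_le) (use upper in blast)
  then show ?thesis
    by (simp add: K0_def G_def D_def \<delta>_def \<eta>_def A_def algebra_simps)
qed

text \<open>The first summand bounds the energy rate on a confined path. The factor 4 is 1 + 2 + 1,
  from the last three terms of \<open>increment_estimate\<close> when t - s \<le> 1.\<close>

definition variation_const :: "real \<Rightarrow> real" where
  "variation_const R = (\<bar>\<alpha>\<bar> + 2 * c) * R\<^sup>2 + 4 * (c * R)\<^sup>2"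

definition step_const :: "real \<Rightarrow> real" where
  "step_const R = 3 * (c * R)\<^sup>2 + (2 * (c * R) + 4 * R * \<bar>\<alpha>\<bar>) * (1 + variation_const R)"

context
  fixes R :: real
  assumes R: "R \<ge> 0"
begin

lemma confined_measure: "0 \<le> measure M (confined R t)" "measure M (confined R t) \<le> 1"
  by simp_all

text \<open>This is \<open>increment_estimate\<close> with V = 0: only the energy and the error
  terms survive, all of order t - s when t - s \<le> 1.\<close>

lemma squared_variation:
  assumes st: "0 \<le> s" "s < t" "t \<le> s + 1"
  shows "expectation (\<lambda>\<omega>. indicator (confined R t) \<omega> * (norm (X t \<omega> - X s \<omega>))\<^sup>2) \<le> variation_const R * (t - s)"
proof -
  define \<delta> where "\<delta> = t - s"
  have \<delta>: "0 < \<delta>" "\<delta> \<le> 1" using st by (auto simp: \<delta>_def)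
  define r where "r = c * R"
  define K where "K = (\<bar>\<alpha>\<bar> + 2 * c) * R\<^sup>2"
  let ?G = "\<lambda>\<omega>. indicator (confined R t) \<omega> * (LINT u:{s..t}|lborel. energy_rate (X u \<omega>))"
  have "expectation (\<lambda>\<omega>. indicator (confined R t) \<omega> * (norm (X t \<omega> - X s \<omega>))\<^sup>2)
      \<le> expectation ?G + r\<^sup>2 * \<delta>\<^sup>2 + 2 * r\<^sup>2 * \<delta> * sqrt \<delta>
        + r\<^sup>2 * \<delta> * (measure M (confined R s) - measure M (confined R t))"
    using increment_estimate[OF R st(1,2), of "\<lambda>_. 0"] R by (simp add: \<delta>_def r_def)
  also have "expectation ?G \<le> K * \<delta>"
  proof -
    have bound: "\<bar>?G \<omega>\<bar> \<le> K * \<delta>" if "\<omega> \<in> space M" for \<omega>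
    proof (cases "\<omega> \<in> confined R t")
      case True
      have "norm (LINT u:{s..t}|lborel. energy_rate (X u \<omega>)) \<le> K * (t - s)"
        using st energy_rate_confined[OF True]
        by (intro path_integral_bound[OF that energy_rate_continuous]) (auto simp: K_def)
      then show ?thesis using True by (simp add: \<delta>_def)
    qed (use c \<delta> in \<open>simp add: K_def\<close>)
    have "integrable M ?G"
      using path_functional_measurable[OF energy_rate_continuous st(1), of t]
      by (intro integrable_bounded[OF _ bound] borel_measurable_times) auto
    then have "expectation ?G \<le> expectation (\<lambda>\<omega>. K * \<delta>)"
      using bound by (intro integral_mono) (auto simp: abs_le_iff)
    then show ?thesis by (simp add: prob_space)
  qed
  also have "r\<^sup>2 * \<delta>\<^sup>2 \<le> r\<^sup>2 * \<delta>" using \<delta> by (intro mult_left_mono) (auto simp: power2_eq_square mult_left_le)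
  also have "2 * r\<^sup>2 * \<delta> * sqrt \<delta> \<le> 2 * r\<^sup>2 * \<delta> * 1" using \<delta> by (intro mult_left_mono) auto
  also have "r\<^sup>2 * \<delta> * (measure M (confined R s) - measure M (confined R t)) \<le> r\<^sup>2 * \<delta> * 1"
  proof (intro mult_left_mono)
    show "measure M (confined R s) - measure M (confined R t) \<le> 1"
      using confined_measure(1)[of t] confined_measure(2)[of s] by linarith
  qed (use \<delta> in auto)
  finally show ?thesis by (simp add: variation_const_def K_def r_def \<delta>_def algebra_simps)
qed

text \<open>The inequality y \<le> \<eta> + y^2 / \<eta> with \<eta> = sqrt (t - s) turns a second
  moment of order \<eta>^2 into a first moment of order \<eta>. The event is enlarged to
  \<open>confined R u\<close>, where the second moment over [s,u] is controlled.\<close>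

lemma mean_variation:
  assumes su: "0 \<le> s" "s \<le> u" "u \<le> t" "t \<le> s + 1"
  shows "expectation (\<lambda>\<omega>. indicator (confined R t) \<omega> * norm (X u \<omega> - X s \<omega>)) \<le> (1 + variation_const R) * sqrt (t - s)"
proof (cases "u = s")
  case True
  then show ?thesis using su c by (simp add: variation_const_def)
next
  case False
  with su have lt: "s < u" "s < t" by auto
  define \<eta> where "\<eta> = sqrt (t - s)"
  have \<eta>: "\<eta> > 0" "\<eta> * \<eta> = t - s" using lt by (auto simp: \<eta>_def)
  have [measurable]: "X u \<in> borel_measurable M" "X s \<in> borel_measurable M" using X_measurable su by auto
  have diff: "norm (X u \<omega> - X s \<omega>) \<le> 2 * R" if "\<omega> \<in> confined R u" for \<omega>
    using norm_triangle_ineq4[of "X u \<omega> - z" "X s \<omega> - z"] confinedD[OF that, of u] confinedD[OF that, of s] su by simp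
  have int1: "integrable M (\<lambda>\<omega>. indicator (confined R t) \<omega> * norm (X u \<omega> - X s \<omega>))"
    using diff confined_mono[OF su(3), of R] R by (intro integrable_bounded[of _ "2 * R"]) (auto simp: indicator_def)
  have int2: "integrable M (\<lambda>\<omega>. indicator (confined R u) \<omega> * (norm (X u \<omega> - X s \<omega>))\<^sup>2)"
  proof (intro integrable_bounded[of _ "(2 * R)\<^sup>2"])
    fix \<omega>
    show "\<bar>indicator (confined R u) \<omega> * (norm (X u \<omega> - X s \<omega>))\<^sup>2\<bar> \<le> (2 * R)\<^sup>2"
      using power_mono[OF diff[of \<omega>] norm_ge_zero, of 2] by (cases "\<omega> \<in> confined R u") simp_all
  qed measurable
  have "expectation (\<lambda>\<omega>. indicator (confined R t) \<omega> * norm (X u \<omega> - X s \<omega>))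
      \<le> expectation (\<lambda>\<omega>. \<eta> + (1 / \<eta>) * (indicator (confined R u) \<omega> * (norm (X u \<omega> - X s \<omega>))\<^sup>2))"
  proof (rule integral_mono[OF int1])
    show "integrable M (\<lambda>\<omega>. \<eta> + (1 / \<eta>) * (indicator (confined R u) \<omega> * (norm (X u \<omega> - X s \<omega>))\<^sup>2))"
      using int2 by simp
    fix \<omega>
    let ?y = "norm (X u \<omega> - X s \<omega>)"
    have "0 \<le> (?y - \<eta>)\<^sup>2 + ?y * \<eta>" using \<eta> by simp
    then have "?y * \<eta> \<le> \<eta> * \<eta> + ?y\<^sup>2" by (simp add: power2_eq_square algebra_simps)
    then have "?y \<le> \<eta> + (1 / \<eta>) * ?y\<^sup>2" using \<eta>(1) by (simp add: field_simps)
    then show "indicator (confined R t) \<omega> * ?y \<le> \<eta> + (1 / \<eta>) * (indicator (confined R u) \<omega> * ?y\<^sup>2)"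
      using \<eta>(1) confined_mono[OF su(3), of R] by (auto simp: indicator_def)
  qed
  also have "\<dots> = \<eta> + (1 / \<eta>) * expectation (\<lambda>\<omega>. indicator (confined R u) \<omega> * (norm (X u \<omega> - X s \<omega>))\<^sup>2)"
    using int2 by (simp add: prob_space)
  also have "expectation (\<lambda>\<omega>. indicator (confined R u) \<omega> * (norm (X u \<omega> - X s \<omega>))\<^sup>2) \<le> variation_const R * (u - s)"
    using su lt by (intro squared_variation) auto
  also have "variation_const R * (u - s) \<le> variation_const R * (\<eta> * \<eta>)"
    unfolding \<eta>(2) using su c by (intro mult_left_mono) (auto simp: variation_const_def)
  finally show ?thesis
    using \<eta>(1) by (simp add: \<eta>_def[symmetric] divide_right_mono mult_left_mono algebra_simps)
qed

text \<open>Fubini's theorem reduces the time integral to the displacements at fixed times u, which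
  \<open>mean_variation\<close> bounds uniformly over [s,t].\<close>

lemma mean_path_variation:
  assumes st: "0 \<le> s" "s < t" "t \<le> s + 1"
  shows "expectation (\<lambda>\<omega>. indicator (confined R t) \<omega> * (LINT u:{s..t}|lborel. norm (X u \<omega> - X s \<omega>)))
    \<le> (1 + variation_const R) * (t - s) * sqrt (t - s)"
proof -
  interpret P: pair_sigma_finite M lborel ..
  define B where "B = confined R t"
  let ?f = "\<lambda>\<omega> u. indicator B \<omega> * (indicator {s..t} u * norm (X (max 0 u) \<omega> - X s \<omega>))"
  let ?k = "(1 + variation_const R) * sqrt (t - s)"
  have B_space: "\<omega> \<in> B \<Longrightarrow> \<omega> \<in> space M" for \<omega> by (auto simp: B_def confined_def)
  have [measurable]: "B \<in> sets M" by (simp add: B_def)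
  have [measurable]: "X s \<in> borel_measurable M" using X_measurable st by auto
  have "(\<lambda>(\<omega>, u). X (max 0 u) \<omega>) \<in> borel_measurable (M \<Otimes>\<^sub>M lborel)" by (rule path_measurable)
  then have [measurable]: "(\<lambda>x. X (max 0 (snd x)) (fst x)) \<in> borel_measurable (M \<Otimes>\<^sub>M lborel)"
    by (simp add: case_prod_beta')
  have meas: "case_prod ?f \<in> borel_measurable (M \<Otimes>\<^sub>M lborel)"
    by (simp add: case_prod_beta')
  have diff: "norm (X u \<omega> - X s \<omega>) \<le> 2 * R" if "\<omega> \<in> B" "s \<le> u" "u \<le> t" for \<omega> u
    using norm_triangle_ineq4[of "X u \<omega> - z" "X s \<omega> - z"] confinedD[of \<omega> R t u] confinedD[of \<omega> R t s] st that
    by (simp add: B_def)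
  have int: "integrable (M \<Otimes>\<^sub>M lborel) (case_prod ?f)"
  proof (rule integrableI_bounded_set[where A = "space M \<times> {s..t}" and B = "2 * R"])
    show "emeasure (M \<Otimes>\<^sub>M lborel) (space M \<times> {s..t}) < \<infinity>"
      using st by (subst lborel.emeasure_pair_measure_Times) (auto simp: emeasure_space_1 simp del: space_lborel)
    show "AE x in M \<Otimes>\<^sub>M lborel. x \<in> space M \<times> {s..t} \<longrightarrow> norm (case_prod ?f x) \<le> 2 * R"
      using diff st R by (intro AE_I2) (auto simp: indicator_def max_def)
    show "AE x in M \<Otimes>\<^sub>M lborel. x \<notin> space M \<times> {s..t} \<longrightarrow> case_prod ?f x = 0"
      by (rule AE_I2) (auto simp: space_pair_measure indicator_def)
  qed (use meas in auto)
  have "expectation (\<lambda>\<omega>. indicator B \<omega> * (LINT u:{s..t}|lborel. norm (X u \<omega> - X s \<omega>)))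
      = (\<integral>\<omega>. (\<integral>u. ?f \<omega> u \<partial>lborel) \<partial>M)"
  proof (intro Bochner_Integration.integral_cong refl)
    fix \<omega>
    have "(LINT u:{s..t}|lborel. norm (X u \<omega> - X s \<omega>)) = (\<integral>u. indicator {s..t} u * norm (X (max 0 u) \<omega> - X s \<omega>) \<partial>lborel)"
      unfolding set_lebesgue_integral_def using st
      by (intro Bochner_Integration.integral_cong) (auto simp: indicator_def max_def)
    then show "indicator B \<omega> * (LINT u:{s..t}|lborel. norm (X u \<omega> - X s \<omega>)) = (\<integral>u. ?f \<omega> u \<partial>lborel)"
      by simp
  qed
  also have "\<dots> = (\<integral>u. (\<integral>\<omega>. ?f \<omega> u \<partial>M) \<partial>lborel)"
    by (rule P.Fubini_integral[OF int, symmetric])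
  also have "\<dots> \<le> (\<integral>u. indicator {s..t} u *\<^sub>R ?k \<partial>lborel)"
  proof (rule integral_mono)
    show "integrable lborel (\<lambda>u. \<integral>\<omega>. ?f \<omega> u \<partial>M)" by (rule P.integrable_snd[OF int])
    show "integrable lborel (\<lambda>u. indicator {s..t} u *\<^sub>R ?k)"
      by (rule set_integrable_bounded[where C = "\<bar>?k\<bar>", unfolded set_integrable_def]) auto
    fix u
    show "(\<integral>\<omega>. ?f \<omega> u \<partial>M) \<le> indicator {s..t} u *\<^sub>R ?k"
    proof (cases "u \<in> {s..t}")
      case True
      then show ?thesis using mean_variation[of s u t] st by (simp add: B_def max_def)
    qed simp
  qed
  also have "\<dots> = (1 + variation_const R) * (t - s) * sqrt (t - s)"
    using st by simp
  finally show ?thesis by (simp add: B_def)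
qed

text \<open>Replacing X s - z by X u - z in the product with the drift costs at most c R |X u - X
  s|, and the integrand becomes exactly -\<alpha> |X u - z|^2. Comparing this with its value at time
  t costs 2 R |\<alpha>| times the distance of X u from X t, which is split through X s.\<close>

lemma pointwise_dissipation:
  assumes \<omega>: "\<omega> \<in> confined R t" and st: "0 \<le> s" "s < t"
  shows "2 * ((X s \<omega> - z) \<bullet> (LINT u:{s..t}|lborel. b (X u \<omega>))) + (LINT u:{s..t}|lborel. energy_rate (X u \<omega>))
    \<le> - \<alpha> * (t - s) * (norm (X t \<omega> - z))\<^sup>2
      + (2 * (c * R) + 2 * R * \<bar>\<alpha>\<bar>) * (LINT u:{s..t}|lborel. norm (X u \<omega> - X s \<omega>))
      + 2 * R * \<bar>\<alpha>\<bar> * (t - s) * norm (X t \<omega> - X s \<omega>)"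
proof -
  have \<omega>': "\<omega> \<in> space M" using \<omega> by (simp add: confined_def)
  let ?v = "X s \<omega> - z" and ?w = "norm (X t \<omega> - z)" and ?d = "norm (X t \<omega> - X s \<omega>)"
  let ?k = "2 * (c * R) + 2 * R * \<bar>\<alpha>\<bar>"
  have ib: "set_integrable lborel {s..t} (\<lambda>u. 2 * (?v \<bullet> b (X u \<omega>)))"
    by (rule path_integrable[OF \<omega>' _ st(1), of "\<lambda>x. 2 * (?v \<bullet> b x)"]) (intro continuous_intros b_cont)
  have ie: "set_integrable lborel {s..t} (\<lambda>u. energy_rate (X u \<omega>))"
    by (rule path_integrable[OF \<omega>' energy_rate_continuous st(1)])
  have iv: "set_integrable lborel {s..t} (\<lambda>u. norm (X u \<omega> - X s \<omega>))"
    by (rule path_integrable[OF \<omega>' _ st(1), of "\<lambda>x. norm (x - X s \<omega>)"]) (intro continuous_intros)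
  have ic: "set_integrable lborel {s..t} (\<lambda>u. a)" for a :: real by (auto intro: set_integrable_bounded)
  have "2 * (?v \<bullet> (LINT u:{s..t}|lborel. b (X u \<omega>))) = (LINT u:{s..t}|lborel. 2 * (?v \<bullet> b (X u \<omega>)))"
  proof -
    have "(LINT u:{s..t}|lborel. ?v \<bullet> b (X u \<omega>)) = ?v \<bullet> (LINT u:{s..t}|lborel. b (X u \<omega>))"
      using path_integrable[OF \<omega>' b_cont st(1), of t]
      unfolding set_lebesgue_integral_def set_integrable_def
      by (subst integral_inner_right[symmetric]) auto
    then show ?thesis by simp
  qed
  then have "2 * (?v \<bullet> (LINT u:{s..t}|lborel. b (X u \<omega>))) + (LINT u:{s..t}|lborel. energy_rate (X u \<omega>))
      = (LINT u:{s..t}|lborel. 2 * (?v \<bullet> b (X u \<omega>)) + energy_rate (X u \<omega>))"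
    using ib ie by (simp only: set_integral_add)
  also have "\<dots> \<le> (LINT u:{s..t}|lborel. (- \<alpha> * ?w\<^sup>2 + 2 * R * \<bar>\<alpha>\<bar> * ?d) + ?k * norm (X u \<omega> - X s \<omega>))"
  proof (rule set_integral_mono)
    show "set_integrable lborel {s..t} (\<lambda>u. 2 * (?v \<bullet> b (X u \<omega>)) + energy_rate (X u \<omega>))"
      using ib ie by (rule set_integral_add)
    show "set_integrable lborel {s..t} (\<lambda>u. (- \<alpha> * ?w\<^sup>2 + 2 * R * \<bar>\<alpha>\<bar> * ?d) + ?k * norm (X u \<omega> - X s \<omega>))"
      using iv by (intro set_integral_add ic) auto
    fix u assume "u \<in> {s..t}"
    then have u: "0 \<le> u" "u \<le> t" using st by auto
    let ?y = "X u \<omega> - z" and ?e = "norm (X u \<omega> - X s \<omega>)"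
    have y: "norm ?y \<le> R" by (rule confinedD[OF \<omega> u])
    have w: "?w \<le> R" using confinedD[OF \<omega>, of t] st by simp
    have "(?v - ?y) \<bullet> b (X u \<omega>) \<le> norm (?v - ?y) * norm (b (X u \<omega>))" by (rule norm_cauchy_schwarz)
    also have "\<dots> \<le> ?e * (c * R)"
      using growth_confined(1)[OF \<omega> u] by (intro mult_mono) (auto simp: norm_minus_commute)
    finally have 1: "2 * (?v \<bullet> b (X u \<omega>)) - 2 * (?y \<bullet> b (X u \<omega>)) \<le> 2 * (c * R) * ?e"
      by (simp add: inner_diff_left algebra_simps)
    have "\<bar>?w\<^sup>2 - (norm ?y)\<^sup>2\<bar> = \<bar>?w - norm ?y\<bar> * (?w + norm ?y)"
      by (simp add: power2_eq_square square_diff_square_factored abs_mult)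
    also have "\<dots> \<le> (?d + ?e) * (2 * R)"
    proof (rule mult_mono)
      have "\<bar>?w - norm ?y\<bar> \<le> norm ((X t \<omega> - X s \<omega>) - (X u \<omega> - X s \<omega>))"
        using norm_triangle_ineq3[of "X t \<omega> - z" ?y] by simp
      also have "\<dots> \<le> ?d + ?e" by (rule norm_triangle_ineq4)
      finally show "\<bar>?w - norm ?y\<bar> \<le> ?d + ?e" .
    qed (use y w in auto)
    finally have "\<bar>\<alpha>\<bar> * \<bar>?w\<^sup>2 - (norm ?y)\<^sup>2\<bar> \<le> \<bar>\<alpha>\<bar> * ((?d + ?e) * (2 * R))" by (rule mult_left_mono) simp
    moreover have "\<alpha> * (?w\<^sup>2 - (norm ?y)\<^sup>2) \<le> \<bar>\<alpha>\<bar> * \<bar>?w\<^sup>2 - (norm ?y)\<^sup>2\<bar>"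
      by (metis abs_ge_self abs_mult)
    ultimately have 2: "- \<alpha> * (norm ?y)\<^sup>2 \<le> - \<alpha> * ?w\<^sup>2 + \<bar>\<alpha>\<bar> * ((?d + ?e) * (2 * R))"
      by (simp add: right_diff_distrib)
    show "2 * (?v \<bullet> b (X u \<omega>)) + energy_rate (X u \<omega>) \<le> (- \<alpha> * ?w\<^sup>2 + 2 * R * \<bar>\<alpha>\<bar> * ?d) + ?k * ?e"
      using 1 2 by (simp add: energy_rate_def algebra_simps)
  qed
  also have "\<dots> = (t - s) * (- \<alpha> * ?w\<^sup>2 + 2 * R * \<bar>\<alpha>\<bar> * ?d) + ?k * (LINT u:{s..t}|lborel. norm (X u \<omega> - X s \<omega>))"
  proof -
    have "(LINT u:{s..t}|lborel. a) = (t - s) * a" for a :: real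
      using st by (simp add: set_lebesgue_integral_def)
    moreover have "set_integrable lborel {s..t} (\<lambda>u. ?k * norm (X u \<omega> - X s \<omega>))" using iv by simp
    ultimately show ?thesis using set_integral_add(2)[OF ic] by simp
  qed
  finally show ?thesis by (simp add: algebra_simps)
qed

end

lemma confined_integrable:
  fixes g :: "'a \<Rightarrow> real"
  assumes "g \<in> borel_measurable M" "\<And>\<omega>. \<omega> \<in> confined R t \<Longrightarrow> \<bar>g \<omega>\<bar> \<le> C"
  shows "integrable M (\<lambda>\<omega>. indicator (confined R t) \<omega> * g \<omega>)"
proof (rule integrable_bounded)
  show "\<bar>indicator (confined R t) \<omega> * g \<omega>\<bar> \<le> \<bar>C\<bar>" for \<omega>
    using assms(2)[of \<omega>] by (cases "\<omega> \<in> confined R t") auto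
qed (use assms(1) in measurable)

text \<open>The choice of V is X s - z on \<open>confined R s\<close> and 0 elsewhere: it is known
  at time s, its second moment is the stopped moment at s, and on the smaller event
  \<open>confined R t\<close> adding the increment gives X t - z.\<close>

lemma stopped_moment_step:
  assumes R: "R \<ge> 0" and st: "0 \<le> s" "s < t" "t \<le> s + 1"
  shows "stopped_moment R t \<le> stopped_moment R s - \<alpha> * (t - s) * stopped_moment R t
    + step_const R * (t - s) * sqrt (t - s)
    + step_const R * (t - s) * (measure M (confined R s) - measure M (confined R t))"
proof -
  define A B where "A = confined R s" and "B = confined R t"
  define V where "V \<omega> = indicator A \<omega> *\<^sub>R (X s \<omega> - z)" for \<omega>
  define \<delta> where "\<delta> = t - s"
  define r where "r = c * R"
  define k where "k = 2 * r + 2 * R * \<bar>\<alpha>\<bar>"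
  have \<delta>: "0 < \<delta>" "\<delta> \<le> 1" "sqrt \<delta> * sqrt \<delta> = \<delta>" using st by (auto simp: \<delta>_def)
  have vc: "0 \<le> variation_const R" using c by (simp add: variation_const_def)
  have t0: "0 \<le> t" using st by simp
  have rk: "0 \<le> r" "0 \<le> k" using R c by (auto simp: r_def k_def)
  have BA: "B \<subseteq> A" using confined_mono[of s t R] st by (simp add: A_def B_def)
  have B_space: "\<omega> \<in> B \<Longrightarrow> \<omega> \<in> space M" for \<omega> by (auto simp: B_def confined_def)
  have [measurable]: "X t \<in> borel_measurable M" "X s \<in> borel_measurable M" using X_measurable st t0 by auto
  have V_adapted: "V \<in> borel_measurable (Ft s)"
    using confined_adapted[of R s] X_adapted[OF st(1)] unfolding V_def A_def by measurable
  have V_norm: "norm (V \<omega>) \<le> R" for \<omega>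
    using confinedD[of \<omega> R s s] st R by (cases "\<omega> \<in> A") (auto simp: V_def A_def)
  let ?b = "\<lambda>\<omega>. LINT u:{s..t}|lborel. b (X u \<omega>)"
  let ?e = "\<lambda>\<omega>. LINT u:{s..t}|lborel. energy_rate (X u \<omega>)"
  let ?p = "\<lambda>\<omega>. LINT u:{s..t}|lborel. norm (X u \<omega> - X s \<omega>)"
  let ?d = "\<lambda>\<omega>. norm (X t \<omega> - X s \<omega>)"
  let ?q = "measure M A - measure M B"
  have diff: "norm (X u \<omega> - X s \<omega>) \<le> 2 * R" if "\<omega> \<in> B" "s \<le> u" "u \<le> t" for \<omega> u
    using norm_triangle_ineq4[of "X u \<omega> - z" "X s \<omega> - z"] confinedD[of \<omega> R t u] confinedD[of \<omega> R t s] st that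
    by (simp add: B_def)
  have p_meas: "?p \<in> borel_measurable M"
  proof -
    have "(\<lambda>(\<omega>, u). X (max 0 u) \<omega>) \<in> borel_measurable (M \<Otimes>\<^sub>M lborel)" by (rule path_measurable)
    then have [measurable]: "(\<lambda>x. X (max 0 (snd x)) (fst x)) \<in> borel_measurable (M \<Otimes>\<^sub>M lborel)"
      by (simp add: case_prod_beta')
    have "(\<lambda>\<omega>. \<integral>u. indicator {s..t} u *\<^sub>R norm (X (max 0 u) \<omega> - X s \<omega>) \<partial>lborel) \<in> borel_measurable M"
      by (rule lborel.borel_measurable_lebesgue_integral) (simp add: case_prod_beta')
    also have "(\<lambda>\<omega>. \<integral>u. indicator {s..t} u *\<^sub>R norm (X (max 0 u) \<omega> - X s \<omega>) \<partial>lborel) = ?p"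
      unfolding set_lebesgue_integral_def
      by (intro ext Bochner_Integration.integral_cong refl) (use st in \<open>auto simp: indicator_def max_def\<close>)
    finally show ?thesis .
  qed
  have int_b: "integrable M (\<lambda>\<omega>. indicator B \<omega> * (V \<omega> \<bullet> ?b \<omega>))"
    unfolding B_def
  proof (rule confined_integrable)
    show "(\<lambda>\<omega>. V \<omega> \<bullet> ?b \<omega>) \<in> borel_measurable M"
      using measurable_Ft[OF V_adapted] path_functional_measurable[OF b_cont st(1)] by (rule borel_measurable_inner)
    fix \<omega> assume \<omega>: "\<omega> \<in> confined R t"
    have "norm (?b \<omega>) \<le> r * (t - s)"
      using growth_confined(1)[OF \<omega>] st \<omega> unfolding r_def
      by (intro path_integral_bound b_cont) (auto simp: confined_def)
    then have "norm (V \<omega>) * norm (?b \<omega>) \<le> R * (r * (t - s))"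
      using V_norm[of \<omega>] R by (intro mult_mono) auto
    then show "\<bar>V \<omega> \<bullet> ?b \<omega>\<bar> \<le> R * (r * (t - s))"
      using Cauchy_Schwarz_ineq2[of "V \<omega>" "?b \<omega>"] by linarith
  qed
  have int_e: "integrable M (\<lambda>\<omega>. indicator B \<omega> * ?e \<omega>)"
    unfolding B_def
  proof (rule confined_integrable)
    show "?e \<in> borel_measurable M" by (rule path_functional_measurable[OF energy_rate_continuous st(1)])
    fix \<omega> assume \<omega>: "\<omega> \<in> confined R t"
    have "norm (?e \<omega>) \<le> ((\<bar>\<alpha>\<bar> + 2 * c) * R\<^sup>2) * (t - s)"
      using energy_rate_confined[OF \<omega>] st \<omega>
      by (intro path_integral_bound energy_rate_continuous) (auto simp: confined_def)
    then show "\<bar>?e \<omega>\<bar> \<le> ((\<bar>\<alpha>\<bar> + 2 * c) * R\<^sup>2) * (t - s)" by simp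
  qed
  have int_p: "integrable M (\<lambda>\<omega>. indicator B \<omega> * ?p \<omega>)"
    unfolding B_def
  proof (rule confined_integrable[OF p_meas])
    fix \<omega> assume \<omega>: "\<omega> \<in> confined R t"
    have "norm (LINT u:{s..t}|lborel. (\<lambda>x. norm (x - X s \<omega>)) (X u \<omega>)) \<le> 2 * R * (t - s)"
      using diff[of \<omega>] st \<omega> by (intro path_integral_bound continuous_intros) (auto simp: confined_def B_def)
    then show "\<bar>?p \<omega>\<bar> \<le> 2 * R * (t - s)" by simp
  qed
  have int_d: "integrable M (\<lambda>\<omega>. indicator B \<omega> * ?d \<omega>)"
    unfolding B_def by (rule confined_integrable[of _ _ _ "2 * R"]) (use diff st in \<open>auto simp: B_def\<close>)
  have int_y: "integrable M (\<lambda>\<omega>. indicator B \<omega> * (norm (X t \<omega> - z))\<^sup>2)"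
    unfolding B_def
    by (rule confined_integrable[of _ _ _ "R\<^sup>2"]) (use confinedD[of _ R t t] t0 in \<open>auto intro!: power_mono\<close>)
  have eq_t: "stopped_moment R t = expectation (\<lambda>\<omega>. indicator B \<omega> * (norm (V \<omega> + (X t \<omega> - X s \<omega>)))\<^sup>2)"
    unfolding stopped_moment_def B_def[symmetric]
    using BA by (intro Bochner_Integration.integral_cong refl) (auto simp: V_def indicator_def)
  have eq_s: "expectation (\<lambda>\<omega>. (norm (V \<omega>))\<^sup>2) = stopped_moment R s"
    unfolding stopped_moment_def A_def[symmetric]
    by (intro Bochner_Integration.integral_cong refl) (auto simp: V_def indicator_def)
  have "2 * expectation (\<lambda>\<omega>. indicator B \<omega> * (V \<omega> \<bullet> ?b \<omega>)) + expectation (\<lambda>\<omega>. indicator B \<omega> * ?e \<omega>)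
      = expectation (\<lambda>\<omega>. 2 * (indicator B \<omega> * (V \<omega> \<bullet> ?b \<omega>)) + indicator B \<omega> * ?e \<omega>)"
    using int_b int_e by simp
  also have "\<dots> \<le> expectation (\<lambda>\<omega>. (- \<alpha> * \<delta>) * (indicator B \<omega> * (norm (X t \<omega> - z))\<^sup>2)
      + k * (indicator B \<omega> * ?p \<omega>) + (2 * R * \<bar>\<alpha>\<bar> * \<delta>) * (indicator B \<omega> * ?d \<omega>))"
  proof (rule integral_mono)
    show "integrable M (\<lambda>\<omega>. 2 * (indicator B \<omega> * (V \<omega> \<bullet> ?b \<omega>)) + indicator B \<omega> * ?e \<omega>)"
      using int_b int_e by simp
    show "integrable M (\<lambda>\<omega>. (- \<alpha> * \<delta>) * (indicator B \<omega> * (norm (X t \<omega> - z))\<^sup>2)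
      + k * (indicator B \<omega> * ?p \<omega>) + (2 * R * \<bar>\<alpha>\<bar> * \<delta>) * (indicator B \<omega> * ?d \<omega>))"
      using int_y int_p int_d by (intro Bochner_Integration.integrable_add integrable_mult_right)
    fix \<omega>
    show "2 * (indicator B \<omega> * (V \<omega> \<bullet> ?b \<omega>)) + indicator B \<omega> * ?e \<omega>
        \<le> (- \<alpha> * \<delta>) * (indicator B \<omega> * (norm (X t \<omega> - z))\<^sup>2)
      + k * (indicator B \<omega> * ?p \<omega>) + (2 * R * \<bar>\<alpha>\<bar> * \<delta>) * (indicator B \<omega> * ?d \<omega>)"
    proof (cases "\<omega> \<in> B")
      case True
      then have "V \<omega> = X s \<omega> - z" using BA by (auto simp: V_def)
      then show ?thesis
        using pointwise_dissipation[OF R, of \<omega> t s] st True by (simp add: B_def k_def r_def \<delta>_def)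
    qed simp
  qed
  also have "\<dots> = (- \<alpha> * \<delta>) * stopped_moment R t + k * expectation (\<lambda>\<omega>. indicator B \<omega> * ?p \<omega>)
      + (2 * R * \<bar>\<alpha>\<bar> * \<delta>) * expectation (\<lambda>\<omega>. indicator B \<omega> * ?d \<omega>)"
    unfolding stopped_moment_def B_def[symmetric] using int_y int_p int_d by simp
  also have "k * expectation (\<lambda>\<omega>. indicator B \<omega> * ?p \<omega>) \<le> k * ((1 + variation_const R) * \<delta> * sqrt \<delta>)"
    using mean_path_variation[OF R st] rk unfolding B_def \<delta>_def by (intro mult_left_mono) auto
  also have "(2 * R * \<bar>\<alpha>\<bar> * \<delta>) * expectation (\<lambda>\<omega>. indicator B \<omega> * ?d \<omega>)
      \<le> (2 * R * \<bar>\<alpha>\<bar> * \<delta>) * ((1 + variation_const R) * sqrt \<delta>)"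
    using mean_variation[OF R, of s t t] st R \<delta> unfolding B_def \<delta>_def by (intro mult_left_mono) auto
  finally have drift: "2 * expectation (\<lambda>\<omega>. indicator B \<omega> * (V \<omega> \<bullet> ?b \<omega>)) + expectation (\<lambda>\<omega>. indicator B \<omega> * ?e \<omega>)
      \<le> - \<alpha> * \<delta> * stopped_moment R t + (k + 2 * R * \<bar>\<alpha>\<bar>) * (1 + variation_const R) * (\<delta> * sqrt \<delta>)"
    by (simp add: algebra_simps)
  have "stopped_moment R t \<le> stopped_moment R s + 2 * expectation (\<lambda>\<omega>. indicator B \<omega> * (V \<omega> \<bullet> ?b \<omega>))
      + expectation (\<lambda>\<omega>. indicator B \<omega> * ?e \<omega>) + r\<^sup>2 * \<delta>\<^sup>2 + 2 * r\<^sup>2 * \<delta> * sqrt \<delta> + r\<^sup>2 * \<delta> * ?q"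
    unfolding eq_t eq_s[symmetric] B_def A_def r_def \<delta>_def
    by (rule increment_estimate[OF R st(1,2) V_adapted V_norm])
  moreover have "r\<^sup>2 * \<delta>\<^sup>2 \<le> r\<^sup>2 * (\<delta> * sqrt \<delta>)"
    using \<delta> real_le_rsqrt[of \<delta> \<delta>]
    by (intro mult_left_mono) (auto simp: power2_eq_square mult_left_le)
  moreover have "r\<^sup>2 * \<delta> * ?q \<le> step_const R * \<delta> * ?q"
  proof (intro mult_right_mono)
    show "0 \<le> ?q" using BA by (simp add: A_def B_def finite_measure_mono)
    show "r\<^sup>2 \<le> step_const R" using R c vc by (simp add: step_const_def r_def)
  qed (use \<delta> in simp)
  moreover have "step_const R * (\<delta> * sqrt \<delta>) = 3 * r\<^sup>2 * (\<delta> * sqrt \<delta>)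
      + (k + 2 * R * \<bar>\<alpha>\<bar>) * (1 + variation_const R) * (\<delta> * sqrt \<delta>)"
    by (simp add: step_const_def k_def r_def algebra_simps)
  ultimately have "stopped_moment R t \<le> stopped_moment R s - \<alpha> * \<delta> * stopped_moment R t
      + step_const R * (\<delta> * sqrt \<delta>) + step_const R * \<delta> * ?q"
    using drift by (simp add: mult.assoc)
  then show ?thesis by (simp add: \<delta>_def A_def B_def mult.assoc)
qed

text \<open>All mesh points are nonnegative, so every simple integral at time 0 vanishes. Hence the
  constant 0 converges in probability to \<open>I 0\<close>, which is therefore 0 almost
  surely.\<close>

lemma initial_value: "AE \<omega> in M. X 0 \<omega> = x0"
proof -
  obtain I where ito: "has_ito_integral M Ft W (\<lambda>s \<omega>. \<sigma> (X s \<omega>)) I"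
    and eq: "AE \<omega> in M. X 0 \<omega> = x0 + (LINT s:{0..0}|lborel. b (X s \<omega>)) + I 0 \<omega>"
    using solution unfolding sde_solution_def by (meson order_refl)
  from ito obtain k p \<xi> where simple: "\<And>n. simple_integrand M Ft (k n) (p n) (\<xi> n)"
    and conv: "converges_in_prob M (\<lambda>n. simple_ito_integral W (k n) (p n) (\<xi> n) 0) (I 0)"
    unfolding has_ito_integral_def by blast
  have zero: "simple_ito_integral W (k n) (p n) (\<xi> n) 0 \<omega> = 0" for n \<omega>
  proof -
    have lt: "p n i < p n (Suc i)" if "i < k n" for i
      using simple[of n] that by (auto simp: simple_integrand_def)
    have nn: "0 \<le> p n i" if "i \<le> k n" for i
      using that
    proof (induction i)
      case 0 then show ?case using simple[of n] by (simp add: simple_integrand_def)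
    next
      case (Suc i) then show ?case using lt[of i] by simp
    qed
    have "min (p n (Suc i)) 0 = 0" "min (p n i) 0 = 0" if "i < k n" for i
      using nn[of i] nn[of "Suc i"] that by auto
    then show ?thesis by (simp add: simple_ito_integral_def)
  qed
  have [measurable]: "I 0 \<in> borel_measurable M" using conv by (simp add: converges_in_prob_def)
  have "measure M {\<omega> \<in> space M. \<epsilon> < norm (I 0 \<omega>)} = 0" if "\<epsilon> > 0" for \<epsilon>
  proof -
    have "(\<lambda>n::nat. measure M {\<omega> \<in> space M. \<epsilon> < norm (I 0 \<omega>)}) \<longlonglongrightarrow> 0"
      using conv that by (simp add: converges_in_prob_def zero)
    then show ?thesis by (simp add: LIMSEQ_const_iff)
  qed
  then have "AE \<omega> in M. \<not> inverse (real (Suc n)) < norm (I 0 \<omega>)" for n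
    by (intro AE_I[where N = "{\<omega> \<in> space M. inverse (real (Suc n)) < norm (I 0 \<omega>)}"])
       (auto simp: emeasure_eq_measure)
  then have "AE \<omega> in M. \<forall>n. \<not> inverse (real (Suc n)) < norm (I 0 \<omega>)" by (simp add: AE_all_countable)
  with eq show ?thesis
  proof eventually_elim
    case (elim \<omega>)
    have "I 0 \<omega> = 0"
    proof (rule ccontr)
      assume "I 0 \<omega> \<noteq> 0"
      then show False using reals_Archimedean[of "norm (I 0 \<omega>)"] elim(2) by auto
    qed
    moreover have "(LINT s:{0..0}|lborel. b (X s \<omega>)) = 0"
      unfolding set_lebesgue_integral_def
      by (rule integral_eq_zero_AE, rule AE_mp[OF AE_lborel_singleton[of 0]]) (auto intro!: AE_I2 simp: indicator_def)
    ultimately show ?case using elim(1) by simp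
  qed
qed

section \<open>Decay of the full second moment\<close>

lemma stopped_moment_bound:
  assumes R: "R \<ge> 0" and t: "t \<ge> 0"
  shows "stopped_moment R t \<le> exp (- \<alpha> * t) * (norm (x0 - z))\<^sup>2"
proof -
  have "stopped_moment R t \<le> exp (- \<alpha> * t) * stopped_moment R 0"
  proof (rule discrete_gronwall[where q = "\<lambda>t. measure M (confined R t)" and C = "step_const R"])
    show "measure M (confined R t) \<le> measure M (confined R s)" if "s \<le> t" for s t
      using confined_mono[OF that] by (intro finite_measure_mono) auto
    show "0 \<le> step_const R" using R c by (simp add: step_const_def variation_const_def)
  qed (use t stopped_moment_step[OF R] in auto)
  moreover have "stopped_moment R 0 \<le> expectation (\<lambda>\<omega>. (norm (x0 - z))\<^sup>2)"
    unfolding stopped_moment_def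
  proof (rule integral_mono_AE)
    have [measurable]: "X 0 \<in> borel_measurable M" by (simp add: X_measurable)
    show "integrable M (\<lambda>\<omega>. indicator (confined R 0) \<omega> * (norm (X 0 \<omega> - z))\<^sup>2)"
      by (rule confined_integrable[of _ _ _ "R\<^sup>2"]) (use confinedD[of _ R 0 0] in \<open>auto intro!: power_mono\<close>)
    from initial_value show "AE \<omega> in M. indicator (confined R 0) \<omega> * (norm (X 0 \<omega> - z))\<^sup>2 \<le> (norm (x0 - z))\<^sup>2"
      by eventually_elim (simp add: indicator_def)
  qed simp
  then have "stopped_moment R 0 \<le> (norm (x0 - z))\<^sup>2" by (simp add: prob_space)
  ultimately show ?thesis by (meson exp_ge_zero mult_left_mono order_trans)
qed

text \<open>Each path is bounded on the compact interval [0,t], hence confined for all large n, so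
  the stopped integrands increase to the full one. Their uniformly bounded means give integrability
  along with the bound.\<close>

theorem second_moment_bound:
  assumes t: "t \<ge> 0"
  shows "integrable M (\<lambda>\<omega>. (norm (X t \<omega> - z))\<^sup>2)"
    and "expectation (\<lambda>\<omega>. (norm (X t \<omega> - z))\<^sup>2) \<le> exp (- \<alpha> * t) * (norm (x0 - z))\<^sup>2"
proof -
  let ?f = "\<lambda>n \<omega>. indicator (confined (real n) t) \<omega> * (norm (X t \<omega> - z))\<^sup>2"
  let ?C = "exp (- \<alpha> * t) * (norm (x0 - z))\<^sup>2"
  have [measurable]: "X t \<in> borel_measurable M" using X_measurable t by simp
  have int: "integrable M (?f n)" for n
    by (rule confined_integrable[of _ _ _ "(real n)\<^sup>2"]) (use confinedD[of _ "real n" t t] t in \<open>auto intro!: power_mono\<close>)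
  have mono: "mono (\<lambda>n. ?f n \<omega>)" for \<omega>
  proof (rule monoI)
    fix m n :: nat assume "m \<le> n"
    then have "confined (real m) t \<subseteq> confined (real n) t" by (auto simp: confined_def intro: order_trans)
    then show "?f m \<omega> \<le> ?f n \<omega>" by (auto simp: indicator_def)
  qed
  have lim: "(\<lambda>n. ?f n \<omega>) \<longlonglongrightarrow> (norm (X t \<omega> - z))\<^sup>2" if \<omega>: "\<omega> \<in> space M" for \<omega>
  proof -
    have "continuous_on {0..t} (\<lambda>u. X u \<omega> - z)"
      by (intro continuous_intros continuous_on_subset[OF X_continuous[OF \<omega>]]) auto
    then have "bounded ((\<lambda>u. X u \<omega> - z) ` {0..t})"
      by (intro compact_imp_bounded compact_continuous_image) auto
    then obtain C where C: "\<And>u. u \<in> {0..t} \<Longrightarrow> norm (X u \<omega> - z) \<le> C"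
      unfolding bounded_iff by blast
    obtain N :: nat where N: "C \<le> real N" using real_arch_simple by blast
    have "\<forall>\<^sub>F n in sequentially. (norm (X t \<omega> - z))\<^sup>2 = ?f n \<omega>"
      using eventually_ge_at_top[of N]
    proof eventually_elim
      case (elim n)
      then have "\<omega> \<in> confined (real n) t"
        using C N \<omega> by (force simp: confined_def)
      then show ?case by simp
    qed
    then show ?thesis by (rule Lim_transform_eventually[OF tendsto_const])
  qed
  have bound: "expectation (?f n) \<le> ?C" for n
    using stopped_moment_bound[of "real n" t] t by (simp add: stopped_moment_def)
  have incseq: "incseq (\<lambda>n. expectation (?f n))"
    by (intro incseq_SucI integral_mono int monoD[OF mono]) simp
  obtain L where L: "(\<lambda>n. expectation (?f n)) \<longlonglongrightarrow> L"
    using incseq_convergent[OF incseq, of ?C] bound by blast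
  have L_le: "L \<le> ?C" using L bound by (intro LIMSEQ_le_const2) auto
  have ae: "AE \<omega> in M. mono (\<lambda>n. ?f n \<omega>)" "AE \<omega> in M. (\<lambda>n. ?f n \<omega>) \<longlonglongrightarrow> (norm (X t \<omega> - z))\<^sup>2"
    using mono lim by (auto intro!: AE_I2)
  show "integrable M (\<lambda>\<omega>. (norm (X t \<omega> - z))\<^sup>2)"
    by (rule integrable_monotone_convergence[OF int ae L]) measurable
  have "expectation (\<lambda>\<omega>. (norm (X t \<omega> - z))\<^sup>2) = L"
    by (rule integral_monotone_convergence[OF int ae L]) measurable
  then show "expectation (\<lambda>\<omega>. (norm (X t \<omega> - z))\<^sup>2) \<le> ?C" using L_le by simp
qed

end

section \<open>Stochastic coordinate descent\<close>

theorem theorem4p8: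
  fixes F :: "real^'n \<Rightarrow> real"
    and L \<mu> K h \<alpha> :: real
    and x0 Xstar :: "real^'n"
    and M :: "'a measure" and Ft :: "real \<Rightarrow> 'a measure"
    and W X :: "real \<Rightarrow> 'a \<Rightarrow> real^'n"
  assumes C2: "twice_cont_diff F"
    and pos: "L > 0" "\<mu> > 0" "K > 0"
    and lipschitz: "\<And>x y. norm (gradient F x - gradient F y) \<le> L * norm (x - y)"
    and strongly_monotone:
      "\<And>x y. (x - y) \<bullet> (gradient F x - gradient F y) \<ge> \<mu> * (norm (x - y))\<^sup>2"
    and hessian_monotone:
      "\<And>x y. (x - y) \<bullet> (hessian F x *v gradient F x - hessian F y *v gradient F y)
               \<ge> K * (norm (x - y))\<^sup>2"
    and minimizer: "\<And>y. is_arg_min F (\<lambda>_. True) y \<longleftrightarrow> y = Xstar"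
    and h: "h > 0"
    and prob: "filtered_prob_space M Ft"
    and brownian: "brownian_motion M Ft W"
    and solution: "sde_solution M Ft W
        (\<lambda>x. - gradient (\<lambda>y. F y + h / 4 * (norm (gradient F y))\<^sup>2) x)
        (\<lambda>x. sqrt h *\<^sub>R psd_sqrt (scd_covariance F x))
        x0 X"
    and alpha: "\<alpha> = 2 * \<mu> - h * ((real CARD('n) - 1) * L\<^sup>2 - K)"
  shows "(\<forall>t\<ge>0. integrable M (\<lambda>\<omega>. (norm (X t \<omega> - Xstar))\<^sup>2) \<and>
            prob_space.expectation M (\<lambda>\<omega>. (norm (X t \<omega> - Xstar))\<^sup>2)
              \<le> exp (- \<alpha> * t) * (norm (x0 - Xstar))\<^sup>2) \<and>
         ((real CARD('n) - 1) * L\<^sup>2 - K \<le> 0 \<or> h < 2 * \<mu> / ((real CARD('n) - 1) * L\<^sup>2 - K) \<longrightarrow>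
            ((\<lambda>t. prob_space.expectation M (\<lambda>\<omega>. (norm (X t \<omega> - Xstar))\<^sup>2)) \<longlongrightarrow> 0) at_top)"
proof -
  note lip = norm_hessian_mult_le[OF C2 lipschitz]
  have g0: "gradient F Xstar = 0"
    using gradient_minimizer[OF C2] minimizer by blast
  let ?b = "\<lambda>x. - gradient (\<lambda>y. F y + h / 4 * (norm (gradient F y))\<^sup>2) x"
  let ?\<sigma> = "\<lambda>x. sqrt h *\<^sub>R psd_sqrt (scd_covariance F x)"
  \<comment> \<open>Growth constants of drift and noise. The drift has L from the gradient and (h/2)
    L^2 from the Hessian, of norm at most L, applied to the gradient; the noise has the root of h
    times the bound for the trace of the covariance.\<close>
  let ?c = "max (L + h / 2 * L\<^sup>2) (sqrt (h * ((real CARD('n) - 1) * L\<^sup>2)))"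
  have card: "0 \<le> real CARD('n) - 1"
    using zero_less_card_finite[where 'a = 'n] by simp
  have drift: "?b x = - (gradient F x + (h / 2) *\<^sub>R (hessian F x *v gradient F x))" for x
    by (simp only: gradient_modified_potential[OF C2])
  have grad: "norm (gradient F x) \<le> L * norm (x - Xstar)" for x
    using lipschitz[of x Xstar] by (simp add: g0)
  have diffusion: "(norm (?\<sigma> x))\<^sup>2 \<le> h * ((real CARD('n) - 1) * L\<^sup>2) * (norm (x - Xstar))\<^sup>2" for x
  proof -
    have "(norm (?\<sigma> x))\<^sup>2 = h * ((real CARD('n) - 1) * (norm (gradient F x))\<^sup>2)"
      using h by (simp add: power_mult_distrib norm_psd_sqrt_squared scd_covariance_pos_semidef
          trace_scd_covariance)
    also have "\<dots> \<le> h * ((real CARD('n) - 1) * (L * norm (x - Xstar))\<^sup>2)"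
      using h card power_mono[OF grad norm_ge_zero, of x 2] by (intro mult_left_mono) auto
    finally show ?thesis by (simp add: power_mult_distrib mult.assoc)
  qed
  interpret filtered_brownian M Ft W
    by unfold_locales (fact prob, fact brownian)
  interpret dissipative_sde M Ft W ?b ?\<sigma> x0 Xstar X \<alpha> ?c
  proof
    show "sde_solution M Ft W ?b ?\<sigma> x0 X" by (fact solution)
    show "continuous_on UNIV ?b"
      unfolding drift by (intro continuous_intros continuous_on_gradient[OF C2] continuous_on_hessian[OF C2])
    show "0 \<le> ?c" using h card by (intro max.coboundedI2) simp
    fix x
    let ?y = "x - Xstar"
    show "norm (?b x) \<le> ?c * norm ?y"
    proof -
      have "norm (?b x) \<le> norm (gradient F x) + (h / 2) * norm (hessian F x *v gradient F x)"
        unfolding drift norm_minus_cancel using h norm_triangle_ineq by (metis abs_of_pos half_gt_zero norm_scaleR)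
      also have "\<dots> \<le> L * norm ?y + (h / 2) * (L * (L * norm ?y))"
        using grad[of x] order_trans[OF lip mult_left_mono[OF grad]] pos(1) h
        by (intro add_mono mult_left_mono) auto
      also have "\<dots> = (L + h / 2 * L\<^sup>2) * norm ?y" by (simp add: power2_eq_square algebra_simps)
      also have "\<dots> \<le> ?c * norm ?y" by (intro mult_right_mono) auto
      finally show ?thesis .
    qed
    show "norm (?\<sigma> x) \<le> ?c * norm ?y"
    proof -
      have "norm (?\<sigma> x) \<le> sqrt (h * ((real CARD('n) - 1) * L\<^sup>2) * (norm ?y)\<^sup>2)"
        using diffusion[of x] by (rule real_le_rsqrt)
      also have "\<dots> = sqrt (h * ((real CARD('n) - 1) * L\<^sup>2)) * norm ?y" by (simp only: real_sqrt_mult) simp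
      also have "\<dots> \<le> ?c * norm ?y" by (intro mult_right_mono) auto
      finally show ?thesis .
    qed
    \<comment> \<open>The three parts of \<alpha>: strong monotonicity gives 2 \<mu>, the Hessian
      condition gives h K because h/2 is doubled, and the noise takes away h (d-1) L^2. The
      monotonicity conditions are used against Xstar, where the gradient vanishes.\<close>
    show "2 * (?y \<bullet> ?b x) + (norm (?\<sigma> x))\<^sup>2 \<le> - \<alpha> * (norm ?y)\<^sup>2"
    proof -
      have "2 * (?y \<bullet> ?b x) = - 2 * (?y \<bullet> gradient F x) - h * (?y \<bullet> (hessian F x *v gradient F x))"
        unfolding drift by (simp add: inner_diff_right algebra_simps)
      also have "\<dots> \<le> - 2 * (\<mu> * (norm ?y)\<^sup>2) - h * (K * (norm ?y)\<^sup>2)"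
        using strongly_monotone[of x Xstar] mult_left_mono[OF hessian_monotone[of x Xstar] less_imp_le[OF h]]
        by (simp add: g0)
      finally show ?thesis using diffusion[of x] by (simp add: alpha algebra_simps)
    qed
  qed
  have lim: "((\<lambda>t. expectation (\<lambda>\<omega>. (norm (X t \<omega> - Xstar))\<^sup>2)) \<longlongrightarrow> 0) at_top" if "\<alpha> > 0"
  proof (rule tendsto_sandwich[OF _ _ tendsto_const])
    show "\<forall>\<^sub>F t in at_top. 0 \<le> expectation (\<lambda>\<omega>. (norm (X t \<omega> - Xstar))\<^sup>2)"
      by (intro always_eventually allI Bochner_Integration.integral_nonneg) simp
    show "\<forall>\<^sub>F t in at_top. expectation (\<lambda>\<omega>. (norm (X t \<omega> - Xstar))\<^sup>2)
        \<le> exp (- \<alpha> * t) * (norm (x0 - Xstar))\<^sup>2"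
      using eventually_ge_at_top[of 0] by eventually_elim (rule second_moment_bound)
    have "filterlim (\<lambda>t. - (\<alpha> * t)) at_bot at_top"
      using filterlim_tendsto_pos_mult_at_top[OF tendsto_const that filterlim_ident]
      by (subst filterlim_uminus_at_bot) simp
    then have "((\<lambda>t. exp (- \<alpha> * t)) \<longlongrightarrow> 0) at_top"
      by (intro filterlim_compose[OF exp_at_bot]) simp
    then show "((\<lambda>t. exp (- \<alpha> * t) * (norm (x0 - Xstar))\<^sup>2) \<longlongrightarrow> 0) at_top"
      by (rule tendsto_mult_left_zero)
  qed
  \<comment> \<open>For a nonpositive denominator every h > 0 gives a positive rate; otherwise the
    strict inequality is essential. At equality \<alpha> = 0, and the limit can fail: for F =
    (\<mu>/2) |x|^2 with L = \<mu>, K = \<mu>^2 and d \<ge> 3 the estimates are equalities and the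
    second moment stays constant.\<close>
  have "\<alpha> > 0"
    if "(real CARD('n) - 1) * L\<^sup>2 - K \<le> 0 \<or> h < 2 * \<mu> / ((real CARD('n) - 1) * L\<^sup>2 - K)"
  proof (cases "(real CARD('n) - 1) * L\<^sup>2 - K \<le> 0")
    case True
    then have "h * ((real CARD('n) - 1) * L\<^sup>2 - K) \<le> 0" using h by (simp add: mult_nonneg_nonpos)
    then show ?thesis using pos(2) by (simp add: alpha)
  next
    case False
    then show ?thesis using that by (simp add: alpha pos_less_divide_eq)
  qed
  then show ?thesis using second_moment_bound lim by blast
qed

end
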